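(* Let $\mathfrak T$ be a genus zero uniformizing orbifold defined by the Fuchsian equation $[x,\tau]=\mathcal Q(x)$ having only parabolic singularities $x=E_k$. Then the expression $$\Gamma=\frac{d}{d\tau}\ln\dot x$$ is an analytic connection (respecting the factor topology on $\overline{\mathbb H^+/\mathfrak G_x}$) everywhere holomorphic on $\mathbb H^+\cup\{\infty\}$. It satisfies a 3rd order polynomial ODE $\Xi(\dddot\Gamma,\ddot\Gamma,\dot\Gamma,\Gamma)=0$ with constant coefficients. Any other analytic connection also satisfies an ODE of such a kind. General solutions to these equations are constructed by the scheme $$\Gamma(\tau)\;\mapsto\;\frac{\Gamma\big(\frac{a\tau+b}{c\tau+d}\big)}{(c\tau+d)^2}-\frac{2c}{c\tau+d},\qquad ad-bc=1.$$
   Context: $\mathbb H^+$ is the upper half-plane; dots are $\tau$-derivatives; $[x,\tau]=\frac{\dddot x}{\dot x^3}-\frac32\frac{\ddot x^2}{\dot x^4}$. The equation $[x,\tau]=\mathcal Q(x)$, $\mathcal Q$ rational, is identified with the linear Fuchsian equation $\Psi_{xx}=\frac12\mathcal Q(x)\Psi$, $\tau=\Psi_1/\Psi_2$ being a ratio of two independent solutions. It defines a uniformizing orbifold when its monodromy group $\mathfrak G_x$ (acting on $\tau$) is a Fuchsian group of first kind on $\mathbb H^+$ and the inverse function $x=\chi(\tau)$ is a single-valued automorphic function on $\mathbb H^+$ (a Hauptmodul of the genus-zero orbifold $\mathbb H^+/\mathfrak G_x$). A singularity $x=E$ is parabolic if $\mathcal Q(x)=-\frac12\frac1{(x-E)^2}+\cdots$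 near it, so $x$ behaves like $E+a\,e^{\pi i\tau}+\cdots$ (or with $e^{-\pi i/(\tau-\tau_0)}$ at a real point $\tau_0$). At $\tau\to i\infty$ holomorphy is understood in the local parameter $q=e^{\pi i\tau}$. An analytic connection (compatible with scalars on the orbifold) is a function $\Gamma(\tau)$ on $\mathbb H^+$ obeying $\Gamma\big(\frac{\alpha\tau+\beta}{\gamma\tau+\delta}\big)=(\gamma\tau+\delta)^2\Gamma(\tau)+2\gamma(\gamma\tau+\delta)$ for all $\big({\alpha\ \beta\atop\gamma\ \delta}\big)\in\mathfrak G_x$ and built as $\frac{d}{d\tau}\ln\big(R(x)\dot x\big)$ or, more generally, obtained from $\frac{d}{d\tau}\ln\dot x$ by adding a meromorphic differential $R(x)\dot x$ with $R$ rational.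
   Formalization: The point x=∞ is required to be one of the parabolic singularities (otherwise x has poles in H⁺ and Γ is not holomorphic), and holomorphy at τ=i∞ in q=e^{πiτ} is claimed when τ↦τ+2 belongs to the group (up to sign), with the analogous claim at every cusp. *)

theory Defs
  imports "HOL-Complex_Analysis.Complex_Analysis" "HOL-Computational_Algebra.Polynomial"
begin

definition upper_half_plane :: "complex set" ("\<H>") where
  "\<H> = {\<tau>. Im \<tau> > 0}"

definition ratfun :: "complex poly \<Rightarrow> complex poly \<Rightarrow> complex \<Rightarrow> complex" where
  "ratfun P N x = poly P x / poly N x"


section \<open>Moebius transformations and Fuchsian groups\<close>

definition moebius :: "complex^2^2 \<Rightarrow> complex \<Rightarrow> complex" where
  "moebius M \<tau> = (M$1$1 * \<tau> + M$1$2) / (M$2$1 * \<tau> + M$2$2)"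

definition SL2C :: "(complex^2^2) set" where
  "SL2C = {M. det M = 1}"

definition SL2R :: "(complex^2^2) set" where
  "SL2R = {M. det M = 1 \<and> (\<forall>i j. M$i$j \<in> \<real>)}"

definition fuchsian_group :: "(complex^2^2) set \<Rightarrow> bool" where
  "fuchsian_group G \<longleftrightarrow>
     G \<subseteq> SL2R \<and> mat 1 \<in> G \<and> (\<forall>A\<in>G. \<forall>B\<in>G. A ** B \<in> G) \<and> (\<forall>A\<in>G. matrix_inv A \<in> G) \<and>
     discrete G"

text \<open>First kind means that the limit set is the whole circle \<open>\<real> \<union> {\<infinity>}\<close>. It suffices to ask that
  every real number is a limit point, since the limit set is closed in that circle.\<close>

definition fuchsian_group_first_kind :: "(complex^2^2) set \<Rightarrow> bool" where
  "fuchsian_group_first_kind G \<longleftrightarrow>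
     fuchsian_group G \<and>
     (\<forall>t::real. \<exists>z\<in>\<H>. complex_of_real t islimpt ((\<lambda>M. moebius M z) ` G))"


section \<open>The equation \<open>[x,\<tau>] = Q(x)\<close> and its monodromy group\<close>

definition schwarz_bracket :: "(complex \<Rightarrow> complex) \<Rightarrow> complex \<Rightarrow> complex" where
  "schwarz_bracket x \<tau> =
     (deriv ^^ 3) x \<tau> / (deriv x \<tau>)^3 - 3/2 * ((deriv ^^ 2) x \<tau>)^2 / (deriv x \<tau>)^4"

definition parabolic_at :: "(complex \<Rightarrow> complex) \<Rightarrow> complex \<Rightarrow> bool" where
  "parabolic_at Q E \<longleftrightarrow> ((\<lambda>x. (x - E)^2 * Q x) \<longlongrightarrow> - 1/2) (at E)"

text \<open>At \<open>x = \<infinity>\<close> the condition \<open>Q(x) = - 1/2 x\<^sup>-\<^sup>2 + \<dots>\<close> says, as at a finite parabolic point, that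
  the two exponents of \<open>\<Psi>\<^sub>x\<^sub>x = Q \<Psi> / 2\<close> coincide, so that \<open>\<tau>\<close> is logarithmic there.\<close>

definition parabolic_at_infinity :: "(complex \<Rightarrow> complex) \<Rightarrow> bool" where
  "parabolic_at_infinity Q \<longleftrightarrow> ((\<lambda>x. x^2 * Q x) \<longlongrightarrow> - 1/2) at_infinity"

text \<open>For the equation \<open>\<Psi>\<^sub>x\<^sub>x = Q \<Psi> / 2\<close> without first-order term the point \<open>x = \<infinity>\<close> is never an
  ordinary point, so it is counted among the singularities. Together with parabolicity of the
  finite ones this makes the equation Fuchsian.\<close>

definition only_parabolic_singularities :: "complex poly \<Rightarrow> complex poly \<Rightarrow> bool" where
  "only_parabolic_singularities P N \<longleftrightarrow>
     (\<forall>E. poly N E = 0 \<longrightarrow> parabolic_at (ratfun P N) E) \<and> parabolic_at_infinity (ratfun P N)"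

definition fundamental_pair ::
  "(complex \<Rightarrow> complex) \<Rightarrow> complex \<Rightarrow> (complex \<Rightarrow> complex) \<Rightarrow> (complex \<Rightarrow> complex) \<Rightarrow> bool" where
  "fundamental_pair Q x0 \<Psi>1 \<Psi>2 \<longleftrightarrow>
     (\<exists>r>0. \<Psi>1 holomorphic_on ball x0 r \<and> \<Psi>2 holomorphic_on ball x0 r \<and>
        (\<forall>x\<in>ball x0 r. (deriv ^^ 2) \<Psi>1 x = 1/2 * Q x * \<Psi>1 x \<and>
                        (deriv ^^ 2) \<Psi>2 x = 1/2 * Q x * \<Psi>2 x)) \<and>
     deriv \<Psi>1 x0 * \<Psi>2 x0 - \<Psi>1 x0 * deriv \<Psi>2 x0 \<noteq> 0"

text \<open>\<open>F t\<close> represents the germ at \<open>\<gamma> t\<close> obtained by continuing the germ of \<open>f\<close> along \<open>\<gamma>\<close>.\<close>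

definition continuation_along ::
  "(real \<Rightarrow> complex) \<Rightarrow> (complex \<Rightarrow> complex) \<Rightarrow> (real \<Rightarrow> complex \<Rightarrow> complex) \<Rightarrow> bool" where
  "continuation_along \<gamma> f F \<longleftrightarrow>
     (\<forall>\<^sub>F x in nhds (\<gamma> 0). F 0 x = f x) \<and>
     (\<forall>t\<in>{0..1}. F t analytic_on {\<gamma> t} \<and>
        (\<forall>\<^sub>F s in at t within {0..1}. \<forall>\<^sub>F x in nhds (\<gamma> s). F s x = F t x))"

text \<open>Continuation along a loop sends \<open>(\<Psi>1, \<Psi>2)\<close> to \<open>M (\<Psi>1, \<Psi>2)\<close>, hence \<open>\<tau> = \<Psi>1 / \<Psi>2\<close> to
  \<open>moebius M \<tau>\<close>. The Wronskian is constant, so \<open>det M = 1\<close>.\<close>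

definition monodromy_group ::
  "complex set \<Rightarrow> complex \<Rightarrow> (complex \<Rightarrow> complex) \<Rightarrow> (complex \<Rightarrow> complex) \<Rightarrow> (complex^2^2) set" where
  "monodromy_group S x0 \<Psi>1 \<Psi>2 =
     {M. \<exists>\<gamma> F1 F2. path \<gamma> \<and> pathstart \<gamma> = x0 \<and> pathfinish \<gamma> = x0 \<and> path_image \<gamma> \<inter> S = {} \<and>
           continuation_along \<gamma> \<Psi>1 F1 \<and> continuation_along \<gamma> \<Psi>2 F2 \<and>
           (\<forall>\<^sub>F x in nhds x0. F1 1 x = M$1$1 * \<Psi>1 x + M$1$2 * \<Psi>2 x \<and>
                              F2 1 x = M$2$1 * \<Psi>1 x + M$2$2 * \<Psi>2 x)}"


section \<open>Uniformizing orbifolds\<close>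

text \<open>\<open>chi\<close> identifies the quotient of \<open>\<H>\<close> by \<open>G\<close> with the Riemann sphere punctured in parabolic
  singularities (the values at the cusps). A pole of \<open>chi\<close> is a point with value \<open>\<infinity>\<close>; the library
  convention for nicely meromorphic functions is that the HOL value there is \<open>0\<close>.\<close>

definition hauptmodul ::
  "(complex \<Rightarrow> complex) \<Rightarrow> (complex^2^2) set \<Rightarrow> (complex \<Rightarrow> complex) \<Rightarrow> bool" where
  "hauptmodul Q G chi \<longleftrightarrow>
     chi nicely_meromorphic_on \<H> \<and>
     (\<forall>M\<in>G. \<forall>\<tau>\<in>\<H>. chi (moebius M \<tau>) = chi \<tau>) \<and>
     (\<forall>\<tau>1\<in>\<H>. \<forall>\<tau>2\<in>\<H>. chi \<tau>1 = chi \<tau>2 \<and> (is_pole chi \<tau>1 \<longleftrightarrow> is_pole chi \<tau>2) \<longrightarrow>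
        (\<exists>M\<in>G. \<tau>2 = moebius M \<tau>1)) \<and>
     (\<forall>x. \<not> parabolic_at Q x \<longrightarrow> (\<exists>\<tau>\<in>\<H>. \<not> is_pole chi \<tau> \<and> chi \<tau> = x)) \<and>
     (\<not> parabolic_at_infinity Q \<longrightarrow> (\<exists>\<tau>\<in>\<H>. is_pole chi \<tau>))"

text \<open>\<open>chi\<close> is the inverse of \<open>\<tau> = \<Psi>1 / \<Psi>2\<close>. It is enough to say so for the germ at \<open>x0\<close>, because
  \<open>\<H>\<close> is connected.\<close>

definition uniformizing_orbifold ::
  "complex poly \<Rightarrow> complex poly \<Rightarrow> (complex^2^2) set \<Rightarrow> (complex \<Rightarrow> complex) \<Rightarrow> bool" where
  "uniformizing_orbifold P N G chi \<longleftrightarrow>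
     (\<exists>x0 \<Psi>1 \<Psi>2. poly N x0 \<noteq> 0 \<and> fundamental_pair (ratfun P N) x0 \<Psi>1 \<Psi>2 \<and>
        G = monodromy_group {x. poly N x = 0} x0 \<Psi>1 \<Psi>2 \<and>
        (\<forall>\<^sub>F x in nhds x0. \<Psi>1 x / \<Psi>2 x \<in> \<H> \<and> chi (\<Psi>1 x / \<Psi>2 x) = x)) \<and>
     fuchsian_group_first_kind G \<and>
     hauptmodul (ratfun P N) G chi \<and>
     (\<forall>\<^sub>\<approx>\<tau>\<in>\<H>. schwarz_bracket chi \<tau> = ratfun P N (chi \<tau>))"


section \<open>Analytic connections\<close>

text \<open>\<open>d/d\<tau> ln (dchi/d\<tau>)\<close>\<close>

definition canonical_connection :: "(complex \<Rightarrow> complex) \<Rightarrow> complex \<Rightarrow> complex" where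
  "canonical_connection chi \<tau> = (deriv ^^ 2) chi \<tau> / deriv chi \<tau>"

definition regular_points :: "(complex \<Rightarrow> complex) \<Rightarrow> complex set" where
  "regular_points \<Gamma> = {\<tau>\<in>\<H>. \<not> is_pole \<Gamma> \<tau>}"

text \<open>The second conjunct is the affine transformation law. The last one covers the form
  \<open>d/d\<tau> ln (R(chi) dchi/d\<tau>)\<close> by taking \<open>R'/R\<close> for the rational function \<open>p/q\<close>.\<close>

definition analytic_connection ::
  "(complex^2^2) set \<Rightarrow> (complex \<Rightarrow> complex) \<Rightarrow> (complex \<Rightarrow> complex) \<Rightarrow> bool" where
  "analytic_connection G chi \<Gamma> \<longleftrightarrow>
     \<Gamma> nicely_meromorphic_on \<H> \<and>
     (\<forall>M\<in>G. \<forall>\<tau>\<in>regular_points \<Gamma>.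
        \<Gamma> (moebius M \<tau>) =
          (M$2$1 * \<tau> + M$2$2)^2 * \<Gamma> \<tau> + 2 * M$2$1 * (M$2$1 * \<tau> + M$2$2)) \<and>
     (\<exists>p q. q \<noteq> 0 \<and>
        (\<forall>\<^sub>\<approx>\<tau>\<in>\<H>. \<Gamma> \<tau> = canonical_connection chi \<tau> + ratfun p q (chi \<tau>) * deriv chi \<tau>))"

definition connection_act :: "complex^2^2 \<Rightarrow> (complex \<Rightarrow> complex) \<Rightarrow> complex \<Rightarrow> complex" where
  "connection_act M \<Gamma> \<tau> =
     \<Gamma> (moebius M \<tau>) / (M$2$1 * \<tau> + M$2$2)^2 - 2 * M$2$1 / (M$2$1 * \<tau> + M$2$2)"

definition act_domain :: "complex^2^2 \<Rightarrow> complex set \<Rightarrow> complex set" where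
  "act_domain M U = {\<tau>. M$2$1 * \<tau> + M$2$2 \<noteq> 0 \<and> moebius M \<tau> \<in> U}"

definition holomorphic_at_i_infinity :: "(complex \<Rightarrow> complex) \<Rightarrow> bool" where
  "holomorphic_at_i_infinity f \<longleftrightarrow>
     (\<exists>r>0. \<exists>g. g holomorphic_on ball 0 r \<and>
        (\<forall>\<tau>\<in>\<H>. exp (pi * \<i> * \<tau>) \<in> ball 0 r \<longrightarrow> f \<tau> = g (exp (pi * \<i> * \<tau>))))"

text \<open>\<open>M\<infinity>\<close> is a cusp of \<open>G\<close>, and \<open>M\<close> is scaled so that \<open>exp (\<pi>i M\<^sup>-\<^sup>1 \<tau>)\<close> is a function on the
  quotient near it. For \<open>M = mat 1\<close> this is the cusp \<open>i\<infinity>\<close> with the parameter \<open>exp (\<pi>i\<tau>)\<close>; for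
  \<open>M \<tau> = \<tau>\<^sub>0 - 1/\<tau>\<close> it is the real point \<open>\<tau>\<^sub>0\<close> with the parameter \<open>exp (- \<pi>i / (\<tau> - \<tau>\<^sub>0))\<close>. As \<open>G\<close>
  acts through Moebius transformations, signs of matrices are irrelevant.\<close>

definition normalized_cusp :: "(complex^2^2) set \<Rightarrow> complex^2^2 \<Rightarrow> bool" where
  "normalized_cusp G M \<longleftrightarrow>
     M \<in> SL2R \<and>
     (let A = M ** vector [vector [1, 2], vector [0, 1]] ** matrix_inv M in A \<in> G \<or> - A \<in> G)"


section \<open>Third-order polynomial differential equations\<close>

text \<open>Polynomials in several variables are nested univariate ones; the outermost variable
  corresponds to the highest derivative.\<close>

definition eval3 :: "complex poly poly poly \<Rightarrow> complex \<Rightarrow> complex \<Rightarrow> complex \<Rightarrow> complex" where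
  "eval3 D y2 y1 y0 = poly (poly (poly D [:[:y2:]:]) [:y1:]) y0"

definition eval4 ::
  "complex poly poly poly poly \<Rightarrow> complex \<Rightarrow> complex \<Rightarrow> complex \<Rightarrow> complex \<Rightarrow> complex" where
  "eval4 \<Xi> y3 y2 y1 y0 = eval3 (poly \<Xi> [:[:[:y3:]:]:]) y2 y1 y0"

definition solves_ode ::
  "complex poly poly poly poly \<Rightarrow> complex set \<Rightarrow> (complex \<Rightarrow> complex) \<Rightarrow> bool" where
  "solves_ode \<Xi> U f \<longleftrightarrow>
     open U \<and> f holomorphic_on U \<and>
     (\<forall>\<tau>\<in>U. eval4 \<Xi> ((deriv ^^ 3) f \<tau>) ((deriv ^^ 2) f \<tau>) (deriv f \<tau>) (f \<tau>) = 0)"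

text \<open>The transforms of \<open>\<Gamma>\<close> under \<open>SL2C\<close> form the general solution: all of them are solutions, every
  generic initial datum \<open>(y0, y1, y2)\<close> at any \<open>\<tau>0\<close> is met by one of them, and every solution with
  generic initial datum is locally one of them. Generic means outside a proper algebraic subset
  \<open>D = 0\<close> of the space of initial data.\<close>

definition general_solution_by_transforms ::
  "complex poly poly poly poly \<Rightarrow> complex set \<Rightarrow> (complex \<Rightarrow> complex) \<Rightarrow> bool" where
  "general_solution_by_transforms \<Xi> U \<Gamma> \<longleftrightarrow>
     (\<forall>M\<in>SL2C. solves_ode \<Xi> (act_domain M U) (connection_act M \<Gamma>)) \<and>
     (\<exists>D. D \<noteq> 0 \<and>
        (\<forall>\<tau>0 y0 y1 y2. eval3 D y2 y1 y0 \<noteq> 0 \<longrightarrow>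
           (\<exists>M\<in>SL2C. \<tau>0 \<in> act_domain M U \<and> connection_act M \<Gamma> \<tau>0 = y0 \<and>
              deriv (connection_act M \<Gamma>) \<tau>0 = y1 \<and>
              (deriv ^^ 2) (connection_act M \<Gamma>) \<tau>0 = y2)) \<and>
        (\<forall>V f. solves_ode \<Xi> V f \<longrightarrow>
           (\<forall>\<tau>0\<in>V. eval3 D ((deriv ^^ 2) f \<tau>0) (deriv f \<tau>0) (f \<tau>0) \<noteq> 0 \<longrightarrow>
              (\<exists>M\<in>SL2C. \<tau>0 \<in> act_domain M U \<and>
                 (\<forall>\<^sub>F \<tau> in nhds \<tau>0. f \<tau> = connection_act M \<Gamma> \<tau>)))))"

end

theory Submission
  imports "Subresultants.Subresultant_Gcd" "HOL-Computational_Algebra.Field_as_Ring"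
    "HOL-Computational_Algebra.Fundamental_Theorem_Algebra" Defs
begin

text \<open>Write \<open>x\<close> for the Hauptmodul \<open>chi\<close>, \<open>Q = P/N\<close>, and let \<open>{x,\<tau>}\<close> be the Schwarzian derivative,
  so that the equation reads \<open>{x,\<tau>} = Q(x) x'\<^sup>2\<close>.

  Holomorphy in the interior. Where \<open>x = e + k (\<tau> - \<tau>\<^sub>0)\<^sup>n\<close> (or \<open>x\<close> has a pole), comparing the
  coefficients of \<open>(\<tau> - \<tau>\<^sub>0)\<^sup>-\<^sup>2\<close> gives \<open>(1 - n\<^sup>2)/2 = \<kappa> n\<^sup>2\<close> with \<open>\<kappa> = -1/2\<close> if the value is a parabolic
  point and \<open>\<kappa> = 0\<close> otherwise. The first case is impossible and the second forces \<open>n = 1\<close>. Hence \<open>x\<close> is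
  holomorphic on the upper half-plane, \<open>x'\<close> has no zeros and \<open>x\<close> omits the roots of \<open>N\<close>
  (\<open>hauptmodul_regular\<close>), so \<open>x''/x'\<close> is holomorphic. Its transformation law is the differentiated
  invariance of \<open>x\<close>.

  Holomorphy at the cusps. Near a cusp \<open>x = F(q)\<close>, and \<open>F\<close> omits the roots of \<open>N\<close>, of which there are
  at least two (\<open>two_cusps\<close>). By the great Picard theorem \<open>F' = q\<^sup>m h(q)\<close> with \<open>h(0) \<noteq> 0\<close>, and
  \<open>x''/x' = \<pi>i (1 + q F''/F')\<close> is holomorphic at \<open>q = 0\<close> (\<open>connection_holomorphic_at_cusp\<close>).

  The differential equation. For a connection \<open>f = x''/x' + R(x) x'\<close> put \<open>a = f' - f\<^sup>2/2\<close>,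
  \<open>b = a' - 2 f a\<close>, \<open>c = b' - 3 f b\<close>. Since these are covariant derivatives, they equal \<open>S2(x) \<rho>\<^sup>2\<close>,
  \<open>S3(x) \<rho>\<^sup>3\<close>, \<open>S4(x) \<rho>\<^sup>4\<close> with polynomials \<open>S2, S3, S4\<close> and \<open>\<rho> = x'/den(x)\<close> (\<open>jets_of_conn\<close>). So
  \<open>b\<^sup>2/a\<^sup>3 = J(x)\<close> and \<open>c/a\<^sup>2 = L(x)\<close> are rational functions of \<open>x\<close>, and a resultant in \<open>x\<close> yields a
  polynomial relation between \<open>f, f', f'', f'''\<close>.

  Its general solution. Generic initial values \<open>f, f', f''\<close> determine \<open>x\<close> up to finitely many choices
  (from \<open>b\<^sup>2/a\<^sup>3\<close>), then \<open>x'\<close> (from \<open>b/a\<close>), then \<open>x''\<close> (from \<open>f\<close>); some transform \<open>x \<circ> M\<close> has any such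
  initial values because \<open>x\<close> takes every value that is not a root of \<open>N\<close>
  (\<open>initial_values_attained\<close>). Conversely, a solution \<open>f\<close> with
  generic jet gives a local function \<open>X\<close> with \<open>J(X) = b\<^sup>2/a\<^sup>3\<close> and \<open>L(X) = c/a\<^sup>2\<close> (\<open>holomorphic_branch\<close>).
  It follows that \<open>f = X''/X' + R(X) X'\<close> and \<open>{X,\<tau>} = Q(X) X'\<^sup>2\<close> (\<open>conn_of_jets\<close>), so \<open>x\<^sup>-\<^sup>1 \<circ> X\<close> has
  Schwarzian zero and is a Moebius transformation (\<open>schwarz_solution_is_moebius_transform\<close>).

  Why \<open>J\<close> is not constant. If it were, \<open>a = 1/h\<^sup>2\<close> for a polynomial \<open>h\<close> of degree at most 2, and
  \<open>\<bar>h(\<tau>)\<bar> / Im \<tau>\<close> would be invariant under the group; then \<open>h\<close> vanishes at every real limit point of an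
  orbit, hence on the whole real line (\<open>first_kind_no_invariant_quadratic\<close>). The degenerate case
  \<open>S2 = 0\<close> is a Riccati equation \<open>R' - R\<^sup>2/2 = - Q\<close> for the rational function \<open>R\<close>: the residues of \<open>R\<close> are
  \<open>-1\<close> at the roots of \<open>N\<close> and \<open>-2\<close> at other poles, and they add up to \<open>-1\<close>, which contradicts the
  presence of two roots (\<open>riccati_no_rational_solution\<close>).\<close>

(* The symbol $ is reserved for the entries of matrices. *)
no_notation fps_nth (infixl "$" 75)
no_notation Matrix.vec_index (infixl "$" 100)

section \<open>Elimination of one variable between two polynomial relations\<close>

text \<open>The variable \<open>y\<^sub>k\<close> stands for the \<open>k\<close>-th derivative of a connection \<open>f\<close>. Then \<open>jet_a\<close> is \<open>f' - f\<^sup>2/2\<close>, and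
  \<open>jet_b\<close>, \<open>jet_c\<close> are its first and second covariant derivatives \<open>a' - 2 f a\<close> and \<open>b' - 3 f b\<close>, written out as
  polynomials in the jet of \<open>f\<close>. They have weights 4, 6 and 8 under Moebius transformations.\<close>
definition jet_a :: "'a::field \<Rightarrow> 'a \<Rightarrow> 'a" where
  "jet_a y1 y0 = y1 - y0\<^sup>2 / 2"
definition jet_b :: "'a::field \<Rightarrow> 'a \<Rightarrow> 'a \<Rightarrow> 'a" where
  "jet_b y2 y1 y0 = y2 - 3 * y0 * y1 + y0 ^ 3"
definition jet_c :: "'a::field \<Rightarrow> 'a \<Rightarrow> 'a \<Rightarrow> 'a \<Rightarrow> 'a" where
  "jet_c y3 y2 y1 y0 = y3 - 6 * y0 * y2 - 3 * y1\<^sup>2 + 12 * y0\<^sup>2 * y1 - 3 * y0 ^ 4"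

lemma common_root_iff_resultant:
  fixes F G :: "complex poly"
  assumes "degree F + degree G > 0" "F \<noteq> 0"
  shows "resultant F G = 0 \<longleftrightarrow> (\<exists>x. poly F x = 0 \<and> poly G x = 0)"
proof
  assume "resultant F G = 0"
  hence "degree (gcd F G) \<noteq> 0" by (simp add: resultant_0_gcd)
  then obtain x where "poly (gcd F G) x = 0"
    using alg_closed_imp_poly_has_root[of "gcd F G"] by auto
  thus "\<exists>x. poly F x = 0 \<and> poly G x = 0"
    by (meson dvd_trans gcd_dvd1 gcd_dvd2 poly_eq_0_iff_dvd)
next
  assume "\<exists>x. poly F x = 0 \<and> poly G x = 0"
  then obtain x where "[:-x,1:] dvd F" "[:-x,1:] dvd G" by (auto simp: poly_eq_0_iff_dvd)
  hence d: "[:-x,1:] dvd gcd F G" by simp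
  have "gcd F G \<noteq> 0" using assms by auto
  hence "degree (gcd F G) \<ge> degree [:-x,1:]" using d by (rule dvd_imp_degree_le[rotated])
  thus "resultant F G = 0" by (simp add: resultant_0_gcd)
qed

text \<open>A resultant commutes with a specialization \<open>h\<close> of the coefficients only if \<open>h\<close> preserves both degrees.
  Adding \<open>x\<^sup>k F\<close> to \<open>G\<close> with \<open>k > degree G\<close> keeps the common roots and gives the second polynomial the leading
  coefficient of \<open>F\<close>, so that only this one has to survive.\<close>
lemma specialized_resultant_zero_iff:
  fixes h :: "'a::idom \<Rightarrow> complex" and F G :: "'a poly"
  assumes "comm_ring_hom h" and lc: "h (lead_coeff F) \<noteq> 0"
  defines "G' \<equiv> G + monom 1 (Suc (degree G)) * F"
  shows "h (resultant F G') = 0 \<longleftrightarrow> (\<exists>x. poly (map_poly h F) x = 0 \<and> poly (map_poly h G) x = 0)"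
proof -
  interpret h: comm_ring_hom h by fact
  interpret hp: map_poly_comm_ring_hom h ..
  let ?K = "Suc (degree G)"
  have F0: "F \<noteq> 0" using lc by auto
  have lc0: "lead_coeff F \<noteq> 0" using F0 by simp
  have dm: "degree (monom 1 ?K * F) = ?K + degree F"
    using F0 by (simp add: degree_mult_eq degree_monom_eq)
  have dG: "degree G' = ?K + degree F" unfolding G'_def
    using dm by (subst degree_add_eq_right) auto
  have lG: "lead_coeff G' = lead_coeff F"
    unfolding dG unfolding G'_def by (simp add: coeff_monom_mult coeff_eq_0)
  have dF': "degree (map_poly h F) = degree F" using lc
    by (metis h.hom_zero le_antisym degree_map_poly_le coeff_map_poly le_degree)
  have dG': "degree (map_poly h G') = degree G'" using lc lG
    by (metis h.hom_zero le_antisym degree_map_poly_le coeff_map_poly le_degree)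
  have "h (resultant F G') = resultant (map_poly h F) (map_poly h G')"
    using h.resultant_map_poly[OF dF' dG'] by simp
  also have "\<dots> = 0 \<longleftrightarrow> (\<exists>x. poly (map_poly h F) x = 0 \<and> poly (map_poly h G') x = 0)"
  proof (rule common_root_iff_resultant)
    show "degree (map_poly h F) + degree (map_poly h G') > 0" using dG' dG by simp
    have "coeff (map_poly h F) (degree F) \<noteq> 0" using lc by (subst coeff_map_poly) auto
    thus "map_poly h F \<noteq> 0" by fastforce
  qed
  also have "map_poly h G' = map_poly h G + monom 1 ?K * map_poly h F"
    unfolding G'_def by (simp add: hp.hom_add hp.hom_mult)
  finally show ?thesis by (auto simp: poly_monom)
qed

lemma eval4_comm_ring_hom: "comm_ring_hom (\<lambda>p. eval4 p y3 y2 y1 y0)"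
  by unfold_locales (auto simp: eval4_def eval3_def)

abbreviation const3 :: "complex \<Rightarrow> complex poly poly poly" where "const3 c \<equiv> [:[:[:c:]:]:]"
abbreviation const4 :: "complex \<Rightarrow> complex poly poly poly poly" where "const4 c \<equiv> [:const3 c:]"

lemma eval4_hom_simps [simp]:
  "eval4 (p + p') y3 y2 y1 y0 = eval4 p y3 y2 y1 y0 + eval4 p' y3 y2 y1 y0"
  "eval4 (p - p') y3 y2 y1 y0 = eval4 p y3 y2 y1 y0 - eval4 p' y3 y2 y1 y0"
  "eval4 (p * p') y3 y2 y1 y0 = eval4 p y3 y2 y1 y0 * eval4 p' y3 y2 y1 y0"
  "eval4 (p ^ n) y3 y2 y1 y0 = eval4 p y3 y2 y1 y0 ^ n"
  "eval4 0 y3 y2 y1 y0 = 0"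
  "eval4 [:0, 1:] y3 y2 y1 y0 = y3"
  "eval4 [:P:] y3 y2 y1 y0 = eval3 P y2 y1 y0"
  by (auto simp: eval4_def eval3_def poly_power)

lemma eval3_hom_simps [simp]:
  "eval3 (p + p') y2 y1 y0 = eval3 p y2 y1 y0 + eval3 p' y2 y1 y0"
  "eval3 (p - p') y2 y1 y0 = eval3 p y2 y1 y0 - eval3 p' y2 y1 y0"
  "eval3 (p * p') y2 y1 y0 = eval3 p y2 y1 y0 * eval3 p' y2 y1 y0"
  "eval3 (p ^ n) y2 y1 y0 = eval3 p y2 y1 y0 ^ n"
  "eval3 0 y2 y1 y0 = 0"
  "eval3 1 y2 y1 y0 = 1"
  "eval3 [:0, 1:] y2 y1 y0 = y2"
  "eval3 [:[:0, 1:]:] y2 y1 y0 = y1"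
  "eval3 [:[:[:0, 1:]:]:] y2 y1 y0 = y0"
  "eval3 (const3 e) y2 y1 y0 = e"
  by (auto simp: eval3_def poly_power)

lemma eval3_prod [simp]: "eval3 (prod f A) y2 y1 y0 = (\<Prod>e\<in>A. eval3 (f e) y2 y1 y0)"
  by (simp add: eval3_def poly_prod)

definition jet_a_poly :: "complex poly poly poly" where
  "jet_a_poly = [:[:0,1:]:] - const3 (1/2) * [:[:[:0,1:]:]:] ^ 2"
definition jet_b_poly :: "complex poly poly poly" where
  "jet_b_poly = [:0,1:] - const3 3 * [:[:[:0,1:]:]:] * [:[:0,1:]:] + [:[:[:0,1:]:]:] ^ 3"
definition jet_c_poly :: "complex poly poly poly poly" where
  "jet_c_poly = [:0,1:] + [: - const3 6 * [:[:[:0,1:]:]:] * [:0,1:] - const3 3 * [:[:0,1:]:] ^ 2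
     + const3 12 * [:[:[:0,1:]:]:] ^ 2 * [:[:0,1:]:] - const3 3 * [:[:[:0,1:]:]:] ^ 4 :]"

lemma eval3_uminus [simp]: "eval3 (- p) y2 y1 y0 = - eval3 p y2 y1 y0"
  by (simp add: eval3_def)

lemma eval_jet_polys [simp]:
  "eval3 jet_a_poly y2 y1 y0 = jet_a y1 y0"
  "eval3 jet_b_poly y2 y1 y0 = jet_b y2 y1 y0"
  "eval4 jet_c_poly y3 y2 y1 y0 = jet_c y3 y2 y1 y0"
  unfolding jet_a_poly_def jet_b_poly_def jet_c_poly_def jet_a_def jet_b_def jet_c_def
  by (simp_all del: pCons_one minus_pCons mult_pCons_left mult_pCons_right add_pCons diff_pCons)

text \<open>\<open>\<Xi>\<close> is the resultant in \<open>x\<close> of \<open>b\<^sup>2 j2 - a\<^sup>3 j1\<close> and \<open>c k1 - a\<^sup>2 k2\<close>, whose coefficients are polynomials in the jet.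
  The exceptional value \<open>e\<close> of \<open>b\<^sup>2/a\<^sup>3\<close> is the value of \<open>j1/j2\<close> at \<open>x = \<infinity>\<close>, if finite; a root is lost there.\<close>
lemma elimination:
  fixes j1 j2 k1 k2 :: "complex poly"
  assumes nz: "j1 \<noteq> 0 \<or> j2 \<noteq> 0"
  obtains \<Xi> e where
    "\<And>y3 y2 y1 y0. \<lbrakk>jet_a y1 y0 \<noteq> 0; jet_b y2 y1 y0 \<noteq> 0; (jet_b y2 y1 y0)\<^sup>2 \<noteq> e * jet_a y1 y0 ^ 3\<rbrakk> \<Longrightarrow>
       eval4 \<Xi> y3 y2 y1 y0 = 0 \<longleftrightarrow>
       (\<exists>x. (jet_b y2 y1 y0)\<^sup>2 * poly j2 x = jet_a y1 y0 ^ 3 * poly j1 x \<and>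
            jet_c y3 y2 y1 y0 * poly k1 x = (jet_a y1 y0)\<^sup>2 * poly k2 x)"
    "\<And>u. u \<noteq> e \<Longrightarrow> degree (smult u j2 - j1) = max (degree j1) (degree j2)"
proof -
  define m where "m = max (degree j1) (degree j2)"
  define \<alpha> \<beta> where "\<alpha> = coeff j2 m" and "\<beta> = coeff j1 m"
  have ab: "\<alpha> \<noteq> 0 \<or> \<beta> \<noteq> 0"
  proof (cases "degree j1 \<le> degree j2")
    case True
    hence "\<alpha> = lead_coeff j2" by (simp add: \<alpha>_def m_def)
    moreover have "\<beta> = lead_coeff j1" if "j2 = 0" using that True by (simp add: \<beta>_def m_def)
    ultimately show ?thesis using nz by (cases "j2 = 0") simp_all
  next
    case False
    hence "\<beta> = lead_coeff j1" by (simp add: \<beta>_def m_def)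
    moreover have "j1 \<noteq> 0" using False by auto
    ultimately show ?thesis by simp
  qed
  define e where "e = \<beta> / \<alpha>"
  define lift where "lift p = map_poly const4 p" for p :: "complex poly"
  define F where "F = smult [:jet_b_poly ^ 2:] (lift j2) - smult [:jet_a_poly ^ 3:] (lift j1)"
  \<comment> \<open>The polynomials in \<open>x\<close> have their coefficients in the ring of polynomials in the jet.\<close>
  define G where "G = smult jet_c_poly (lift k1) - smult [:jet_a_poly ^ 2:] (lift k2)"
  define \<Xi> where "\<Xi> = resultant F (G + monom 1 (Suc (degree G)) * F)"
  have dl: "degree (lift p) \<le> degree p" for p unfolding lift_def by (rule degree_map_poly_le)
  have cl: "coeff (lift p) i = const4 (coeff p i)" for p i
    unfolding lift_def by (subst coeff_map_poly) auto
  show ?thesis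
  proof (rule that[of e \<Xi>])
    fix y3 y2 y1 y0 :: complex
    let ?h = "\<lambda>p. eval4 p y3 y2 y1 y0"
    let ?a = "jet_a y1 y0" and ?b = "jet_b y2 y1 y0" and ?c = "jet_c y3 y2 y1 y0"
    assume a: "?a \<noteq> 0" and b: "?b \<noteq> 0" and e: "?b\<^sup>2 \<noteq> e * ?a ^ 3"
    interpret h: comm_ring_hom ?h by (rule eval4_comm_ring_hom)
    interpret hp: map_poly_comm_ring_hom ?h ..
    have hl: "map_poly ?h (lift p) = p" for p
      unfolding lift_def by (rule poly_eqI) (simp add: coeff_map_poly)
    have hc: "?h (coeff F m) = ?b\<^sup>2 * \<alpha> - ?a ^ 3 * \<beta>"
      unfolding F_def by (simp add: cl \<alpha>_def \<beta>_def del: mult_pCons_left mult_pCons_right diff_pCons)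
    also have "\<dots> \<noteq> 0"
    proof (cases "\<alpha> = 0")
      case True thus ?thesis using ab a by simp
    next
      case False thus ?thesis using e unfolding e_def by (simp add: field_simps)
    qed
    finally have hm: "?h (coeff F m) \<noteq> 0" .
    hence "coeff F m \<noteq> 0" by auto
    moreover have "degree F \<le> m" unfolding F_def m_def
      by (intro degree_diff_le order.trans[OF degree_smult_le] order.trans[OF dl]) auto
    ultimately have "degree F = m" by (simp add: le_antisym le_degree)
    hence "?h (lead_coeff F) \<noteq> 0" using hm by simp
    from specialized_resultant_zero_iff[OF eval4_comm_ring_hom this, of G]
    have "?h \<Xi> = 0 \<longleftrightarrow> (\<exists>x. poly (map_poly ?h F) x = 0 \<and> poly (map_poly ?h G) x = 0)"
      unfolding \<Xi>_def .
    moreover have "map_poly ?h F = smult (?b\<^sup>2) j2 - smult (?a ^ 3) j1"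
      unfolding F_def hp.hom_minus h.map_poly_hom_smult hl by simp
    moreover have "map_poly ?h G = smult ?c k1 - smult (?a\<^sup>2) k2"
      unfolding G_def hp.hom_minus h.map_poly_hom_smult hl by simp
    ultimately show "?h \<Xi> = 0 \<longleftrightarrow> (\<exists>x. ?b\<^sup>2 * poly j2 x = ?a ^ 3 * poly j1 x \<and>
            ?c * poly k1 x = ?a\<^sup>2 * poly k2 x)" by simp
  next
    fix u assume u: "u \<noteq> e"
    have "coeff (smult u j2 - j1) m = u * \<alpha> - \<beta>" by (simp add: \<alpha>_def \<beta>_def)
    also have "\<dots> \<noteq> 0" using u ab unfolding e_def by (cases "\<alpha> = 0") (auto simp: field_simps)
    finally have "degree (smult u j2 - j1) \<ge> m" by (rule le_degree)
    moreover have "degree (smult u j2 - j1) \<le> m" unfolding m_def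
      by (intro degree_diff_le order.trans[OF degree_smult_le]) auto
    ultimately show "degree (smult u j2 - j1) = max (degree j1) (degree j2)" unfolding m_def by (rule antisym[rotated])
  qed
qed

text \<open>Finitely many values of \<open>b\<^sup>2/a\<^sup>3\<close> are excluded by the polynomial condition \<open>a b \<Prod>(b\<^sup>2 - e a\<^sup>3) \<noteq> 0\<close> on the jet.\<close>
lemma generic_locus:
  assumes "finite B"
  obtains D where "D \<noteq> 0"
    "\<And>y2 y1 y0. eval3 D y2 y1 y0 \<noteq> 0 \<longleftrightarrow>
       jet_a y1 y0 \<noteq> 0 \<and> jet_b y2 y1 y0 \<noteq> 0 \<and> (\<forall>e\<in>B. (jet_b y2 y1 y0)\<^sup>2 \<noteq> e * jet_a y1 y0 ^ 3)"
    "\<exists>y2 y1 y0. eval3 D y2 y1 y0 \<noteq> 0"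
proof -
  define D where "D = jet_a_poly * jet_b_poly * (\<Prod>e\<in>B. jet_b_poly\<^sup>2 - const3 e * jet_a_poly ^ 3)"
  have eq: "eval3 D y2 y1 y0 \<noteq> 0 \<longleftrightarrow>
       jet_a y1 y0 \<noteq> 0 \<and> jet_b y2 y1 y0 \<noteq> 0 \<and> (\<forall>e\<in>B. (jet_b y2 y1 y0)\<^sup>2 \<noteq> e * jet_a y1 y0 ^ 3)" for y2 y1 y0
    unfolding D_def using assms by (simp del: mult_pCons_left mult_pCons_right)
  have "finite (insert 0 (csqrt ` B \<union> (\<lambda>e. - csqrt e) ` B))" using assms by simp
  then obtain y :: complex where y: "y \<notin> insert 0 (csqrt ` B \<union> (\<lambda>e. - csqrt e) ` B)"
    using ex_new_if_finite[OF infinite_UNIV_char_0] by blast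
  have "y\<^sup>2 \<noteq> e" if "e \<in> B" for e
  proof
    assume "y\<^sup>2 = e"
    hence "y\<^sup>2 = (csqrt e)\<^sup>2" by simp
    hence "y = csqrt e \<or> y = - csqrt e" by (simp only: power2_eq_iff)
    thus False using y that by auto
  qed
  hence "eval3 D y 1 0 \<noteq> 0" using y by (subst eq) (auto simp: jet_a_def jet_b_def)
  hence ex: "\<exists>y2 y1 y0. eval3 D y2 y1 y0 \<noteq> 0" by blast
  hence "D \<noteq> 0" by auto
  thus ?thesis by (rule that[OF _ eq ex])
qed

section \<open>The jet of a connection and its invariants\<close>

lemma iterated_deriv_eq:
  fixes f :: "complex \<Rightarrow> complex"
  assumes "open V" "\<tau> \<in> V"
    and "\<And>t. t \<in> V \<Longrightarrow> (f has_field_derivative f1 t) (at t)"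
    and "\<And>t. t \<in> V \<Longrightarrow> (f1 has_field_derivative f2 t) (at t)"
    and "\<And>t. t \<in> V \<Longrightarrow> (f2 has_field_derivative f3 t) (at t)"
  shows "deriv f \<tau> = f1 \<tau>" "(deriv ^^ 2) f \<tau> = f2 \<tau>" "(deriv ^^ 3) f \<tau> = f3 \<tau>"
proof -
  have 1: "deriv f t = f1 t" if "t \<in> V" for t using assms(3)[OF that] by (rule DERIV_imp_deriv)
  have "(deriv f has_field_derivative f2 t) (at t)" if "t \<in> V" for t
    by (rule has_field_derivative_transform_within_open[OF assms(4)[OF that] assms(1) that]) (simp add: 1)
  hence 2: "deriv (deriv f) t = f2 t" if "t \<in> V" for t using that by (intro DERIV_imp_deriv)
  have "(deriv (deriv f) has_field_derivative f3 t) (at t)" if "t \<in> V" for t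
    by (rule has_field_derivative_transform_within_open[OF assms(5)[OF that] assms(1) that]) (simp add: 2)
  hence 3: "deriv (deriv (deriv f)) t = f3 t" if "t \<in> V" for t using that by (intro DERIV_imp_deriv)
  show "deriv f \<tau> = f1 \<tau>" "(deriv ^^ 2) f \<tau> = f2 \<tau>" "(deriv ^^ 3) f \<tau> = f3 \<tau>"
    using 1[OF assms(2)] 2[OF assms(2)] 3[OF assms(2)] by (simp_all add: eval_nat_numeral)
qed

lemma holomorphic_iterated_deriv:
  assumes "open V" "f holomorphic_on V" "\<tau> \<in> V"
  shows "(f has_field_derivative deriv f \<tau>) (at \<tau>)"
    "(deriv f has_field_derivative (deriv ^^ 2) f \<tau>) (at \<tau>)"
    "((deriv ^^ 2) f has_field_derivative (deriv ^^ 3) f \<tau>) (at \<tau>)"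
  using holomorphic_derivI[OF assms(2,1,3)]
    holomorphic_derivI[OF holomorphic_deriv[OF assms(2,1)] assms(1,3)]
    holomorphic_derivI[OF holomorphic_higher_deriv[OF assms(2,1), of 2] assms(1,3)]
  by (simp_all add: eval_nat_numeral)

abbreviation "jet_a_at f t \<equiv> jet_a (deriv f t) (f t)"
abbreviation "jet_b_at f t \<equiv> jet_b ((deriv ^^ 2) f t) (deriv f t) (f t)"
abbreviation "jet_c_at f t \<equiv> jet_c ((deriv ^^ 3) f t) ((deriv ^^ 2) f t) (deriv f t) (f t)"

text \<open>Solving \<open>a = f' - f\<^sup>2/2\<close>, \<open>a' = b + 2 f a\<close>, \<open>b' = c + 3 f b\<close> successively for \<open>f'\<close>, \<open>f''\<close>, \<open>f'''\<close> inverts the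
  definition of the three jet polynomials.\<close>
lemma jet_triangular:
  fixes F a b c :: complex
  defines "y1 \<equiv> a + F\<^sup>2 / 2"
  defines "y2 \<equiv> b + 2 * F * a + F * y1"
  shows "jet_a y1 F = a" "jet_b y2 y1 F = b"
    "jet_c (c + 3 * F * b + 2 * y1 * a + 2 * F * (b + 2 * F * a) + y1\<^sup>2 + F * y2) y2 y1 F = c"
proof -
  show a: "jet_a y1 F = a" by (simp add: jet_a_def y1_def)
  have "jet_b y2 y1 F = b + 2 * F * (a - y1) + F ^ 3" by (simp add: jet_b_def y2_def algebra_simps)
  also have "a - y1 = - (F\<^sup>2 / 2)" by (simp add: y1_def)
  finally show "jet_b y2 y1 F = b" by (simp add: power2_eq_square power3_eq_cube)
  have a': "a = y1 - F\<^sup>2 / 2" by (simp add: y1_def)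
  show "jet_c (c + 3 * F * b + 2 * y1 * a + 2 * F * (b + 2 * F * a) + y1\<^sup>2 + F * y2) y2 y1 F = c"
    unfolding jet_c_def y2_def a' by (simp add: algebra_simps power2_eq_square power4_eq_xxxx)
qed

lemma jet_derivatives:
  assumes "open V" "f holomorphic_on V" "\<tau> \<in> V"
  defines "a \<equiv> \<lambda>t. jet_a_at f t"
    and "b \<equiv> \<lambda>t. jet_b_at f t"
    and "c \<equiv> \<lambda>t. jet_c_at f t"
  shows "(f has_field_derivative a \<tau> + (f \<tau>)\<^sup>2 / 2) (at \<tau>)"
    "(a has_field_derivative b \<tau> + 2 * f \<tau> * a \<tau>) (at \<tau>)"
    "(b has_field_derivative c \<tau> + 3 * f \<tau> * b \<tau>) (at \<tau>)"
proof -
  note d = holomorphic_iterated_deriv[OF assms(1-3)]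
  show "(f has_field_derivative a \<tau> + (f \<tau>)\<^sup>2 / 2) (at \<tau>)"
    using d(1) by (simp add: a_def jet_a_def)
  show "(a has_field_derivative b \<tau> + 2 * f \<tau> * a \<tau>) (at \<tau>)"
    unfolding a_def b_def jet_a_def jet_b_def
    by (rule derivative_eq_intros d refl | simp)+ (simp add: power2_eq_square power3_eq_cube algebra_simps)
  show "(b has_field_derivative c \<tau> + 3 * f \<tau> * b \<tau>) (at \<tau>)"
    unfolding b_def c_def jet_b_def jet_c_def
    by (rule derivative_eq_intros d refl | simp)+ (simp add: power2_eq_square power3_eq_cube power4_eq_xxxx algebra_simps)
qed

text \<open>The relation between \<open>a\<close> and \<open>b\<close> says exactly that they can be normalized to \<open>s2\<close> and \<open>s3\<close> by a common scaling of
  weights 2 and 3.\<close>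
lemma normalization_by_scaling:
  fixes s2 s3 a b :: complex
  assumes "s2 \<noteq> 0" "s3 \<noteq> 0" "a \<noteq> 0" "b\<^sup>2 * s2 ^ 3 = a ^ 3 * s3\<^sup>2"
  defines "\<rho> \<equiv> b * s2 / (a * s3)"
  shows "a = s2 * \<rho> ^ 2" "b = s3 * \<rho> ^ 3"
proof -
  have "s2 * \<rho> ^ 2 * (a\<^sup>2 * s3\<^sup>2) = b\<^sup>2 * s2 ^ 3"
    using assms(1-3) by (simp add: \<rho>_def power_divide power_mult_distrib power2_eq_square power3_eq_cube)
  also have "\<dots> = a * (a\<^sup>2 * s3\<^sup>2)" unfolding assms(4) by (simp add: power2_eq_square power3_eq_cube)
  finally show a: "a = s2 * \<rho> ^ 2" using assms(2,3) by simp
  have "b = \<rho> * a * s3 / s2" using assms(1-3) by (simp add: \<rho>_def)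
  also have "\<rho> * a * s3 / s2 = \<rho> * (s2 * \<rho> ^ 2) * s3 / s2" using a by simp
  also have "\<dots> = s3 * \<rho> ^ 3" using assms(1) by (simp add: power2_eq_square power3_eq_cube)
  finally show "b = s3 * \<rho> ^ 3" .
qed

text \<open>The functions \<open>X'\<close> and \<open>w = X''/X'\<close> are carried along, so that the third-order equation
  \<open>{X,\<tau>} = Q(X) X'\<^sup>2\<close> becomes a Riccati equation for \<open>w\<close> and no iterated derivatives occur.\<close>
definition schwarz_solution ::
  "complex poly \<Rightarrow> complex poly \<Rightarrow> complex set \<Rightarrow> (complex \<Rightarrow> complex) \<Rightarrow> (complex \<Rightarrow> complex) \<Rightarrow>
   (complex \<Rightarrow> complex) \<Rightarrow> bool" where
  "schwarz_solution P N V X X' w \<longleftrightarrow> open V \<and> (\<forall>\<tau>\<in>V.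
     (X has_field_derivative X' \<tau>) (at \<tau>) \<and> (X' has_field_derivative w \<tau> * X' \<tau>) (at \<tau>) \<and>
     (w has_field_derivative (w \<tau>)\<^sup>2 / 2 + ratfun P N (X \<tau>) * (X' \<tau>)\<^sup>2) (at \<tau>) \<and>
     X' \<tau> \<noteq> 0 \<and> poly N (X \<tau>) \<noteq> 0)"

text \<open>The rational function \<open>R = p/q\<close> defines the connection \<open>X''/X' + R(X) X'\<close>. With the common denominator
  \<open>den\<close> of \<open>Q\<close> and \<open>R\<close> one has \<open>R = num/den\<close>. If \<open>\<phi> = S(X) \<rho>\<^sup>k\<close> with \<open>\<rho> = X'/den(X)\<close>, then the covariant derivative
  \<open>\<phi>' - k f \<phi>\<close> is \<open>(cov k S)(X) \<rho>\<^sup>k\<^sup>+\<^sup>1\<close>. Up to a factor, \<open>W\<close> is the numerator of the derivative of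
  \<open>J = S3\<^sup>2/S2\<^sup>3\<close>, namely \<open>J' = - S3 W / S2\<^sup>4\<close>.\<close>
locale rational_connection =
  fixes P N p q :: "complex poly"
begin

definition "den = N * q"
definition "num = p * N"
definition "cov k S = pderiv S * den - smult (of_nat k) (S * (pderiv den + num))"
definition "S2 = P * N * q ^ 2 + pderiv num * den - num * pderiv den - smult (1/2) (num ^ 2)"
definition "S3 = cov 2 S2"
definition "S4 = cov 3 S3"
definition "W = smult 3 (S3 * pderiv S2) - smult 2 (S2 * pderiv S3)"

text \<open>The terms with \<open>den' + num\<close> enter \<open>S3\<close> with the factor 2 and \<open>S4\<close> with the factor 3, so they cancel.\<close>
lemma W_den: "W * den = smult 3 (S3 ^ 2) - smult 2 (S2 * S4)"
  unfolding W_def S4_def S3_def cov_def by (simp add: algebra_simps power2_eq_square smult_add_right smult_diff_right)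

lemma poly_S2: "poly S2 x = poly P x * poly N x * (poly q x)\<^sup>2 + poly (pderiv num) x * poly den x
    - poly num x * poly (pderiv den) x - (poly num x)\<^sup>2 / 2"
  by (simp add: S2_def poly_power)

lemma poly_cov: "poly (cov k S) x = poly (pderiv S) x * poly den x - of_nat k * (poly S x * (poly (pderiv den) x + poly num x))"
  by (simp add: cov_def)

definition conn :: "(complex \<Rightarrow> complex) \<Rightarrow> (complex \<Rightarrow> complex) \<Rightarrow> (complex \<Rightarrow> complex) \<Rightarrow> complex \<Rightarrow> complex" where
  "conn X X' w \<tau> = w \<tau> + ratfun p q (X \<tau>) * X' \<tau>"

text \<open>It starts from \<open>a = S2(X) \<rho>\<^sup>2\<close>, which is the Schwarzian equation together with the derivative of \<open>R(X) X'\<close>;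
  each covariant derivative raises the power of \<open>\<rho>\<close> by one.\<close>
lemma jets_of_conn:
  assumes sol: "schwarz_solution P N V X X' w"
    and q: "\<And>t. t \<in> V \<Longrightarrow> poly q (X t) \<noteq> 0"
    and f: "\<And>t. t \<in> V \<Longrightarrow> f t = conn X X' w t"
    and \<tau>: "\<tau> \<in> V"
  defines "\<rho> \<equiv> \<lambda>t. X' t / poly den (X t)"
  shows "f holomorphic_on V"
    "jet_a_at f \<tau> = poly S2 (X \<tau>) * \<rho> \<tau> ^ 2"
    "jet_b_at f \<tau> = poly S3 (X \<tau>) * \<rho> \<tau> ^ 3"
    "jet_c_at f \<tau> = poly S4 (X \<tau>) * \<rho> \<tau> ^ 4"
proof -
  have V: "open V" using sol by (simp add: schwarz_solution_def)
  have X: "(X has_field_derivative X' t) (at t)" and X': "(X' has_field_derivative w t * X' t) (at t)"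
    and w: "(w has_field_derivative (w t)\<^sup>2 / 2 + ratfun P N (X t) * (X' t)\<^sup>2) (at t)"
    and N: "poly N (X t) \<noteq> 0" if "t \<in> V" for t
    using sol that by (auto simp: schwarz_solution_def)
  have den: "poly den (X t) \<noteq> 0" if "t \<in> V" for t using N q that by (simp add: den_def)
  have pX: "((\<lambda>t. poly S (X t)) has_field_derivative poly (pderiv S) (X t) * X' t) (at t)"
    if "t \<in> V" for S t
    using DERIV_chain2[OF poly_DERIV X[OF that]] .
  have \<rho>: "(\<rho> has_field_derivative w t * \<rho> t - poly (pderiv den) (X t) * \<rho> t ^ 2) (at t)"
    if t: "t \<in> V" for t
    unfolding \<rho>_def
    by (rule derivative_eq_intros pX[OF t] X'[OF t] refl den[OF t])+
       (use den[OF t] in \<open>simp add: field_simps power2_eq_square\<close>)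
  have X'\<rho>: "X' t = poly den (X t) * \<rho> t" if "t \<in> V" for t
    using den[OF that] by (simp add: \<rho>_def)
  have f': "f t = w t + poly num (X t) * \<rho> t" if "t \<in> V" for t
    using f[OF that] N[OF that] q[OF that]
    by (simp add: conn_def ratfun_def \<rho>_def num_def den_def)
  have cov: "((\<lambda>t. poly S (X t) * \<rho> t ^ k) has_field_derivative
      poly (cov k S) (X t) * \<rho> t ^ Suc k + of_nat k * f t * (poly S (X t) * \<rho> t ^ k)) (at t)"
    if t: "t \<in> V" for S k t
  proof (cases k)
    case 0
    thus ?thesis using pX[OF t, of S] by (simp add: poly_cov X'\<rho>[OF t] mult_ac)
  next
    case (Suc l)
    show ?thesis
      by (rule derivative_eq_intros pX[OF t] \<rho>[OF t] refl)+
         (simp add: Suc poly_cov f'[OF t] X'\<rho>[OF t] algebra_simps power2_eq_square)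
  qed
  have df: "(f has_field_derivative poly S2 (X t) * \<rho> t ^ 2 + (f t)\<^sup>2 / 2) (at t)" if t: "t \<in> V" for t
  proof -
    have Q: "ratfun P N (X t) * (poly den (X t) * \<rho> t)\<^sup>2 = poly P (X t) * poly N (X t) * (poly q (X t))\<^sup>2 * (\<rho> t)\<^sup>2"
      using N[OF t] by (simp add: ratfun_def den_def power2_eq_square)
    have alg: "W\<^sup>2 / 2 + Z * R\<^sup>2 + (n' * (d * R) * R + (W * R - d' * R\<^sup>2) * n)
       = (Z + n' * d - n * d' - n\<^sup>2 / 2) * R\<^sup>2 + (W + n * R)\<^sup>2 / 2" for W Z R n n' d d' :: complex
      by (simp add: field_simps power2_eq_square)
    have "((\<lambda>t. w t + poly num (X t) * \<rho> t) has_field_derivative poly S2 (X t) * \<rho> t ^ 2 + (f t)\<^sup>2 / 2) (at t)"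
      by (rule DERIV_cong[OF DERIV_add[OF w[OF t] DERIV_mult[OF pX[OF t] \<rho>[OF t]]]])
        (simp only: Q poly_S2 f'[OF t] X'\<rho>[OF t] alg)
    thus ?thesis by (rule has_field_derivative_transform_within_open[OF _ V t]) (simp add: f')
  qed
  define A2 A3 A4 where "A2 t = poly S2 (X t) * \<rho> t ^ 2" and "A3 t = poly S3 (X t) * \<rho> t ^ 3"
    and "A4 t = poly S4 (X t) * \<rho> t ^ 4" for t
  define f1 where "f1 t = A2 t + (f t)\<^sup>2 / 2" for t
  define f2 where "f2 t = A3 t + 2 * f t * A2 t + f t * f1 t" for t
  define f3 where "f3 t = A4 t + 3 * f t * A3 t + 2 * f1 t * A2 t
     + 2 * f t * (A3 t + 2 * f t * A2 t) + (f1 t)\<^sup>2 + f t * f2 t" for t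
  have d1: "(f has_field_derivative f1 t) (at t)" if "t \<in> V" for t
    using df[OF that] by (simp add: f1_def A2_def)
  have c2: "(A2 has_field_derivative A3 t + 2 * f t * A2 t) (at t)" if "t \<in> V" for t
    using cov[OF that, of S2 2] unfolding A2_def A3_def by (simp add: S3_def numeral_3_eq_3)
  have c3: "(A3 has_field_derivative A4 t + 3 * f t * A3 t) (at t)" if "t \<in> V" for t
  proof -
    have "Suc 3 = (4::nat)" by simp
    thus ?thesis using cov[OF that, of S3 3] unfolding A3_def A4_def by (simp only: S4_def of_nat_numeral)
  qed
  have d2: "(f1 has_field_derivative f2 t) (at t)" if "t \<in> V" for t
    unfolding f1_def power2_eq_square
    by (rule DERIV_cong[OF DERIV_add[OF c2[OF that] DERIV_cdivide[OF DERIV_mult[OF d1[OF that] d1[OF that]]]]])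
       (simp add: f2_def f1_def algebra_simps)
  have d3: "(f2 has_field_derivative f3 t) (at t)" if "t \<in> V" for t
    unfolding f2_def by (rule derivative_eq_intros c2[OF that] c3[OF that] d1[OF that] d2[OF that] refl)+
      (simp add: f3_def algebra_simps power2_eq_square)
  have e: "deriv f \<tau> = f1 \<tau>" "(deriv ^^ 2) f \<tau> = f2 \<tau>" "(deriv ^^ 3) f \<tau> = f3 \<tau>"
    using iterated_deriv_eq[of V \<tau> f f1 f2 f3] V \<tau> d1 d2 d3 by blast+
  show "f holomorphic_on V" using d1 V by (auto simp: holomorphic_on_open)
  show "jet_a_at f \<tau> = poly S2 (X \<tau>) * \<rho> \<tau> ^ 2"
    unfolding e(1) f1_def A2_def[symmetric] by (rule jet_triangular(1))
  show "jet_b_at f \<tau> = poly S3 (X \<tau>) * \<rho> \<tau> ^ 3"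
    unfolding e(1,2) f2_def f1_def A3_def[symmetric] by (rule jet_triangular(2))
  show "jet_c_at f \<tau> = poly S4 (X \<tau>) * \<rho> \<tau> ^ 4"
    unfolding e(1-3) f3_def A4_def[symmetric] unfolding f2_def f1_def by (rule jet_triangular(3))
qed

text \<open>The converse direction. The jet determines \<open>\<rho>\<close> with \<open>a = S2(X) \<rho>\<^sup>2\<close> and \<open>b = S3(X) \<rho>\<^sup>3\<close>. Differentiating both
  relations and eliminating \<open>\<rho>'\<close> leaves \<open>W(X) (X' - den(X) \<rho>) = 0\<close>, so \<open>\<rho>\<close> is \<open>X'/den(X)\<close>; the derivative of \<open>a\<close> then
  gives \<open>f\<close>, and \<open>a\<close> itself is the Schwarzian equation for \<open>X\<close>.\<close>
lemma conn_of_jets: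
  assumes V: "open V" and f: "f holomorphic_on V" and X: "X holomorphic_on V"
  defines "a \<equiv> \<lambda>t. jet_a_at f t"
    and "b \<equiv> \<lambda>t. jet_b_at f t"
    and "c \<equiv> \<lambda>t. jet_c_at f t"
  assumes J: "\<And>t. t \<in> V \<Longrightarrow> (b t)\<^sup>2 * poly S2 (X t) ^ 3 = a t ^ 3 * (poly S3 (X t))\<^sup>2"
    and L: "\<And>t. t \<in> V \<Longrightarrow> c t * (poly S2 (X t))\<^sup>2 = (a t)\<^sup>2 * poly S4 (X t)"
    and nz: "\<And>t. t \<in> V \<Longrightarrow> a t \<noteq> 0 \<and> b t \<noteq> 0 \<and> poly (S2 * S3 * W * den) (X t) \<noteq> 0"
  obtains w where "schwarz_solution P N V X (deriv X) w" "\<And>t. t \<in> V \<Longrightarrow> f t = conn X (deriv X) w t"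
proof -
  define \<rho> where "\<rho> t = b t * poly S2 (X t) / (a t * poly S3 (X t))" for t
  define w where "w t = f t - poly num (X t) * \<rho> t" for t
  have j: "(f has_field_derivative a t + (f t)\<^sup>2 / 2) (at t)"
    "(a has_field_derivative b t + 2 * f t * a t) (at t)"
    "(b has_field_derivative c t + 3 * f t * b t) (at t)" if "t \<in> V" for t
    using jet_derivatives[OF V f that] by (simp_all add: a_def b_def c_def)
  have nz': "a t \<noteq> 0" "b t \<noteq> 0" "poly S2 (X t) \<noteq> 0" "poly S3 (X t) \<noteq> 0" "poly W (X t) \<noteq> 0" "poly den (X t) \<noteq> 0"
    if "t \<in> V" for t using nz[OF that] by auto
  have \<rho>0: "\<rho> t \<noteq> 0" if "t \<in> V" for t using nz'[OF that] by (simp add: \<rho>_def)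
  have a: "a t = poly S2 (X t) * \<rho> t ^ 2" and b: "b t = poly S3 (X t) * \<rho> t ^ 3"
    and c: "c t = poly S4 (X t) * \<rho> t ^ 4" if t: "t \<in> V" for t
  proof -
    note wt = normalization_by_scaling[OF nz'(3)[OF t] nz'(4)[OF t] nz'(1)[OF t] J[OF t]]
    show a: "a t = poly S2 (X t) * \<rho> t ^ 2" and "b t = poly S3 (X t) * \<rho> t ^ 3"
      using wt by (simp_all add: \<rho>_def)
    have "c t = (a t)\<^sup>2 * poly S4 (X t) / (poly S2 (X t))\<^sup>2" using L[OF t] nz'[OF t] by (simp add: field_simps)
    thus "c t = poly S4 (X t) * \<rho> t ^ 4" unfolding a using nz'[OF t]
      by (simp add: power2_eq_square power4_eq_xxxx)
  qed
  define X' where "X' = deriv X"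
  have X': "(X has_field_derivative X' t) (at t)" if "t \<in> V" for t
    unfolding X'_def using holomorphic_derivI[OF X V that] by simp
  have pX: "((\<lambda>t. poly S (X t)) has_field_derivative poly (pderiv S) (X t) * X' t) (at t)"
    if "t \<in> V" for S t
    using DERIV_chain2[OF poly_DERIV X'[OF that]] .
  have "\<rho> holomorphic_on V"
  proof -
    have ha: "a holomorphic_on V" "b holomorphic_on V"
      using j(2,3) V by (auto simp: holomorphic_on_open)
    have hp: "(\<lambda>t. poly S (X t)) holomorphic_on V" for S using pX V by (auto simp: holomorphic_on_open)
    show ?thesis unfolding \<rho>_def using nz' by (intro holomorphic_intros ha hp) auto
  qed
  then have \<rho>': "(\<rho> has_field_derivative deriv \<rho> t) (at t)" if "t \<in> V" for t
    using that by (intro holomorphic_derivI[OF _ V])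
  define \<rho>1 where "\<rho>1 = deriv \<rho>"
  note \<rho>' = \<rho>'[folded \<rho>1_def]
  have A: "poly (pderiv S2) (X t) * X' t * \<rho> t ^ 2 + 2 * poly S2 (X t) * \<rho> t * \<rho>1 t
      = poly S3 (X t) * \<rho> t ^ 3 + 2 * f t * (poly S2 (X t) * \<rho> t ^ 2)" if t: "t \<in> V" for t
  proof (rule DERIV_unique)
    show "((\<lambda>t. poly S2 (X t) * \<rho> t ^ 2) has_field_derivative
       poly (pderiv S2) (X t) * X' t * \<rho> t ^ 2 + 2 * poly S2 (X t) * \<rho> t * \<rho>1 t) (at t)"
      by (rule derivative_eq_intros pX[OF t] \<rho>'[OF t] refl)+ simp
    show "((\<lambda>t. poly S2 (X t) * \<rho> t ^ 2) has_field_derivative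
      poly S3 (X t) * \<rho> t ^ 3 + 2 * f t * (poly S2 (X t) * \<rho> t ^ 2)) (at t)"
      by (rule has_field_derivative_transform_within_open[OF j(2)[OF t, unfolded a[OF t] b[OF t]] V t a])
  qed
  have B: "poly (pderiv S3) (X t) * X' t * \<rho> t ^ 3 + 3 * poly S3 (X t) * \<rho> t ^ 2 * \<rho>1 t
      = poly S4 (X t) * \<rho> t ^ 4 + 3 * f t * (poly S3 (X t) * \<rho> t ^ 3)" if t: "t \<in> V" for t
  proof (rule DERIV_unique)
    show "((\<lambda>t. poly S3 (X t) * \<rho> t ^ 3) has_field_derivative
       poly (pderiv S3) (X t) * X' t * \<rho> t ^ 3 + 3 * poly S3 (X t) * \<rho> t ^ 2 * \<rho>1 t) (at t)"
      by (rule derivative_eq_intros pX[OF t] \<rho>'[OF t] refl)+ simp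
    show "((\<lambda>t. poly S3 (X t) * \<rho> t ^ 3) has_field_derivative
      poly S4 (X t) * \<rho> t ^ 4 + 3 * f t * (poly S3 (X t) * \<rho> t ^ 3)) (at t)"
      by (rule has_field_derivative_transform_within_open[OF j(3)[OF t, unfolded c[OF t] b[OF t]] V t b])
  qed
  have X'\<rho>: "X' t = poly den (X t) * \<rho> t" if t: "t \<in> V" for t
  proof -
    let ?x = "X t"
    \<comment> \<open>The derivatives of \<open>a\<close> and \<open>b\<close>, divided by powers of \<open>\<rho>\<close>, are two linear equations for \<open>X'\<close> and \<open>\<rho>'\<close>.\<close>
    have A': "poly (pderiv S2) ?x * X' t * \<rho> t + 2 * poly S2 ?x * \<rho>1 t
      = poly S3 ?x * \<rho> t ^ 2 + 2 * f t * poly S2 ?x * \<rho> t"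
    proof -
      have "\<rho> t * (poly (pderiv S2) ?x * X' t * \<rho> t + 2 * poly S2 ?x * \<rho>1 t)
         = \<rho> t * (poly S3 ?x * \<rho> t ^ 2 + 2 * f t * poly S2 ?x * \<rho> t)"
        using A[OF t] by (simp add: algebra_simps power2_eq_square power3_eq_cube)
      thus ?thesis using \<rho>0[OF t] by simp
    qed
    have B': "poly (pderiv S3) ?x * X' t * \<rho> t + 3 * poly S3 ?x * \<rho>1 t
      = poly S4 ?x * \<rho> t ^ 2 + 3 * f t * poly S3 ?x * \<rho> t"
    proof -
      have "\<rho> t ^ 2 * (poly (pderiv S3) ?x * X' t * \<rho> t + 3 * poly S3 ?x * \<rho>1 t)
         = \<rho> t ^ 2 * (poly S4 ?x * \<rho> t ^ 2 + 3 * f t * poly S3 ?x * \<rho> t)"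
        using B[OF t] by (simp add: algebra_simps power2_eq_square power3_eq_cube power4_eq_xxxx)
      thus ?thesis using \<rho>0[OF t] by simp
    qed
    have "poly W ?x * X' t * \<rho> t = 3 * poly S3 ?x * (poly (pderiv S2) ?x * X' t * \<rho> t + 2 * poly S2 ?x * \<rho>1 t)
        - 2 * poly S2 ?x * (poly (pderiv S3) ?x * X' t * \<rho> t + 3 * poly S3 ?x * \<rho>1 t)"
      by (simp add: W_def algebra_simps)
    also have "\<dots> = (3 * (poly S3 ?x)\<^sup>2 - 2 * (poly S2 ?x * poly S4 ?x)) * \<rho> t ^ 2"
      unfolding A' B' by (simp add: algebra_simps power2_eq_square)
    also have "3 * (poly S3 ?x)\<^sup>2 - 2 * (poly S2 ?x * poly S4 ?x) = poly W ?x * poly den ?x"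
      using arg_cong[OF W_den, of "\<lambda>p. poly p ?x"] by (simp add: poly_power)
    finally have "poly W ?x * \<rho> t * X' t = poly W ?x * \<rho> t * (poly den ?x * \<rho> t)"
      by (simp add: power2_eq_square mult_ac)
    thus ?thesis using \<rho>0[OF t] nz'[OF t] by simp
  qed
  have \<rho>1: "\<rho>1 t = f t * \<rho> t - (poly (pderiv den) (X t) + poly num (X t)) * \<rho> t ^ 2" if t: "t \<in> V" for t
  proof -
    have "2 * poly S2 (X t) * \<rho> t * \<rho>1 t
       = 2 * poly S2 (X t) * \<rho> t * (f t * \<rho> t - (poly (pderiv den) (X t) + poly num (X t)) * \<rho> t ^ 2)"
      using A[OF t] unfolding X'\<rho>[OF t] S3_def poly_cov
      by (simp add: algebra_simps power2_eq_square power3_eq_cube)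
    thus ?thesis using nz'[OF t] \<rho>0[OF t] by simp
  qed
  have "schwarz_solution P N V X X' w"
    unfolding schwarz_solution_def
  proof (intro conjI ballI V)
    fix t assume t: "t \<in> V"
    show "(X has_field_derivative X' t) (at t)" by (rule X'[OF t])
    show N: "poly N (X t) \<noteq> 0" using nz'[OF t] by (auto simp: den_def)
    show "X' t \<noteq> 0" using X'\<rho>[OF t] \<rho>0[OF t] nz'[OF t] by simp
    have \<rho>d: "(\<rho> has_field_derivative f t * \<rho> t - (poly (pderiv den) (X t) + poly num (X t)) * \<rho> t ^ 2) (at t)"
      using \<rho>'[OF t] \<rho>1[OF t] by simp
    have "((\<lambda>t. poly den (X t) * \<rho> t) has_field_derivative w t * X' t) (at t)"
      by (rule derivative_eq_intros pX[OF t] \<rho>d refl)+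
         (simp add: w_def X'\<rho>[OF t] algebra_simps power2_eq_square)
    thus "(X' has_field_derivative w t * X' t) (at t)"
      by (rule has_field_derivative_transform_within_open[OF _ V t]) (simp add: X'\<rho>)
    have Q: "ratfun P N (X t) * (poly den (X t) * \<rho> t)\<^sup>2 = poly P (X t) * poly N (X t) * (poly q (X t))\<^sup>2 * (\<rho> t)\<^sup>2"
      using N by (simp add: ratfun_def den_def power2_eq_square)
    have alg: "(Z + n' * d - n * d' - n\<^sup>2 / 2) * R\<^sup>2 + F\<^sup>2 / 2 - (n' * (d * R) * R + (F * R - (d' + n) * R\<^sup>2) * n)
       = (F - n * R)\<^sup>2 / 2 + Z * R\<^sup>2" for F Z R n n' d d' :: complex
      by (simp add: field_simps power2_eq_square)
    have fd: "(f has_field_derivative poly S2 (X t) * \<rho> t ^ 2 + (f t)\<^sup>2 / 2) (at t)"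
      using j(1)[OF t] a[OF t] by simp
    show "(w has_field_derivative (w t)\<^sup>2 / 2 + ratfun P N (X t) * (X' t)\<^sup>2) (at t)"
      unfolding w_def
      by (rule DERIV_cong[OF DERIV_diff[OF fd DERIV_mult[OF pX[OF t] \<rho>d]]])
        (simp only: Q poly_S2 X'\<rho>[OF t] alg)
  qed
  moreover have "f t = conn X X' w t" if t: "t \<in> V" for t
  proof -
    have "poly N (X t) \<noteq> 0" "poly q (X t) \<noteq> 0" using nz'[OF t] by (auto simp: den_def)
    thus ?thesis using X'\<rho>[OF t] by (simp add: conn_def w_def ratfun_def num_def den_def)
  qed
  ultimately show ?thesis by (intro that[of w]) (auto simp: X'_def)
qed

end

section \<open>Local behaviour of the Hauptmodul\<close>

lemma open_upper_half_plane: "open \<H>"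
  unfolding upper_half_plane_def by (rule open_halfspace_Im_gt)

lemma connected_upper_half_plane: "connected \<H>"
  unfolding upper_half_plane_def by (rule convex_connected[OF convex_halfspace_Im_gt])

lemma has_field_derivative_mult_power_int:
  fixes z :: complex
  assumes "(k has_field_derivative k') (at t)" "t \<noteq> z"
  shows "((\<lambda>t. k t * (t - z) powi n) has_field_derivative (of_int n * k t + (t - z) * k') * (t - z) powi (n - 1)) (at t)"
proof -
  have t: "t - z \<noteq> 0" using assms(2) by simp
  have "((\<lambda>t. k t * (t - z) powi n) has_field_derivative
      k' * (t - z) powi n + (of_int n * (t - z) powi (n - 1) * 1) * k t) (at t)"
    by (intro DERIV_mult assms(1) DERIV_power_int) (use t in \<open>auto intro!: derivative_eq_intros\<close>)
  moreover have "(t - z) powi n = (t - z) * (t - z) powi (n - 1)"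
    using t power_int_add[of "t - z" 1 "n - 1"] by simp
  ultimately show ?thesis by (simp add: algebra_simps)
qed

lemma log_derivative_of_mult_power_int:
  fixes z :: complex
  assumes k: "(k has_field_derivative k') (at t)" "k t \<noteq> 0" and t: "t \<noteq> z"
    and f: "(f has_field_derivative f') (at t)"
    and eq: "\<forall>\<^sub>F s in nhds t. f s = k s * (s - z) powi n"
  shows "f t \<noteq> 0" "f' / f t = of_int n / (t - z) + k' / k t"
proof -
  have ft: "f t = k t * (t - z) powi n" using eq by (rule eventually_nhds_x_imp_x)
  have pw: "(t - z) powi n = (t - z) * (t - z) powi (n - 1)"
    using t power_int_add[of "t - z" 1 "n - 1"] by simp
  show "f t \<noteq> 0" using ft k(2) t by simp
  have "(f has_field_derivative (of_int n * k t + (t - z) * k') * (t - z) powi (n - 1)) (at t)"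
    using has_field_derivative_mult_power_int[OF k(1) t, of n] by (subst DERIV_cong_ev[OF refl eq refl])
  hence f': "f' = (of_int n * k t + (t - z) * k') * (t - z) powi (n - 1)"
    by (rule DERIV_unique[OF f])
  have alg: "(of_int n * a + u * b) * p / (a * (u * p)) = of_int n / u + b / a"
    if "u \<noteq> 0" "p \<noteq> 0" "a \<noteq> 0" for u p a b :: complex
  proof -
    have "(of_int n * a + u * b) * p / (a * (u * p)) = (of_int n * a + u * b) / (a * u)" using that by simp
    thus ?thesis using that by (simp add: add_divide_distrib)
  qed
  show "f' / f t = of_int n / (t - z) + k' / k t"
    unfolding f' ft pw using t k(2) alg[of "t - z" "(t - z) powi (n - 1)" "k t"] by simp
qed

lemma schwarz_bracket_eq:
  assumes "deriv x \<tau> \<noteq> 0" "x analytic_on {\<tau>}"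
  shows "(canonical_connection x has_field_derivative
      (canonical_connection x \<tau>)\<^sup>2 / 2 + schwarz_bracket x \<tau> * (deriv x \<tau>)\<^sup>2) (at \<tau>)"
proof -
  obtain V where V: "open V" "\<tau> \<in> V" "x holomorphic_on V" using assms(2) by (auto simp: analytic_at)
  note d = holomorphic_iterated_deriv[OF V(1,3,2)]
  have "(canonical_connection x has_field_derivative
     ((deriv ^^ 3) x \<tau> * deriv x \<tau> - (deriv ^^ 2) x \<tau> * (deriv ^^ 2) x \<tau>) / (deriv x \<tau> * deriv x \<tau>)) (at \<tau>)"
    unfolding canonical_connection_def by (rule DERIV_divide[OF d(3,2) assms(1)])
  thus ?thesis
    by (rule DERIV_cong)
      (use assms(1) in \<open>simp add: canonical_connection_def schwarz_bracket_def field_simps power2_eq_square power3_eq_cube power4_eq_xxxx\<close>)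
qed

lemma regular_value_double_pole_limit:
  assumes "poly N e \<noteq> 0"
  shows "((\<lambda>x. (x - e)\<^sup>2 * ratfun P N x) \<longlongrightarrow> 0) (at e)"
proof -
  have "((\<lambda>x. (x - e)\<^sup>2 * ratfun P N x) \<longlongrightarrow> (e - e)\<^sup>2 * (poly P e / poly N e)) (at e)"
    unfolding ratfun_def using assms by (intro tendsto_intros)
  thus ?thesis by simp
qed

lemma parabolic_at_imp_pole:
  assumes "parabolic_at (ratfun P N) E" shows "poly N E = 0"
proof (rule ccontr)
  assume "poly N E \<noteq> 0"
  from tendsto_unique[OF trivial_limit_at regular_value_double_pole_limit[OF this] assms[unfolded parabolic_at_def]]
  show False by simp
qed

lemma ex_not_root_not_eq:
  assumes "N \<noteq> (0 :: complex poly)" shows "\<exists>x. poly N x \<noteq> 0 \<and> x \<noteq> c"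
proof -
  have "finite (insert c {x. poly N x = 0})" using poly_roots_finite[OF assms] by simp
  thus ?thesis using ex_new_if_finite[OF infinite_UNIV_char_0, of "insert c {x. poly N x = 0}"] by auto
qed

text \<open>The local exponents. Both sides of \<open>w' - w\<^sup>2/2 = Q(x) x'\<^sup>2\<close> with \<open>w = x''/x'\<close> are multiplied by \<open>(t - z)\<^sup>2\<close> and
  compared at \<open>t = z\<close>; for \<open>x - e = k (t - z)\<^sup>n\<close> this gives \<open>(1 - n\<^sup>2)/2 = \<kappa> n\<^sup>2\<close>. At a pole the same holds with
  \<open>e = 0\<close>, \<open>n < 0\<close> and \<open>\<kappa>\<close> the limit of \<open>x\<^sup>2 Q(x)\<close> at infinity.\<close>
lemma schwarz_indices:
  assumes "isolated_singularity_at x z" "not_essential x z" 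
    and nc: "\<forall>\<^sub>F t in at z. x t \<noteq> e"
    and lim: "(is_pole x z \<and> e = 0) \<or> x \<midarrow>z\<rightarrow> e"
    and eq: "\<forall>\<^sub>F t in at z. schwarz_bracket x t = Q (x t)"
    and par: "is_pole x z \<Longrightarrow> ((\<lambda>x. x\<^sup>2 * Q x) \<longlongrightarrow> -1/2) at_infinity"
    and kap: "\<not> is_pole x z \<Longrightarrow> ((\<lambda>x. (x - e)\<^sup>2 * Q x) \<longlongrightarrow> \<kappa>) (at e)" "\<kappa> = -1/2 \<or> \<kappa> = 0"
  shows "\<not> is_pole x z \<and> \<kappa> = 0 \<and>
     (\<exists>k r. r > 0 \<and> k holomorphic_on ball z r \<and> k z \<noteq> 0 \<and> (\<forall>t\<in>ball z r - {z}. x t = e + k t * (t - z)))"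
proof -
  define F where "F t = x t - e" for t
  have iF: "isolated_singularity_at F z" unfolding F_def
    by (intro singularity_intros assms)
  have nF: "not_essential F z"
  proof (cases "x \<midarrow>z\<rightarrow> e")
    case True
    have "F \<midarrow>z\<rightarrow> e - e" unfolding F_def by (intro tendsto_intros True)
    thus ?thesis by (rule tendsto_imp_not_essential)
  next
    case False
    hence "F = x" using lim by (simp add: F_def fun_eq_iff)
    thus ?thesis using assms(2) by simp
  qed
  have "\<exists>\<^sub>F w in at z. F w \<noteq> 0"
    using nc by (intro eventually_frequently) (auto simp: F_def elim: eventually_mono)
  from zorder_exist[OF iF nF this]
  obtain n k r where k0: "k z \<noteq> 0" and r: "r > 0" and kh: "k holomorphic_on cball z r"
    and Fk: "\<And>w. w \<in> cball z r - {z} \<Longrightarrow> F w = k w * (w - z) powi n \<and> k w \<noteq> 0" by blast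
  have kh: "k holomorphic_on ball z r" using kh by (rule holomorphic_on_subset) auto
  have kz: "k \<midarrow>z\<rightarrow> k z"
    using holomorphic_on_imp_continuous_on[OF kh] r by (simp add: continuous_on_eq_continuous_at isContD)
  have ev: "\<forall>\<^sub>F t in at z. t \<in> ball z r - {z}" using r by (intro eventually_at_in_open) auto
  have evF: "\<forall>\<^sub>F t in at z. F t = k t * (t - z) powi n" using ev by eventually_elim (use Fk in auto)
  \<comment> \<open>For \<open>n = 0\<close> the function would tend to a finite value different from \<open>e\<close>.\<close>
  have n0: "n \<noteq> 0"
  proof
    assume "n = 0"
    hence "F \<midarrow>z\<rightarrow> k z" using kz evF by (subst tendsto_cong[of _ k]) auto
    hence *: "x \<midarrow>z\<rightarrow> k z + e" using tendsto_add[of F "k z" "at z" "\<lambda>_. e" e] by (simp add: F_def)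
    hence "\<not> is_pole x z" unfolding is_pole_def by (auto dest: not_tendsto_and_filterlim_at_infinity[OF trivial_limit_at])
    with lim have "x \<midarrow>z\<rightarrow> e" by blast
    with * have "k z + e = e" using tendsto_unique[OF trivial_limit_at] by blast
    thus False using k0 by simp
  qed
  have pole_iff: "is_pole x z \<longleftrightarrow> n < 0"
  proof
    assume p: "is_pole x z"
    show "n < 0"
    proof (rule ccontr)
      assume "\<not> n < 0"
      then obtain m where m: "n = int m" by (metis nonneg_int_cases not_less)
      have "((\<lambda>t. k t * (t - z) ^ m + e) \<longlongrightarrow> k z * (z - z) ^ m + e) (at z)" by (intro tendsto_intros kz)
      hence "x \<midarrow>z\<rightarrow> k z * (z - z) ^ m + e"
        by (rule Lim_transform_eventually)
          (use evF in \<open>eventually_elim, simp add: F_def m eq_diff_eq[symmetric]\<close>)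
      thus False using p unfolding is_pole_def by (auto dest: not_tendsto_and_filterlim_at_infinity[OF trivial_limit_at])
    qed
  next
    assume "n < 0"
    then obtain m where m: "n = - int m" "m > 0" by (metis neg_int_cases)
    have "is_pole (\<lambda>t. k t / (t - z) ^ m) z" using r m by (intro is_pole_basic[OF kh _ _ k0]) auto
    also have "?this \<longleftrightarrow> is_pole F z"
      by (rule is_pole_cong) (use evF in \<open>auto simp: m power_int_minus field_simps elim: eventually_mono\<close>)
    finally have p: "is_pole F z" .
    show "is_pole x z"
    proof (rule ccontr)
      assume "\<not> is_pole x z"
      hence "x \<midarrow>z\<rightarrow> e" using lim by blast
      hence "F \<midarrow>z\<rightarrow> e - e" unfolding F_def by (intro tendsto_intros)
      thus False using p unfolding is_pole_def
        by (auto dest: not_tendsto_and_filterlim_at_infinity[OF trivial_limit_at])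
    qed
  qed
  define k1 where "k1 t = of_int n * k t + (t - z) * deriv k t" for t
  have k1h: "k1 holomorphic_on ball z r" unfolding k1_def by (intro holomorphic_intros kh) auto
  have k1z: "k1 z \<noteq> 0" using n0 k0 by (simp add: k1_def)
  have k1lim: "k1 \<midarrow>z\<rightarrow> k1 z"
    using holomorphic_on_imp_continuous_on[OF k1h] r by (simp add: continuous_on_eq_continuous_at isContD)
  have "\<forall>\<^sub>F t in at z. k1 t \<noteq> 0" using k1lim k1z by (rule tendsto_imp_eventually_ne)
  then obtain d where d: "d > 0" "\<And>t. t \<noteq> z \<Longrightarrow> dist t z < d \<Longrightarrow> k1 t \<noteq> 0"
    by (auto simp: eventually_at)
  define r' where "r' = min d r"
  have r': "r' > 0" "r' \<le> r" using d r by (auto simp: r'_def)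
  moreover have "k1 t \<noteq> 0" if "t \<in> ball z r'" for t
    using d(2)[of t] that k1z by (cases "t = z") (auto simp: r'_def dist_commute)
  ultimately have r': "r' > 0" "r' \<le> r" "\<And>t. t \<in> ball z r' \<Longrightarrow> k1 t \<noteq> 0" by blast+
  define B where "B = ball z r' - {z}"
  have B: "open B" unfolding B_def by auto
  have x: "x t = e + k t * (t - z) powi n" if "t \<in> B" for t
    using Fk[of t] that r' by (auto simp: B_def F_def algebra_simps)
  have dk: "(k has_field_derivative deriv k t) (at t)" "(k1 has_field_derivative deriv k1 t) (at t)" if "t \<in> ball z r" for t
    using holomorphic_derivI[OF kh _ that] holomorphic_derivI[OF k1h _ that] by auto
  have dx: "(x has_field_derivative k1 t * (t - z) powi (n - 1)) (at t)" if t: "t \<in> B" for t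
  proof (rule has_field_derivative_transform_within_open[OF _ B t])
    have "((\<lambda>t. k t * (t - z) powi n) has_field_derivative k1 t * (t - z) powi (n - 1)) (at t)"
      unfolding k1_def using t r' by (intro has_field_derivative_mult_power_int dk) (auto simp: B_def)
    from DERIV_add[OF DERIV_const[of e] this]
    show "((\<lambda>t. e + k t * (t - z) powi n) has_field_derivative k1 t * (t - z) powi (n - 1)) (at t)" by simp
  qed (simp add: x)
  have xh: "x holomorphic_on B" using dx B by (auto simp: holomorphic_on_open)
  have dx': "deriv x t = k1 t * (t - z) powi (n - 1)" if "t \<in> B" for t using dx[OF that] by (rule DERIV_imp_deriv)
  define v where "v = canonical_connection x"
  have dx0: "deriv x t \<noteq> 0" if "t \<in> B" for t using dx'[OF that] r'(3)[of t] that by (auto simp: B_def)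
  have v: "v t = of_int (n - 1) / (t - z) + deriv k1 t / k1 t" if t: "t \<in> B" for t
  proof -
    have "(deriv x has_field_derivative (deriv ^^ 2) x t) (at t)" by (rule holomorphic_iterated_deriv(2)[OF B xh t])
    moreover have "\<forall>\<^sub>F s in nhds t. deriv x s = k1 s * (s - z) powi (n - 1)"
      using eventually_nhds_in_open[OF B t] by eventually_elim (rule dx')
    moreover have "t \<in> ball z r" "t \<noteq> z" "k1 t \<noteq> 0" using t r' by (auto simp: B_def)
    ultimately show ?thesis unfolding v_def canonical_connection_def
      using log_derivative_of_mult_power_int(2)[OF dk(2)] by blast
  qed
  define \<mu> where "\<mu> t = deriv k1 t / k1 t" for t
  have \<mu>h: "\<mu> holomorphic_on ball z r'" unfolding \<mu>_def
    by (intro holomorphic_intros holomorphic_on_subset[OF k1h]) (use r' in auto)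
  have \<mu>c: "isCont \<mu> z" "isCont (deriv \<mu>) z"
    using holomorphic_on_imp_continuous_on[OF \<mu>h] holomorphic_on_imp_continuous_on[OF holomorphic_deriv[OF \<mu>h]] r'
    by (auto simp: continuous_on_eq_continuous_at)
  have dv: "(v has_field_derivative - of_int (n - 1) / (t - z)\<^sup>2 + deriv \<mu> t) (at t)" if t: "t \<in> B" for t
  proof (rule has_field_derivative_transform_within_open[OF _ B t])
    have "t - z \<noteq> 0" "t \<in> ball z r'" using t by (auto simp: B_def)
    thus "((\<lambda>t. of_int (n - 1) / (t - z) + \<mu> t) has_field_derivative - of_int (n - 1) / (t - z)\<^sup>2 + deriv \<mu> t) (at t)"
      by (auto intro!: derivative_eq_intros holomorphic_derivI[OF \<mu>h] simp: power2_eq_square)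
  qed (simp add: v \<mu>_def)
  define L where "L t = - of_int (n - 1) + (t - z)\<^sup>2 * deriv \<mu> t - (of_int (n - 1) + (t - z) * \<mu> t)\<^sup>2 / 2" for t
  have evB: "\<forall>\<^sub>F t in at z. t \<in> B" unfolding B_def using r' by (intro eventually_at_in_open) auto
  have main: "\<forall>\<^sub>F t in at z. L t = (x t - e)\<^sup>2 * Q (x t) * (k1 t / k t)\<^sup>2"
    using evB eq
  proof eventually_elim
    case (elim t)
    have tz: "t - z \<noteq> 0" and kt: "k t \<noteq> 0" using elim(1) Fk[of t] r' by (auto simp: B_def)
    have an: "x analytic_on {t}" using xh B elim(1) by (auto simp: analytic_at)
    have alg: "u\<^sup>2 * (v\<^sup>2 / 2 + S * d\<^sup>2) - (u * v)\<^sup>2 / 2 = S * (u * d)\<^sup>2" for u v S d :: complex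
      by (simp add: algebra_simps power_mult_distrib)
    have "- of_int (n - 1) / (t - z)\<^sup>2 + deriv \<mu> t = (v t)\<^sup>2 / 2 + schwarz_bracket x t * (deriv x t)\<^sup>2"
      using DERIV_unique[OF dv[OF elim(1)] schwarz_bracket_eq[OF dx0[OF elim(1)] an, folded v_def]] .
    hence *: "(t - z)\<^sup>2 * (- of_int (n - 1) / (t - z)\<^sup>2 + deriv \<mu> t) - ((t - z) * v t)\<^sup>2 / 2
        = Q (x t) * ((t - z) * deriv x t)\<^sup>2"
      by (simp only: alg elim(2))
    have "(t - z)\<^sup>2 * (- of_int (n - 1) / (t - z)\<^sup>2 + deriv \<mu> t) = - of_int (n - 1) + (t - z)\<^sup>2 * deriv \<mu> t"
      using tz by (simp add: field_simps)
    moreover have "(t - z) * v t = of_int (n - 1) + (t - z) * \<mu> t"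
      using tz unfolding v[OF elim(1)] \<mu>_def by (simp add: field_simps)
    moreover have "(t - z) * deriv x t = (x t - e) * (k1 t / k t)"
    proof -
      have "(t - z) powi n = (t - z) * (t - z) powi (n - 1)"
        using tz power_int_add[of "t - z" 1 "n - 1"] by simp
      thus ?thesis unfolding dx'[OF elim(1)] x[OF elim(1)] using kt by simp
    qed
    ultimately show ?case using * unfolding L_def by (simp add: power_mult_distrib power_divide mult_ac)
  qed
  have L1: "L \<midarrow>z\<rightarrow> - of_int (n - 1) + (z - z)\<^sup>2 * deriv \<mu> z - (of_int (n - 1) + (z - z) * \<mu> z)\<^sup>2 / 2"
    unfolding L_def using \<mu>c[unfolded isCont_def] by (intro tendsto_intros) simp_all
  have k1k: "(\<lambda>t. (k1 t / k t)\<^sup>2) \<midarrow>z\<rightarrow> (k1 z / k z)\<^sup>2" by (intro tendsto_intros k1lim kz k0)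
  have k1k': "(k1 z / k z)\<^sup>2 = of_int (n\<^sup>2)" using k0 by (simp add: k1_def power2_eq_square)
  define \<kappa>' where "\<kappa>' = (if is_pole x z then - 1/2 else \<kappa>)"
  have "(\<lambda>t. (x t - e)\<^sup>2 * Q (x t)) \<midarrow>z\<rightarrow> \<kappa>'"
  proof (cases "is_pole x z")
    case True
    hence "e = 0" using lim unfolding is_pole_def by (auto dest: not_tendsto_and_filterlim_at_infinity[OF trivial_limit_at])
    thus ?thesis using filterlim_compose[OF par[OF True]] True unfolding is_pole_def \<kappa>'_def by simp
  next
    case False
    hence "filterlim x (at e) (at z)" using lim nc by (simp add: filterlim_at)
    from filterlim_compose[OF kap(1)[OF False] this] show ?thesis using False by (simp add: \<kappa>'_def)
  qed
  from tendsto_mult[OF this k1k]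
  have "L \<midarrow>z\<rightarrow> \<kappa>' * of_int (n\<^sup>2)"
    unfolding k1k' by (rule Lim_transform_eventually) (use main in \<open>auto elim: eventually_mono\<close>)
  from tendsto_unique[OF trivial_limit_at L1 this]
  \<comment> \<open>The coefficients of \<open>(t - z)\<^sup>-\<^sup>2\<close> on both sides.\<close>
  have ind: "- of_int (n - 1) - (of_int (n - 1))\<^sup>2 / 2 = \<kappa>' * of_int (n\<^sup>2)" by simp
  hence ind: "1 - (of_int n)\<^sup>2 = 2 * \<kappa>' * (of_int n)\<^sup>2" by (simp add: power2_eq_square field_simps)
  have \<kappa>': "\<kappa>' = 0"
  proof (rule ccontr)
    assume "\<kappa>' \<noteq> 0"
    hence "\<kappa>' = -1/2" using kap(2) by (auto simp: \<kappa>'_def split: if_splits)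
    thus False using ind by simp
  qed
  hence np: "\<not> is_pole x z" by (auto simp: \<kappa>'_def)
  have "of_int (n\<^sup>2) = (1::complex)" using ind \<kappa>' by simp
  hence "n\<^sup>2 = 1" using of_int_eq_1_iff by blast
  hence "n = 1 \<or> n = -1" by (simp add: power2_eq_1_iff)
  hence "n = 1" using np pole_iff by auto
  have "k holomorphic_on ball z r'" using kh r' by (auto elim: holomorphic_on_subset)
  moreover have "\<forall>t\<in>ball z r' - {z}. x t = e + k t * (t - z)" using x \<open>n = 1\<close> by (simp add: B_def)
  ultimately show ?thesis using np \<kappa>' k0 r'(1) by (auto simp: \<kappa>'_def)
qed

text \<open>Near each point of the half-plane the local exponents leave only an unramified finite value that is not a root
  of \<open>N\<close>. The equation then holds everywhere, by continuity.\<close>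
lemma hauptmodul_regular:
  assumes N: "N \<noteq> 0" and par: "only_parabolic_singularities P N"
    and mero: "chi nicely_meromorphic_on \<H>"
    and surj: "\<And>x. poly N x \<noteq> 0 \<Longrightarrow> \<exists>\<tau>\<in>\<H>. chi \<tau> = x"
    and eq: "\<forall>\<^sub>\<approx>\<tau>\<in>\<H>. schwarz_bracket chi \<tau> = ratfun P N (chi \<tau>)"
  shows "schwarz_solution P N \<H> chi (deriv chi) (canonical_connection chi)"
proof -
  have nc: "\<forall>\<^sub>F t in at z. chi t \<noteq> e" if "z \<in> \<H>" for z e
  proof -
    obtain x where x: "poly N x \<noteq> 0" "x \<noteq> e" using ex_not_root_not_eq[OF N] by blast
    then obtain \<tau> where "\<tau> \<in> \<H>" "chi \<tau> = x" using surj by blast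
    hence "\<forall>\<^sub>\<approx>x\<in>\<H>. chi x \<noteq> e"
      using nicely_meromorphic_imp_constant_or_avoid[OF mero open_upper_half_plane connected_upper_half_plane, of e] x
      by auto
    thus ?thesis using that by (rule eventually_cosparse_imp_eventually_at)
  qed
  have loc: "\<not> is_pole chi z \<and> poly N (chi z) \<noteq> 0 \<and>
     (\<exists>k r. r > 0 \<and> k holomorphic_on ball z r \<and> k z \<noteq> 0 \<and> (\<forall>t\<in>ball z r - {z}. chi t = chi z + k t * (t - z)))"
    if z: "z \<in> \<H>" for z
  proof -
    define \<kappa> :: complex where "\<kappa> = (if poly N (chi z) = 0 then -1/2 else 0)"
    have m: "chi meromorphic_on {z}" using mero z meromorphic_on_subset
      unfolding nicely_meromorphic_on_def by blast
    have "\<not> is_pole chi z \<and> \<kappa> = 0 \<and>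
     (\<exists>k r. r > 0 \<and> k holomorphic_on ball z r \<and> k z \<noteq> 0 \<and> (\<forall>t\<in>ball z r - {z}. chi t = chi z + k t * (t - z)))"
    proof (rule schwarz_indices)
      show "isolated_singularity_at chi z" "not_essential chi z" using m by (auto simp: meromorphic_at_iff)
      show "\<forall>\<^sub>F t in at z. chi t \<noteq> chi z" by (rule nc[OF z])
      show "is_pole chi z \<and> chi z = 0 \<or> chi \<midarrow>z\<rightarrow> chi z" using mero z unfolding nicely_meromorphic_on_def by blast
      show "\<forall>\<^sub>F t in at z. schwarz_bracket chi t = ratfun P N (chi t)"
        using eq z by (rule eventually_cosparse_imp_eventually_at)
      show "((\<lambda>x. x\<^sup>2 * ratfun P N x) \<longlongrightarrow> - 1 / 2) at_infinity"
        using par by (simp add: only_parabolic_singularities_def parabolic_at_infinity_def)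
      show "((\<lambda>x. (x - chi z)\<^sup>2 * ratfun P N x) \<longlongrightarrow> \<kappa>) (at (chi z))"
      proof (cases "poly N (chi z) = 0")
        case True
        thus ?thesis using par by (simp add: \<kappa>_def only_parabolic_singularities_def parabolic_at_def)
      next
        case False
        thus ?thesis using regular_value_double_pole_limit by (simp add: \<kappa>_def)
      qed
      show "\<kappa> = -1/2 \<or> \<kappa> = 0" by (simp add: \<kappa>_def)
    qed
    thus ?thesis by (auto simp: \<kappa>_def split: if_splits)
  qed
  have an: "chi analytic_on {z}" if "z \<in> \<H>" for z
    using nicely_meromorphic_on_imp_analytic_at[OF mero that] loc[OF that] by blast
  hence hol: "chi holomorphic_on \<H>"
    using analytic_imp_holomorphic analytic_on_analytic_at by blast
  have d0: "deriv chi z \<noteq> 0" if z: "z \<in> \<H>" for z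
  proof -
    obtain k r where k: "r > 0" "k holomorphic_on ball z r" "k z \<noteq> 0"
      "\<And>t. t\<in>ball z r - {z} \<Longrightarrow> chi t = chi z + k t * (t - z)" using loc[OF z] by blast
    have "((\<lambda>t. chi z + k t * (t - z)) has_field_derivative k z) (at z)"
      using holomorphic_derivI[OF k(2), of z] k(1) by (auto intro!: derivative_eq_intros)
    hence "(chi has_field_derivative k z) (at z)"
      by (rule has_field_derivative_transform_within_open[of _ _ _ "ball z r"]) (use k in \<open>force+\<close>)
    thus ?thesis using k(3) DERIV_imp_deriv by metis
  qed
  define w where "w = canonical_connection chi"
  note d = holomorphic_iterated_deriv[OF open_upper_half_plane hol]
  have dw: "(w has_field_derivative (w t)\<^sup>2 / 2 + schwarz_bracket chi t * (deriv chi t)\<^sup>2) (at t)" if "t \<in> \<H>" for t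
    unfolding w_def using schwarz_bracket_eq[OF d0[OF that] an[OF that]] .
  have "schwarz_bracket chi z = ratfun P N (chi z)" if z: "z \<in> \<H>" for z
  proof -
    have cc: "isCont (deriv chi) z" "isCont ((deriv ^^ 2) chi) z" "isCont ((deriv ^^ 3) chi) z" "isCont chi z"
      using d(1,2)[OF z] holomorphic_derivI[OF holomorphic_higher_deriv[OF hol open_upper_half_plane, of 3] open_upper_half_plane z]
        d(3)[OF z] by (auto intro: DERIV_isCont)
    have "isCont (\<lambda>t. schwarz_bracket chi t) z" unfolding schwarz_bracket_def
      using d0[OF z] by (intro continuous_intros cc) auto
    moreover have "isCont (\<lambda>t. ratfun P N (chi t)) z" unfolding ratfun_def
      using loc[OF z] by (intro continuous_intros cc) auto
    ultimately have l: "schwarz_bracket chi \<midarrow>z\<rightarrow> schwarz_bracket chi z" "(\<lambda>t. ratfun P N (chi t)) \<midarrow>z\<rightarrow> ratfun P N (chi z)"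
      by (auto simp: isCont_def)
    have ev: "\<forall>\<^sub>F t in at z. schwarz_bracket chi t = ratfun P N (chi t)"
      using eq z by (rule eventually_cosparse_imp_eventually_at)
    show ?thesis
      by (rule tendsto_unique[OF trivial_limit_at Lim_transform_eventually[OF l(1) ev] l(2)])
  qed
  moreover have "canonical_connection chi t * deriv chi t = (deriv ^^ 2) chi t" if "t \<in> \<H>" for t
    using d0[OF that] by (simp add: canonical_connection_def)
  ultimately show ?thesis
    unfolding schwarz_solution_def using d(1,2) dw d0 loc
    by (intro conjI open_upper_half_plane ballI) (simp_all add: w_def)
qed

section \<open>Moebius transformations and quadratic forms invariant under a group of the first kind\<close>

lemma SL2C_det: "M \<in> SL2C \<Longrightarrow> M$1$1 * M$2$2 - M$1$2 * M$2$1 = 1"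
  by (simp add: SL2C_def det_2)

lemma SL2R_imp_SL2C: "M \<in> SL2R \<Longrightarrow> M \<in> SL2C"
  by (simp add: SL2C_def SL2R_def)

lemma moebius_has_derivative:
  assumes "M \<in> SL2C" "M$2$1 * \<tau> + M$2$2 \<noteq> 0"
  shows "(moebius M has_field_derivative 1 / (M$2$1 * \<tau> + M$2$2)\<^sup>2) (at \<tau>)"
proof -
  have "((\<lambda>\<tau>. (M$1$1 * \<tau> + M$1$2) / (M$2$1 * \<tau> + M$2$2)) has_field_derivative
      (M$1$1 * (M$2$1 * \<tau> + M$2$2) - (M$1$1 * \<tau> + M$1$2) * M$2$1) / ((M$2$1 * \<tau> + M$2$2) * (M$2$1 * \<tau> + M$2$2))) (at \<tau>)"
    using assms(2) by (auto intro!: derivative_eq_intros)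
  moreover have "M$1$1 * (M$2$1 * \<tau> + M$2$2) - (M$1$1 * \<tau> + M$1$2) * M$2$1 = 1"
    using SL2C_det[OF assms(1)] by (simp add: algebra_simps)
  ultimately show ?thesis by (simp add: moebius_def[abs_def] power2_eq_square)
qed

lemma SL2R_action:
  assumes M: "M \<in> SL2R" and \<tau>: "\<tau> \<in> \<H>"
  shows "M$2$1 * \<tau> + M$2$2 \<noteq> 0"
    "Im (moebius M \<tau>) = Im \<tau> / (cmod (M$2$1 * \<tau> + M$2$2))\<^sup>2" "moebius M \<tau> \<in> \<H>"
proof -
  have re: "M$i$j = of_real (Re (M$i$j))" for i j
    using M by (auto simp: SL2R_def complex_is_Real_iff complex_eq_iff)
  define a b c d where "a = Re (M$1$1)" and "b = Re (M$1$2)" and "c = Re (M$2$1)" and "d = Re (M$2$2)"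
  have M': "M$1$1 = of_real a" "M$1$2 = of_real b" "M$2$1 = of_real c" "M$2$2 = of_real d"
    using re by (simp_all add: a_def b_def c_def d_def)
  have "complex_of_real (a * d - b * c) = 1"
    using SL2C_det[OF SL2R_imp_SL2C[OF M]] by (simp add: M')
  hence det: "a * d - b * c = 1" using of_real_eq_1_iff by blast
  have Im: "Im \<tau> > 0" using \<tau> by (simp add: upper_half_plane_def)
  show nz: "M$2$1 * \<tau> + M$2$2 \<noteq> 0"
  proof
    assume "M$2$1 * \<tau> + M$2$2 = 0"
    hence "c * Im \<tau> = 0" "c * Re \<tau> + d = 0" by (auto simp: M' complex_eq_iff)
    hence "c = 0" "d = 0" using Im by auto
    thus False using det by simp
  qed
  have "Im (moebius M \<tau>) = ((a * Im \<tau>) * (c * Re \<tau> + d) - (a * Re \<tau> + b) * (c * Im \<tau>)) / ((c * Re \<tau> + d)\<^sup>2 + (c * Im \<tau>)\<^sup>2)"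
    by (simp add: moebius_def M' Im_divide)
  also have "(a * Im \<tau>) * (c * Re \<tau> + d) - (a * Re \<tau> + b) * (c * Im \<tau>) = (a * d - b * c) * Im \<tau>"
    by (simp add: algebra_simps)
  also have "(c * Re \<tau> + d)\<^sup>2 + (c * Im \<tau>)\<^sup>2 = (cmod (M$2$1 * \<tau> + M$2$2))\<^sup>2"
    by (simp add: M' cmod_power2)
  finally show *: "Im (moebius M \<tau>) = Im \<tau> / (cmod (M$2$1 * \<tau> + M$2$2))\<^sup>2" by (simp add: det)
  thus "moebius M \<tau> \<in> \<H>" using Im nz by (simp add: upper_half_plane_def)
qed

lemma holomorphic_zero_derivative_const:
  fixes f :: "complex \<Rightarrow> complex"
  assumes "\<And>t. t \<in> ball z r \<Longrightarrow> (f has_field_derivative 0) (at t)"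
  shows "\<exists>c. \<forall>t\<in>ball z r. f t = c"
  using has_field_derivative_zero_constant[OF convex_ball, of z r f] assms
  by (blast intro: has_field_derivative_at_within)

lemma holomorphic_affine:
  fixes f :: "complex \<Rightarrow> complex"
  assumes "\<And>t. t \<in> ball z r \<Longrightarrow> (f has_field_derivative f1 t) (at t)"
    and "\<And>t. t \<in> ball z r \<Longrightarrow> (f1 has_field_derivative 0) (at t)"
  obtains a b where "\<And>t. t \<in> ball z r \<Longrightarrow> f t = a * t + b" "\<And>t. t \<in> ball z r \<Longrightarrow> f1 t = a"
proof -
  obtain a where a: "\<And>t. t \<in> ball z r \<Longrightarrow> f1 t = a" using holomorphic_zero_derivative_const assms(2) by blast
  have "((\<lambda>t. f t - a * t) has_field_derivative 0) (at t)" if "t \<in> ball z r" for t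
    using assms(1)[OF that] a[OF that] by (auto intro!: derivative_eq_intros)
  then obtain b where "\<And>t. t \<in> ball z r \<Longrightarrow> f t - a * t = b"
    using holomorphic_zero_derivative_const[of z r "\<lambda>t. f t - a * t"] by blast
  hence "\<And>t. t \<in> ball z r \<Longrightarrow> f t = a * t + b" by (auto simp: algebra_simps)
  thus ?thesis using that a by blast
qed

lemma ball_holomorphic_sqrt:
  assumes "f holomorphic_on ball z r" "\<And>t. t \<in> ball z r \<Longrightarrow> f t \<noteq> 0"
  obtains h where "h holomorphic_on ball z r" "\<And>t. t \<in> ball z r \<Longrightarrow> f t = h t ^ 2"
  using contractible_imp_holomorphic_sqrt[OF assms(1) convex_imp_contractible[OF convex_ball] assms(2)] by blast

text \<open>Put \<open>h = \<Theta>\<^sup>-\<^sup>1\<^sup>/\<^sup>2\<close>, so that \<open>h' = - \<omega> h\<close>. The hypothesis becomes \<open>h'\<^sup>2/2 - h h'' = \<kappa>\<close>, and its derivative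
  is \<open>h h''' = 0\<close>.\<close>
lemma inverse_square_of_quadratic:
  fixes \<Theta> \<omega> :: "complex \<Rightarrow> complex"
  assumes \<Theta>: "\<And>t. t \<in> ball z r \<Longrightarrow> (\<Theta> has_field_derivative 2 * \<omega> t * \<Theta> t) (at t)"
    and \<omega>: "\<And>t. t \<in> ball z r \<Longrightarrow> (\<omega> has_field_derivative (\<omega> t)\<^sup>2 / 2 + \<kappa> * \<Theta> t) (at t)"
    and nz: "\<And>t. t \<in> ball z r \<Longrightarrow> \<Theta> t \<noteq> 0"
  obtains \<alpha> \<beta> \<gamma> where "\<And>t. t \<in> ball z r \<Longrightarrow> \<Theta> t * (\<alpha> * t\<^sup>2 + \<beta> * t + \<gamma>)\<^sup>2 = 1"
proof -
  have "(\<lambda>t. 1 / \<Theta> t) holomorphic_on ball z r"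
    using \<Theta> nz by (intro holomorphic_intros) (force simp: holomorphic_on_open)+
  then obtain h where h: "h holomorphic_on ball z r" "\<And>t. t \<in> ball z r \<Longrightarrow> 1 / \<Theta> t = h t ^ 2"
    using ball_holomorphic_sqrt[of "\<lambda>t. 1 / \<Theta> t" z r] nz by auto
  have h0: "h t \<noteq> 0" if "t \<in> ball z r" for t
    using h(2)[OF that] nz[OF that] by auto
  have \<Theta>h: "\<Theta> t = 1 / h t ^ 2" if "t \<in> ball z r" for t
    unfolding h(2)[OF that, symmetric] by simp
  have dh: "(h has_field_derivative - \<omega> t * h t) (at t)" if t: "t \<in> ball z r" for t
  proof -
    have d: "(h has_field_derivative deriv h t) (at t)" using holomorphic_derivI[OF h(1) _ t] by simp
    have "((\<lambda>t. h t ^ 2) has_field_derivative 2 * h t * deriv h t) (at t)"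
      by (rule derivative_eq_intros d refl)+ simp
    moreover have "((\<lambda>t. 1 / \<Theta> t) has_field_derivative - (2 * \<omega> t * \<Theta> t) / (\<Theta> t * \<Theta> t)) (at t)"
      using nz[OF t] by (auto intro!: derivative_eq_intros \<Theta>[OF t])
    from has_field_derivative_transform_within_open[OF this open_ball t h(2)]
    have "((\<lambda>t. h t ^ 2) has_field_derivative - (2 * \<omega> t * \<Theta> t) / (\<Theta> t * \<Theta> t)) (at t)" by simp
    ultimately have "2 * h t * deriv h t = - (2 * \<omega> t * \<Theta> t) / (\<Theta> t * \<Theta> t)" by (rule DERIV_unique)
    also have "\<dots> = - 2 * \<omega> t * (1 / \<Theta> t)" using nz[OF t] by simp
    also have "\<dots> = - 2 * \<omega> t * h t ^ 2" unfolding h(2)[OF t] ..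
    finally have "h t * deriv h t = - (\<omega> t * (h t * h t))" by (simp add: power2_eq_square)
    hence "h t * (deriv h t + \<omega> t * h t) = 0" by (simp add: distrib_left mult_ac)
    hence "deriv h t = - \<omega> t * h t" using h0[OF t] by (simp add: eq_neg_iff_add_eq_0)
    thus ?thesis using d by simp
  qed
  define h2 where "h2 t = (\<omega> t)\<^sup>2 * h t / 2 - \<kappa> / h t" for t
  have dh1: "((\<lambda>t. - \<omega> t * h t) has_field_derivative h2 t) (at t)" if t: "t \<in> ball z r" for t
  proof (rule DERIV_cong)
    show "((\<lambda>t. - \<omega> t * h t) has_field_derivative
       - ((\<omega> t)\<^sup>2 / 2 + \<kappa> * \<Theta> t) * h t + (- \<omega> t * h t) * - \<omega> t) (at t)"
      by (intro DERIV_mult DERIV_minus \<omega> dh t)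
    show "- ((\<omega> t)\<^sup>2 / 2 + \<kappa> * \<Theta> t) * h t + (- \<omega> t * h t) * - \<omega> t = h2 t"
      using h0[OF t] unfolding h2_def \<Theta>h[OF t] by (simp add: field_simps power2_eq_square)
  qed
  have dh2: "(h2 has_field_derivative 0) (at t)" if t: "t \<in> ball z r" for t
  proof (rule DERIV_cong)
    show "(h2 has_field_derivative
       ((2 * \<omega> t * ((\<omega> t)\<^sup>2 / 2 + \<kappa> * \<Theta> t)) * h t + (- \<omega> t * h t) * (\<omega> t)\<^sup>2) / 2 - (- (\<kappa> * (- \<omega> t * h t)) / (h t * h t))) (at t)"
      unfolding h2_def using h0[OF t]
      by (auto intro!: derivative_eq_intros \<omega>[OF t] dh[OF t])
    show "((2 * \<omega> t * ((\<omega> t)\<^sup>2 / 2 + \<kappa> * \<Theta> t)) * h t + (- \<omega> t * h t) * (\<omega> t)\<^sup>2) / 2 - (- (\<kappa> * (- \<omega> t * h t)) / (h t * h t)) = 0"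
      using h0[OF t] unfolding \<Theta>h[OF t] by (simp add: field_simps power2_eq_square)
  qed
  obtain a b where ab: "\<And>t. t \<in> ball z r \<Longrightarrow> - \<omega> t * h t = a * t + b"
    using holomorphic_affine[OF dh1 dh2] by blast
  have "((\<lambda>t. h t - (a / 2 * t\<^sup>2 + b * t)) has_field_derivative 0) (at t)" if t: "t \<in> ball z r" for t
  proof (rule DERIV_cong)
    show "((\<lambda>t. h t - (a / 2 * t\<^sup>2 + b * t)) has_field_derivative - \<omega> t * h t - (a * t + b)) (at t)"
      by (intro DERIV_diff dh t) (auto intro!: derivative_eq_intros)
    show "- \<omega> t * h t - (a * t + b) = 0" unfolding ab[OF t] by simp
  qed
  then obtain c where "\<And>t. t \<in> ball z r \<Longrightarrow> h t - (a / 2 * t\<^sup>2 + b * t) = c"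
    using holomorphic_zero_derivative_const[of z r "\<lambda>t. h t - (a / 2 * t\<^sup>2 + b * t)"] by blast
  hence c: "h t = a / 2 * t\<^sup>2 + b * t + c" if "t \<in> ball z r" for t
    using that by (auto simp: algebra_simps)
  have "\<Theta> t * (a / 2 * t\<^sup>2 + b * t + c)\<^sup>2 = 1" if "t \<in> ball z r" for t
    using h0[OF that] unfolding c[OF that, symmetric] \<Theta>h[OF that] by simp
  thus ?thesis by (rule that)
qed

lemma invariant_derivative:
  assumes x: "x holomorphic_on \<H>" and M: "M \<in> SL2R"
    and inv: "\<And>t. t \<in> \<H> \<Longrightarrow> x (moebius M t) = x t" and \<tau>: "\<tau> \<in> \<H>"
  shows "deriv x (moebius M \<tau>) = (M$2$1 * \<tau> + M$2$2)\<^sup>2 * deriv x \<tau>"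
proof -
  note act = SL2R_action[OF M \<tau>]
  have "((\<lambda>t. x (moebius M t)) has_field_derivative deriv x (moebius M \<tau>) * (1 / (M$2$1 * \<tau> + M$2$2)\<^sup>2)) (at \<tau>)"
    by (rule DERIV_chain2[OF holomorphic_derivI[OF x open_upper_half_plane act(3)] moebius_has_derivative[OF SL2R_imp_SL2C[OF M] act(1)]])
  hence "(x has_field_derivative deriv x (moebius M \<tau>) * (1 / (M$2$1 * \<tau> + M$2$2)\<^sup>2)) (at \<tau>)"
    by (rule has_field_derivative_transform_within_open[OF _ open_upper_half_plane \<tau> inv])
  from DERIV_imp_deriv[OF this] show ?thesis using act(1) by (simp add: field_simps)
qed

text \<open>The weight 4 form \<open>s(x) x'\<^sup>2 / g(x)\<^sup>2\<close> is \<open>1/h\<^sup>2\<close> on a ball, hence on the half-plane. Its covariance under \<open>G\<close> reads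
  \<open>\<bar>h(M\<tau>)\<bar> \<bar>c\<tau> + d\<bar>\<^sup>2 = \<bar>h(\<tau>)\<bar>\<close>, so \<open>\<bar>h\<bar> / Im\<close> is constant on orbits. An orbit can then accumulate at a real point only if that point is a zero of \<open>h\<close>, whereas for a
  group of the first kind every real number is an accumulation point.\<close>
lemma first_kind_no_invariant_quadratic:
  assumes G: "fuchsian_group_first_kind G"
    and x: "x holomorphic_on \<H>" and x0: "\<And>t. t \<in> \<H> \<Longrightarrow> deriv x t \<noteq> 0"
    and inv: "\<And>M t. M \<in> G \<Longrightarrow> t \<in> \<H> \<Longrightarrow> x (moebius M t) = x t"
    and B: "ball z r \<subseteq> \<H>" "r > 0" and s: "poly s (x z) \<noteq> 0" and g: "poly g (x z) \<noteq> 0"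
    and eq: "\<And>t. t \<in> ball z r \<Longrightarrow> poly s (x t) * (deriv x t)\<^sup>2 * (\<alpha> * t\<^sup>2 + \<beta> * t + \<gamma>)\<^sup>2 = (poly g (x t))\<^sup>2"
  shows False
proof -
  define h where "h t = \<alpha> * t\<^sup>2 + \<beta> * t + \<gamma>" for t
  have hh: "h holomorphic_on A" for A unfolding h_def by (intro holomorphic_intros)
  have px: "(\<lambda>t. poly p (x t)) holomorphic_on \<H>" for p
    using DERIV_chain2[OF poly_DERIV holomorphic_derivI[OF x open_upper_half_plane]] open_upper_half_plane
    by (auto simp: holomorphic_on_open)
  have dx: "deriv x holomorphic_on \<H>" by (intro holomorphic_deriv x open_upper_half_plane)
  have z: "z \<in> \<H>" using B by auto
  \<comment> \<open>Multiplied out, the relation has no poles, so it continues to the whole half-plane.\<close>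
  have eqH: "poly s (x t) * (deriv x t)\<^sup>2 * (h t)\<^sup>2 = (poly g (x t))\<^sup>2" if "t \<in> \<H>" for t
    by (rule analytic_continuation_open[OF open_ball open_upper_half_plane _ connected_upper_half_plane B(1) _ _ _ that])
       (use B eq in \<open>auto intro!: holomorphic_intros dx px hh simp: h_def\<close>)
  have hM: "(h (moebius M t) * (M$2$1 * t + M$2$2)\<^sup>2)\<^sup>2 = (h t)\<^sup>2" if M: "M \<in> G" and t: "t \<in> \<H>" for M t
  proof -
    have MS: "M \<in> SL2R" using M G by (auto simp: fuchsian_group_first_kind_def fuchsian_group_def)
    have "isCont (\<lambda>t. poly s (x t)) z"
      using holomorphic_on_imp_continuous_on[OF px[of s]] z open_upper_half_plane
      by (auto simp: continuous_on_eq_continuous_at)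
    hence "((\<lambda>t. poly s (x t)) \<longlongrightarrow> poly s (x z)) (nhds z)"
      unfolding isCont_def using tendsto_at_iff_tendsto_nhds[of "\<lambda>t. poly s (x t)" z] by simp
    hence "\<forall>\<^sub>F t in nhds z. poly s (x t) \<noteq> 0"
      using s by (rule tendsto_imp_eventually_ne)
    then obtain U where U: "open U" "z \<in> U" "\<And>t. t \<in> U \<Longrightarrow> poly s (x t) \<noteq> 0"
      by (auto simp: eventually_nhds)
    have mh: "moebius M holomorphic_on \<H>"
      using moebius_has_derivative[OF SL2R_imp_SL2C[OF MS]] SL2R_action(1)[OF MS] open_upper_half_plane
      by (auto simp: holomorphic_on_open)
    have hm: "(\<lambda>t. h (moebius M t)) holomorphic_on \<H>"
      using holomorphic_on_compose[OF mh hh] by (simp add: o_def)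
    have loc: "(h (moebius M t) * (M$2$1 * t + M$2$2)\<^sup>2)\<^sup>2 = (h t)\<^sup>2" if t: "t \<in> U \<inter> \<H>" for t
    proof -
      have tH: "t \<in> \<H>" and st: "poly s (x t) \<noteq> 0" using t U by auto
      have "poly s (x t) * (deriv x t)\<^sup>2 * (h (moebius M t) * (M$2$1 * t + M$2$2)\<^sup>2)\<^sup>2 = (poly g (x t))\<^sup>2"
        using eqH[OF SL2R_action(3)[OF MS tH]] inv[OF M tH] invariant_derivative[OF x MS inv[OF M] tH]
        by (simp add: power_mult_distrib mult_ac)
      also have "\<dots> = poly s (x t) * (deriv x t)\<^sup>2 * (h t)\<^sup>2" using eqH[OF tH] by simp
      finally show ?thesis using st x0[OF tH] by simp
    qed
    show ?thesis
    proof (rule analytic_continuation_open[OF _ open_upper_half_plane _ connected_upper_half_plane _ _ _ loc t])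
      show "open (U \<inter> \<H>)" using U open_upper_half_plane by blast
      show "U \<inter> \<H> \<noteq> {}" using U z by blast
      show "(\<lambda>t. (h (moebius M t) * (M $ 2 $ 1 * t + M $ 2 $ 2)\<^sup>2)\<^sup>2) holomorphic_on \<H>"
        by (intro holomorphic_intros hm)
      show "(\<lambda>t. (h t)\<^sup>2) holomorphic_on \<H>" by (intro holomorphic_intros hh)
    qed auto
  qed
  have "h (of_real t) = 0" for t :: real
  proof -
    obtain y where y: "y \<in> \<H>" and lim: "complex_of_real t islimpt ((\<lambda>M. moebius M y) ` G)"
      using G by (auto simp: fuchsian_group_first_kind_def)
    define C where "C = {w. cmod (h w) * Im y = cmod (h y) * Im w}"
    have "closed C" unfolding C_def h_def by (intro closed_Collect_eq continuous_intros)
    moreover have "(\<lambda>M. moebius M y) ` G \<subseteq> C"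
    proof clarify
      fix M assume M: "M \<in> G"
      have MS: "M \<in> SL2R" using M G by (auto simp: fuchsian_group_first_kind_def fuchsian_group_def)
      define l where "l = cmod (M$2$1 * y + M$2$2)"
      have l: "l \<noteq> 0" using SL2R_action(1)[OF MS y] by (simp add: l_def)
      have "(cmod (h (moebius M y) * (M$2$1 * y + M$2$2)\<^sup>2))\<^sup>2 = (cmod (h y))\<^sup>2"
        using arg_cong[OF hM[OF M y], of cmod] by (simp add: norm_power)
      hence hl: "cmod (h (moebius M y)) * l\<^sup>2 = cmod (h y)"
        by (simp add: norm_mult norm_power l_def power2_eq_iff_nonneg)
      have "Im (moebius M y) = Im y / l\<^sup>2" unfolding l_def by (rule SL2R_action(2)[OF MS y])
      hence "Im y = Im (moebius M y) * l\<^sup>2" using l by simp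
      thus "moebius M y \<in> C" unfolding C_def hl[symmetric] by simp
    qed
    ultimately have "complex_of_real t \<in> C"
      using lim closed_limpt islimpt_subset by metis
    thus ?thesis using y by (simp add: C_def upper_half_plane_def)
  qed
  from this[of 0] this[of 1] this[of "-1"]
  have "\<gamma> = 0" "\<alpha> + \<beta> = 0" "\<alpha> - \<beta> = 0" by (auto simp: h_def)
  moreover have "2 * \<alpha> = (\<alpha> + \<beta>) + (\<alpha> - \<beta>)" by simp
  ultimately have "\<gamma> = 0" "\<alpha> = 0" "\<beta> = 0" by simp_all
  hence "(poly g (x z))\<^sup>2 = 0" using eqH[OF z] by (simp add: h_def)
  thus False using g by simp
qed

section \<open>The invariants of a connection are not constant\<close>

lemma poly_eventually_nonzero_at:
  assumes "A \<noteq> (0 :: complex poly)" shows "\<forall>\<^sub>F x in at e. poly A x \<noteq> 0"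
proof -
  have "open (- ({x. poly A x = 0} - {e}))"
    using poly_roots_finite[OF assms] by (intro open_Compl finite_imp_closed) auto
  hence "\<forall>\<^sub>F x in at e. x \<in> - ({x. poly A x = 0} - {e}) - {e}" by (intro eventually_at_in_open) auto
  thus ?thesis by eventually_elim auto
qed

lemma poly_over_power_at_infinity:
  fixes p :: "complex poly"
  assumes "degree p \<le> n"
  shows "((\<lambda>x. poly p x / x ^ n) \<longlongrightarrow> coeff p n) at_infinity"
proof -
  have t: "((\<lambda>x::complex. x ^ i / x ^ n) \<longlongrightarrow> (if i = n then 1 else 0)) at_infinity" if "i \<le> n" for i
  proof -
    have ev: "\<forall>\<^sub>F x in at_infinity. inverse x ^ (n - i) = (x::complex) ^ i / x ^ n"
      unfolding eventually_at_infinity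
    proof (intro exI allI impI)
      fix x :: complex assume "1 \<le> norm x"
      hence "x \<noteq> 0" by auto
      thus "inverse x ^ (n - i) = x ^ i / x ^ n" using that
        by (simp add: power_diff power_inverse field_simps)
    qed
    have "((\<lambda>x::complex. inverse x ^ (n - i)) \<longlongrightarrow> 0 ^ (n - i)) at_infinity"
      by (intro tendsto_intros tendsto_inverse_0)
    from Lim_transform_eventually[OF this ev] show ?thesis using that by (auto simp: power_0_left)
  qed
  have "((\<lambda>x. \<Sum>i\<le>n. coeff p i * (x ^ i / x ^ n)) \<longlongrightarrow> (\<Sum>i\<le>n. coeff p i * (if i = n then 1 else 0))) at_infinity"
    by (intro tendsto_intros t) auto
  moreover have "(\<Sum>i\<le>n. coeff p i * (if i = n then 1 else 0)) = coeff p n"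
    by (simp add: if_distrib cong: if_cong)
  moreover have "(\<Sum>i\<le>n. coeff p i * (x ^ i / x ^ n)) = poly p x / x ^ n" for x
  proof -
    have "poly p x = (\<Sum>i\<le>n. coeff p i * x ^ i)"
      unfolding poly_altdef using assms
      by (intro sum.mono_neutral_left) (auto simp: coeff_eq_0)
    thus ?thesis by (simp add: sum_divide_distrib)
  qed
  ultimately show ?thesis by simp
qed

text \<open>Over the complex numbers a polynomial without multiple roots is a product of distinct linear factors.\<close>
lemma rsquarefree_card_roots:
  assumes "rsquarefree (p :: complex poly)" shows "card {x. poly p x = 0} = degree p"
proof -
  have p0: "p \<noteq> 0" using assms by (auto simp: rsquarefree_def)
  have "degree p = degree (smult (lead_coeff p) (\<Prod>z|poly p z = 0. [:-z, 1:]))"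
    using complex_poly_decompose_rsquarefree[OF assms] by simp
  also have "\<dots> = degree (\<Prod>z|poly p z = 0. [:-z, 1:])" using p0 by simp
  also have "\<dots> = (\<Sum>z|poly p z = 0. degree [:-z, 1:])" by (intro degree_prod_eq_sum_degree) auto
  also have "\<dots> = card {x. poly p x = 0}" by simp
  finally show ?thesis by simp
qed

text \<open>These are the properties of a uniformizing orbifold that matter for the connections: the interior regularity
  of the Hauptmodul, its invariance, and the values that it takes.\<close>
locale parabolic_uniformization =
  fixes P N :: "complex poly" and chi :: "complex \<Rightarrow> complex" and G :: "(complex^2^2) set"
  assumes N_nz: "N \<noteq> 0" and coprime_PN: "coprime P N"
    and parabolic: "only_parabolic_singularities P N"
    and first_kind: "fuchsian_group_first_kind G"
    and schwarz: "schwarz_solution P N \<H> chi (deriv chi) (canonical_connection chi)"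
    and invariant: "\<And>M \<tau>. M \<in> G \<Longrightarrow> \<tau> \<in> \<H> \<Longrightarrow> chi (moebius M \<tau>) = chi \<tau>"
    and surjective: "\<And>x. poly N x \<noteq> 0 \<Longrightarrow> \<exists>\<tau>\<in>\<H>. chi \<tau> = x"
begin

lemma chi_holomorphic: "chi holomorphic_on \<H>"
  using schwarz by (auto simp: schwarz_solution_def holomorphic_on_open)

lemma deriv_chi_nz: "\<tau> \<in> \<H> \<Longrightarrow> deriv chi \<tau> \<noteq> 0"
  using schwarz by (auto simp: schwarz_solution_def)

lemma parabolic_root: "poly N E = 0 \<Longrightarrow> ((\<lambda>x. (x - E)\<^sup>2 * ratfun P N x) \<longlongrightarrow> - 1/2) (at E)"
  using parabolic by (simp add: only_parabolic_singularities_def parabolic_at_def)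

lemma parabolic_infinity: "((\<lambda>x. x\<^sup>2 * ratfun P N x) \<longlongrightarrow> - 1/2) at_infinity"
  using parabolic by (simp add: only_parabolic_singularities_def parabolic_at_infinity_def)

text \<open>With a single root \<open>E\<close> the function \<open>(x - E)\<^sup>2 Q(x)\<close> is entire with limit \<open>-1/2\<close> at infinity, so \<open>Q = -1/2 (x - E)\<^sup>-\<^sup>2\<close>
  by Liouville. For this \<open>Q\<close> the function \<open>u = x'/(x - E)\<close> satisfies \<open>{x,\<tau>} + u\<^sup>2/2 = (u'/u)' - (u'/u)\<^sup>2/2\<close>, so the right-hand
  side is 0 and \<open>u\<^sup>2\<close> is an invariant form of the kind that groups of the first kind do not admit. Without any root the same
  function vanishes at \<open>E\<close>, which contradicts its constant value.\<close>
lemma two_cusps: "\<exists>E1 E2. E1 \<noteq> E2 \<and> poly N E1 = 0 \<and> poly N E2 = 0"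
proof (rule ccontr)
  assume no: "\<nexists>E1 E2. E1 \<noteq> E2 \<and> poly N E1 = 0 \<and> poly N E2 = 0"
  then obtain E where E: "\<And>x. poly N x = 0 \<Longrightarrow> x = E" by metis
  \<comment> \<open>The value at a root is the limit given by parabolicity.\<close>
  define f where "f x = (if poly N x = 0 then -1/2 else (x - E)\<^sup>2 * ratfun P N x)" for x
  have fh: "f holomorphic_on UNIV"
  proof (rule no_isolated_singularity'[of "{x. poly N x = 0}"])
    fix z assume "z \<in> {x. poly N x = 0}"
    hence N0: "poly N z = 0" and z: "z = E" using E by auto
    have "\<forall>\<^sub>F x in at z. (x - E)\<^sup>2 * ratfun P N x = f x"
      using E z by (auto simp: f_def eventually_at_filter)
    thus "(f \<longlongrightarrow> f z) (at z)"
      using Lim_transform_eventually[OF parabolic_root[OF N0]] z N0 by (simp add: f_def)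
  next
    have "(\<lambda>x. (x - E)\<^sup>2 * ratfun P N x) holomorphic_on UNIV - {x. poly N x = 0}"
      unfolding ratfun_def by (intro holomorphic_intros) auto
    thus "f holomorphic_on UNIV - {x. poly N x = 0}"
      by (rule holomorphic_transform) (auto simp: f_def)
  qed (simp_all add: poly_roots_finite[OF N_nz])
  have "(f \<longlongrightarrow> -1/2) at_infinity"
  proof -
    have "((\<lambda>x. (1 - E * inverse x)\<^sup>2 * (x\<^sup>2 * ratfun P N x)) \<longlongrightarrow> (1 - E * 0)\<^sup>2 * (-1/2)) at_infinity"
      by (intro tendsto_intros parabolic_infinity tendsto_inverse_0)
    hence l: "((\<lambda>x. (1 - E * inverse x)\<^sup>2 * (x\<^sup>2 * ratfun P N x)) \<longlongrightarrow> -1/2) at_infinity" by simp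
    have "\<forall>\<^sub>F x in at_infinity. x \<noteq> E \<and> x \<noteq> 0"
      unfolding eventually_at_infinity
  proof (intro exI allI impI)
    fix x :: complex assume "cmod E + 1 \<le> norm x"
    hence "norm x > norm E" "norm x > 0" using norm_ge_zero[of E] by linarith+
    thus "x \<noteq> E \<and> x \<noteq> 0" by auto
  qed
    hence "\<forall>\<^sub>F x in at_infinity. (1 - E * inverse x)\<^sup>2 * (x\<^sup>2 * ratfun P N x) = f x"
    proof eventually_elim
      case (elim x)
      hence "(1 - E * inverse x) * x = x - E" by (simp add: field_simps)
      hence "(1 - E * inverse x)\<^sup>2 * x\<^sup>2 = (x - E)\<^sup>2" by (metis power_mult_distrib)
      thus ?case using E[of x] elim by (auto simp: f_def)
    qed
    thus ?thesis by (rule Lim_transform_eventually[OF l])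
  qed
  hence fc: "f z = -1/2" for z by (rule Liouville_weak[OF fh])
  have NE: "poly N E = 0" using fc[of E] by (auto simp: f_def split: if_splits)
  have Q: "ratfun P N x = -1/2 / (x - E)\<^sup>2" if "poly N x \<noteq> 0" for x
  proof -
    have "x \<noteq> E" using that NE by auto
    thus ?thesis using fc[of x] that by (simp add: f_def field_simps)
  qed
  define w where "w = canonical_connection chi"
  define u where "u t = deriv chi t / (chi t - E)" for t
  have sol: "(chi has_field_derivative deriv chi t) (at t)" "(deriv chi has_field_derivative w t * deriv chi t) (at t)"
    "(w has_field_derivative (w t)\<^sup>2 / 2 + ratfun P N (chi t) * (deriv chi t)\<^sup>2) (at t)"
    "deriv chi t \<noteq> 0" "poly N (chi t) \<noteq> 0" if "t \<in> \<H>" for t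
    using schwarz that by (auto simp: schwarz_solution_def w_def)
  have ne: "chi t - E \<noteq> 0" if "t \<in> \<H>" for t using sol(5)[OF that] NE by auto
  have du: "(u has_field_derivative w t * u t - (u t)\<^sup>2) (at t)" if t: "t \<in> \<H>" for t
  proof (rule DERIV_cong)
    show "(u has_field_derivative (w t * deriv chi t * (chi t - E) - deriv chi t * deriv chi t) / ((chi t - E) * (chi t - E))) (at t)"
      unfolding u_def using ne[OF t] by (auto intro!: derivative_eq_intros sol(1,2)[OF t])
    show "(w t * deriv chi t * (chi t - E) - deriv chi t * deriv chi t) / ((chi t - E) * (chi t - E)) = w t * u t - (u t)\<^sup>2"
      unfolding u_def using ne[OF t] by (simp add: diff_divide_distrib power2_eq_square)
  qed
  define z where "z = \<i>"
  have z: "z \<in> \<H>" by (simp add: z_def upper_half_plane_def)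
  obtain r where r: "r > 0" "ball z r \<subseteq> \<H>" using open_upper_half_plane z openE by blast
  have "((\<lambda>t. (u t)\<^sup>2) has_field_derivative 2 * (w t - u t) * (u t)\<^sup>2) (at t)" if "t \<in> ball z r" for t
    by (rule DERIV_cong[OF DERIV_power[OF du]]) (use that r in \<open>auto simp: algebra_simps power2_eq_square\<close>)
  moreover have "((\<lambda>t. w t - u t) has_field_derivative (w t - u t)\<^sup>2 / 2 + 0 * (u t)\<^sup>2) (at t)" if t: "t \<in> ball z r" for t
  proof (rule DERIV_cong[OF DERIV_diff[OF sol(3) du]])
    have tH: "t \<in> \<H>" using t r by auto
    thus "t \<in> \<H>" "t \<in> \<H>" by auto
    have "ratfun P N (chi t) * (deriv chi t)\<^sup>2 = - (u t)\<^sup>2 / 2"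
      using Q[OF sol(5)[OF tH]] by (simp add: u_def power_divide)
    thus "(w t)\<^sup>2 / 2 + ratfun P N (chi t) * (deriv chi t)\<^sup>2 - (w t * u t - (u t)\<^sup>2) = (w t - u t)\<^sup>2 / 2 + 0 * (u t)\<^sup>2"
      by (simp add: power2_diff field_simps)
  qed
  moreover have "(u t)\<^sup>2 \<noteq> 0" if t: "t \<in> ball z r" for t
    using ne[of t] sol(4)[of t] t r by (auto simp: u_def)
  ultimately obtain \<alpha> \<beta> \<gamma> where h: "\<And>t. t \<in> ball z r \<Longrightarrow> (u t)\<^sup>2 * (\<alpha> * t\<^sup>2 + \<beta> * t + \<gamma>)\<^sup>2 = 1"
    using inverse_square_of_quadratic[of z r "\<lambda>t. (u t)\<^sup>2" "\<lambda>t. w t - u t" 0] by blast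
  show False
  proof (rule first_kind_no_invariant_quadratic[OF first_kind chi_holomorphic deriv_chi_nz invariant r(2,1), of 1 "[:-E, 1:]" \<alpha> \<beta> \<gamma>])
    show "poly [:-E, 1:] (chi z) \<noteq> 0" using ne[OF z] by simp
    fix t assume t: "t \<in> ball z r"
    hence "t \<in> \<H>" using r by blast
    hence "chi t - E \<noteq> 0" by (rule ne)
    thus "poly 1 (chi t) * (deriv chi t)\<^sup>2 * (\<alpha> * t\<^sup>2 + \<beta> * t + \<gamma>)\<^sup>2 = (poly [:-E, 1:] (chi t))\<^sup>2"
      using h[OF t] by (simp add: u_def power_divide field_simps)
  qed auto
qed

lemma degree_P_less: "degree P < degree N" and P_nz: "P \<noteq> 0"
proof -
  show P0: "P \<noteq> 0"
  proof
    assume "P = 0"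
    hence "((\<lambda>x::complex. 0::complex) \<longlongrightarrow> - 1/2) at_infinity" using parabolic_infinity by (simp add: ratfun_def)
    hence "(0::complex) = - 1/2" using tendsto_unique[OF trivial_limit_at_infinity tendsto_const] by blast
    thus False by simp
  qed
  show "degree P < degree N"
  proof (rule ccontr)
    assume "\<not> degree P < degree N"
    hence NP: "((\<lambda>x. poly N x / x ^ degree P) \<longlongrightarrow> coeff N (degree P)) at_infinity"
      by (intro poly_over_power_at_infinity) simp
    have "((\<lambda>x. (inverse x)\<^sup>2 * (x\<^sup>2 * ratfun P N x) * (poly N x / x ^ degree P))
        \<longlongrightarrow> 0\<^sup>2 * (-1/2) * coeff N (degree P)) at_infinity"
      by (intro tendsto_intros parabolic_infinity tendsto_inverse_0 NP)
    hence l: "((\<lambda>x. (inverse x)\<^sup>2 * (x\<^sup>2 * ratfun P N x) * (poly N x / x ^ degree P)) \<longlongrightarrow> 0) at_infinity" by simp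
    have "bounded {x. poly N x = 0}" using poly_roots_finite[OF N_nz] by (rule finite_imp_bounded)
    then obtain B where B: "\<And>x. poly N x = 0 \<Longrightarrow> cmod x \<le> B" by (auto simp: bounded_iff)
    have "\<forall>\<^sub>F x in at_infinity. (inverse x)\<^sup>2 * (x\<^sup>2 * ratfun P N x) * (poly N x / x ^ degree P) = poly P x / x ^ degree P"
      unfolding eventually_at_infinity
    proof (intro exI allI impI)
      fix x :: complex assume "\<bar>B\<bar> + 1 \<le> norm x"
      hence "x \<noteq> 0" "poly N x \<noteq> 0" using B[of x] by auto
      thus "(inverse x)\<^sup>2 * (x\<^sup>2 * ratfun P N x) * (poly N x / x ^ degree P) = poly P x / x ^ degree P"
        by (simp add: ratfun_def power_inverse)
    qed
    from Lim_transform_eventually[OF l this] have "((\<lambda>x. poly P x / x ^ degree P) \<longlongrightarrow> 0) at_infinity" .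
    moreover have "((\<lambda>x. poly P x / x ^ degree P) \<longlongrightarrow> lead_coeff P) at_infinity"
      by (rule poly_over_power_at_infinity) simp
    ultimately have "lead_coeff P = 0" using tendsto_unique[OF trivial_limit_at_infinity] by blast
    thus False using P0 by simp
  qed
qed

text \<open>The hypothesis says that \<open>R = p/q\<close> solves \<open>R' - R\<^sup>2/2 = - Q\<close>. Its poles are simple: at a multiple pole \<open>R\<^sup>2\<close> would dominate.
  The residue \<open>r\<close> at a pole satisfies \<open>r + r\<^sup>2/2 = \<kappa>\<close>, that is \<open>r = -1\<close> at a root of \<open>N\<close> and \<open>r = -2\<close> elsewhere. The same
  computation at infinity shows that the residues add up to \<open>-1\<close>, but there are at least two roots of \<open>N\<close>, all of them poles.\<close>
lemma riccati_no_rational_solution: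
  assumes cop: "coprime p q" and q0: "q \<noteq> 0"
    and ric: "N * (pderiv p * q - p * pderiv q - smult (1/2) (p ^ 2)) + P * q ^ 2 = 0"
  shows False
proof -
  define T where "T = pderiv p * q - p * pderiv q - smult (1/2) (p ^ 2)"
  define Z where "Z = {x. poly q x = 0}"
  define m :: "complex \<Rightarrow> nat" where "m e = (if poly N e = 0 then 1 else 2)" for e
  have NT: "N * T = - (P * q ^ 2)" using ric by (simp add: T_def eq_neg_iff_add_eq_0)
  have NTx: "poly N x * poly T x = - (poly P x * (poly q x)\<^sup>2)" for x
    using arg_cong[OF NT, of "\<lambda>p. poly p x"] by (simp add: poly_power)
  have finZ: "finite Z" unfolding Z_def by (rule poly_roots_finite[OF q0])
  have NZ: "e \<in> Z" if "poly N e = 0" for e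
  proof -
    have "poly P e \<noteq> 0" using coprime_poly_0[OF coprime_PN, of e] that by auto
    thus ?thesis using NTx[of e] that by (auto simp: Z_def)
  qed
  have res: "poly (pderiv q) e \<noteq> 0 \<and> poly p e = - of_nat (m e) * poly (pderiv q) e" if e: "e \<in> Z" for e
  proof -
    have qe: "poly q e = 0" using e by (simp add: Z_def)
    have pe: "poly p e \<noteq> 0" using coprime_poly_0[OF cop, of e] qe by auto
    define k where "k = order e q"
    obtain q1 where q1: "q = [:-e, 1:] ^ k * q1" "\<not> [:-e, 1:] dvd q1"
      using order_decomp[OF q0, of e] unfolding k_def by blast
    have q1e: "poly q1 e \<noteq> 0" using q1(2) by (simp add: poly_eq_0_iff_dvd)
    have "k \<noteq> 0" using qe q0 by (simp add: k_def order_root)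
    then obtain l where k: "k = Suc l" by (cases k) auto
    have dq: "poly (pderiv q) e = (if l = 0 then poly q1 e else 0)"
      unfolding q1(1) k pderiv_mult pderiv_power_Suc by (simp add: pderiv_pCons power_0_left)
    define \<kappa> :: complex where "\<kappa> = (if poly N e = 0 then -1/2 else 0)"
    have kap: "((\<lambda>x. (x - e)\<^sup>2 * ratfun P N x) \<longlongrightarrow> \<kappa>) (at e)"
      using parabolic_root[of e] regular_value_double_pole_limit[of N e P] by (auto simp: \<kappa>_def)
    have "((\<lambda>x. ((x - e)\<^sup>2) ^ l * ((x - e)\<^sup>2 * ratfun P N x)) \<longlongrightarrow> ((e - e)\<^sup>2) ^ l * \<kappa>) (at e)"
      by (intro tendsto_intros kap)
    moreover have "\<forall>\<^sub>F x in at e. ((x - e)\<^sup>2) ^ l * ((x - e)\<^sup>2 * ratfun P N x) = - poly T x / (poly q1 x)\<^sup>2"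
      using poly_eventually_nonzero_at[OF N_nz] poly_eventually_nonzero_at[OF q0]
    proof eventually_elim
      case (elim x)
      have qx: "poly q x = (x - e) ^ k * poly q1 x" by (simp add: q1(1) poly_power)
      hence nz: "poly q1 x \<noteq> 0" using elim by auto
      have pq: "(poly q x)\<^sup>2 = ((x - e)\<^sup>2) ^ l * (x - e)\<^sup>2 * (poly q1 x)\<^sup>2"
        unfolding qx k by (simp add: power_mult_distrib power_mult[symmetric] power_add[symmetric] mult.commute)
      have "poly P x / poly N x * (poly q x)\<^sup>2 = - poly T x" using NTx[of x] elim by (simp add: field_simps)
      thus ?case unfolding pq ratfun_def using nz by (simp add: field_simps)
    qed
    ultimately have "((\<lambda>x. - poly T x / (poly q1 x)\<^sup>2) \<longlongrightarrow> ((e - e)\<^sup>2) ^ l * \<kappa>) (at e)"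
      by (rule Lim_transform_eventually)
    moreover have "((\<lambda>x. - poly T x / (poly q1 x)\<^sup>2) \<longlongrightarrow> - poly T e / (poly q1 e)\<^sup>2) (at e)"
      using q1e by (intro tendsto_intros) auto
    ultimately have lim: "((e - e)\<^sup>2) ^ l * \<kappa> = - poly T e / (poly q1 e)\<^sup>2"
      using tendsto_unique[OF trivial_limit_at] by blast
    have T: "poly T e = - poly p e * poly (pderiv q) e - (poly p e)\<^sup>2 / 2"
      by (simp add: T_def qe poly_power)
    have l0: "l = 0"
    proof (rule ccontr)
      assume "l \<noteq> 0"
      hence "(poly p e)\<^sup>2 = 0" using lim q1e by (simp add: T dq power_0_left)
      thus False using pe by simp
    qed
    define R where "R = poly p e / poly q1 e"
    have pR: "poly p e = R * poly q1 e" using q1e by (simp add: R_def)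
    have alg: "- (- (R * y) * y - (R * y)\<^sup>2 / 2) = (R + R\<^sup>2 / 2) * y\<^sup>2" for y
      by (simp add: algebra_simps power2_eq_square)
    have "\<kappa> = - poly T e / (poly q1 e)\<^sup>2" using lim by (simp add: l0)
    also have "- poly T e = (R + R\<^sup>2 / 2) * (poly q1 e)\<^sup>2"
      unfolding T dq pR by (simp only: l0 if_True simp_thms alg)
    finally have "\<kappa> = R + R\<^sup>2 / 2" using q1e by simp
    hence kR: "2 * \<kappa> = 2 * R + R\<^sup>2" by simp
    have "R = - of_nat (m e)"
    proof (cases "poly N e = 0")
      case True
      hence "2 * R + R\<^sup>2 = - 1" using kR by (simp add: \<kappa>_def)
      moreover have "(R + 1)\<^sup>2 = (2 * R + R\<^sup>2) + 1" by (simp add: power2_sum)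
      ultimately have "(R + 1)\<^sup>2 = 0" by simp
      hence "R = - 1" by (simp add: eq_neg_iff_add_eq_0)
      thus ?thesis using True by (simp add: m_def)
    next
      case False
      hence "R * (R + 2) = 0" using kR by (simp add: \<kappa>_def power2_eq_square algebra_simps)
      moreover have "R \<noteq> 0" using pe q1e by (simp add: R_def)
      ultimately show ?thesis using False by (simp add: m_def add_eq_0_iff2)
    qed
    thus ?thesis using dq l0 q1e pR by simp
  qed
  obtain E1 E2 where E: "E1 \<noteq> E2" "poly N E1 = 0" "poly N E2 = 0" using two_cusps by blast
  have EZ: "{E1, E2} \<subseteq> Z" using E NZ by auto
  have "rsquarefree q" unfolding rsquarefree_roots using res by (auto simp: Z_def)
  hence cardZ: "card Z = degree q" unfolding Z_def by (rule rsquarefree_card_roots)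
  have "card {E1, E2} \<le> card Z" by (rule card_mono[OF finZ EZ])
  hence card2: "card Z \<ge> 2" using E by simp
  have p0: "p \<noteq> 0" using coprime_poly_0[OF cop, of E1] EZ by (auto simp: Z_def)
  \<comment> \<open>Otherwise \<open>R\<^sup>2\<close> would dominate \<open>R'\<close> and \<open>Q\<close> at infinity.\<close>
  have dpq: "degree p < degree q"
  proof (rule ccontr)
    assume d: "\<not> degree p < degree q"
    define n where "n = degree p"
    have n: "n > 0" using d card2 cardZ by (simp add: n_def)
    have "degree (pderiv p * q) < 2 * n"
      using degree_mult_le[of "pderiv p" q] degree_pderiv[of p] d n by (simp add: n_def)
    moreover have "degree (p * pderiv q) < 2 * n"
      using degree_mult_le[of p "pderiv q"] degree_pderiv[of q] d n card2 cardZ by (simp add: n_def)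
    ultimately have "coeff T (2 * n) = - coeff (p ^ 2) (2 * n) / 2"
      by (simp add: T_def coeff_eq_0)
    also have "coeff (p ^ 2) (2 * n) = (lead_coeff p)\<^sup>2"
      unfolding n_def power2_eq_square mult_2 by (rule coeff_mult_degree_sum)
    finally have c: "coeff T (2 * n) \<noteq> 0" using p0 by simp
    hence dT: "degree T \<ge> 2 * n" by (rule le_degree)
    have T0: "T \<noteq> 0" using c by auto
    have "degree N + degree T = degree (P * q ^ 2)"
      using arg_cong[OF NT, of degree] N_nz T0 by (simp add: degree_mult_eq)
    also have "\<dots> = degree P + 2 * degree q" using P_nz q0 by (simp add: degree_mult_eq degree_power_eq)
    finally show False using dT d degree_P_less by (simp add: n_def)
  qed
  \<comment> \<open>\<open>L/q\<close> is \<open>R\<close> minus its principal parts; \<open>L\<close> vanishes at all \<open>degree q\<close> roots of \<open>q\<close> and has smaller degree.\<close>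
  define L where "L = p + (\<Sum>e\<in>Z. smult (of_nat (m e)) (q div [:-e, 1:]))"
  have qd: "q = [:-e, 1:] * (q div [:-e, 1:])" if "e \<in> Z" for e
  proof -
    have "[:-e, 1:] dvd q" using that by (simp add: Z_def poly_eq_0_iff_dvd)
    thus ?thesis by (rule dvd_mult_div_cancel[symmetric])
  qed
  have qdx: "poly q x = (x - e) * poly (q div [:-e, 1:]) x" if "e \<in> Z" for e x
    by (subst qd[OF that]) (simp add: algebra_simps)
  have qde: "poly (q div [:-e, 1:]) e = poly (pderiv q) e" if "e \<in> Z" for e
  proof -
    have "pderiv q = pderiv ([:-e, 1:] * (q div [:-e, 1:]))" using qd[OF that] by simp
    thus ?thesis by (simp only: pderiv_mult) (simp add: pderiv_pCons)
  qed
  have "L = 0"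
  proof (rule ccontr)
    assume L0: "L \<noteq> 0"
    have "degree (\<Sum>e\<in>Z. smult (of_nat (m e)) (q div [:-e, 1:])) < degree q"
    proof (rule degree_sum_less)
      show "0 < degree q" using dpq by simp
      fix e assume e: "e \<in> Z"
      have "q div [:-e, 1:] \<noteq> 0" using qd[OF e] q0 by auto
      hence "degree q = 1 + degree (q div [:-e, 1:])"
        using degree_mult_eq[of "[:-e, 1:]" "q div [:-e, 1:]"] qd[OF e] by simp
      thus "degree (smult (of_nat (m e)) (q div [:-e, 1:])) < degree q"
        using degree_smult_le[of "of_nat (m e)" "q div [:-e, 1:]"] by simp
    qed
    hence "degree L < degree q" unfolding L_def using dpq by (rule degree_add_less[rotated])
    moreover have "Z \<subseteq> {x. poly L x = 0}"
    proof
      fix e assume e: "e \<in> Z"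
      have "(\<Sum>e'\<in>Z. of_nat (m e') * poly (q div [:-e', 1:]) e) = of_nat (m e) * poly (q div [:-e, 1:]) e"
      proof (subst sum.remove[OF finZ e], subst sum.neutral)
        show "\<forall>e'\<in>Z - {e}. of_nat (m e') * poly (q div [:- e', 1:]) e = 0"
          using qdx[of _ e] e by (auto simp: Z_def)
      qed simp
      thus "e \<in> {x. poly L x = 0}" using res[OF e] qde[OF e] by (simp add: L_def poly_sum)
    qed
    hence "card Z \<le> degree L"
      using card_mono[OF poly_roots_finite[OF L0]] card_poly_roots_bound[OF L0] by (meson order_trans)
    ultimately show False using cardZ by simp
  qed
  define S where "S x = (\<Sum>e\<in>Z. of_nat (m e) / (x - e))" for x :: complex
  have R: "poly p x / poly q x = - S x" if x: "x \<notin> Z" for x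
  proof -
    have "poly p x = - (\<Sum>e\<in>Z. of_nat (m e) * poly (q div [:-e, 1:]) x)"
      using arg_cong[OF \<open>L = 0\<close>, of "\<lambda>p. poly p x"] by (simp add: L_def poly_sum eq_neg_iff_add_eq_0)
    also have "(\<Sum>e\<in>Z. of_nat (m e) * poly (q div [:-e, 1:]) x) = (\<Sum>e\<in>Z. of_nat (m e) / (x - e) * poly q x)"
      using x by (intro sum.cong refl) (auto simp: qdx)
    also have "\<dots> = S x * poly q x" by (simp add: S_def sum_distrib_right)
    finally show ?thesis using x by (simp add: Z_def)
  qed
  define S2 where "S2 x = (\<Sum>e\<in>Z. of_nat (m e) / (x - e)\<^sup>2)" for x :: complex
  have Q: "ratfun P N x = - S2 x + (S x)\<^sup>2 / 2" if x: "x \<notin> Z" for x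
  proof -
    have nz: "poly q x \<noteq> 0" "poly N x \<noteq> 0" using x NZ by (auto simp: Z_def)
    have oz: "open (- Z)" using finZ by (simp add: finite_imp_closed open_Compl)
    have "((\<lambda>x. poly p x / poly q x) has_field_derivative
       (poly (pderiv p) x * poly q x - poly p x * poly (pderiv q) x) / (poly q x * poly q x)) (at x)"
      by (intro DERIV_divide poly_DERIV nz)
    hence 1: "((\<lambda>x. - S x) has_field_derivative
       (poly (pderiv p) x * poly q x - poly p x * poly (pderiv q) x) / (poly q x * poly q x)) (at x)"
      by (rule has_field_derivative_transform_within_open[OF _ oz]) (use x R in auto)
    have "(S has_field_derivative (\<Sum>e\<in>Z. - (of_nat (m e) / (x - e)\<^sup>2))) (at x)"
      unfolding S_def
      by (rule DERIV_sum) (use x in \<open>auto intro!: derivative_eq_intros simp: power2_eq_square\<close>)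
    hence "((\<lambda>x. - S x) has_field_derivative S2 x) (at x)"
      using DERIV_minus by (fastforce simp: S2_def sum_negf)
    from DERIV_unique[OF 1 this]
    have "(poly (pderiv p) x * poly q x - poly p x * poly (pderiv q) x) / (poly q x)\<^sup>2 = S2 x"
      by (simp add: power2_eq_square)
    moreover have "poly T x / (poly q x)\<^sup>2 = (poly (pderiv p) x * poly q x - poly p x * poly (pderiv q) x) / (poly q x)\<^sup>2
        - (poly p x / poly q x)\<^sup>2 / 2"
      by (simp add: T_def poly_power diff_divide_distrib power_divide)
    ultimately have "poly T x / (poly q x)\<^sup>2 = S2 x - (S x)\<^sup>2 / 2" using R[OF x] by simp
    moreover have "poly T x / (poly q x)\<^sup>2 = - ratfun P N x"
      using NTx[of x] nz by (simp add: ratfun_def field_simps)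
    ultimately have "- ratfun P N x = S2 x - (S x)\<^sup>2 / 2" by (simp only:)
    from arg_cong[OF this, of uminus] show ?thesis by simp
  qed
  define \<mu> :: complex where "\<mu> = (\<Sum>e\<in>Z. of_nat (m e))"
  have q1: "((\<lambda>x. x / (x - e)) \<longlongrightarrow> 1) at_infinity" for e :: complex
  proof -
    have "((\<lambda>x. 1 / (1 - e * inverse x)) \<longlongrightarrow> 1 / (1 - e * 0)) at_infinity"
      by (intro tendsto_intros tendsto_inverse_0) auto
    hence l: "((\<lambda>x. 1 / (1 - e * inverse x)) \<longlongrightarrow> 1) at_infinity" by simp
    have "\<forall>\<^sub>F x in at_infinity. 1 / (1 - e * inverse x) = x / (x - e)"
      unfolding eventually_at_infinity
    proof (intro exI allI impI)
      fix x :: complex assume "cmod e + 1 \<le> norm x"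
      hence "norm x > 0" using norm_ge_zero[of e] by linarith
      hence "x \<noteq> 0" by simp
      hence "1 - e * inverse x = (x - e) / x" by (simp add: field_simps)
      thus "1 / (1 - e * inverse x) = x / (x - e)" by simp
    qed
    thus ?thesis by (rule Lim_transform_eventually[OF l])
  qed
  have "((\<lambda>x. - (\<Sum>e\<in>Z. of_nat (m e) * (x / (x - e))\<^sup>2) + (\<Sum>e\<in>Z. of_nat (m e) * (x / (x - e)))\<^sup>2 / 2)
     \<longlongrightarrow> - (\<Sum>e\<in>Z. of_nat (m e) * 1\<^sup>2) + (\<Sum>e\<in>Z. of_nat (m e) * 1)\<^sup>2 / 2) at_infinity"
    by (intro tendsto_intros q1) auto
  hence l1: "((\<lambda>x. - (\<Sum>e\<in>Z. of_nat (m e) * (x / (x - e))\<^sup>2) + (\<Sum>e\<in>Z. of_nat (m e) * (x / (x - e)))\<^sup>2 / 2)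
     \<longlongrightarrow> - \<mu> + \<mu>\<^sup>2 / 2) at_infinity" by (simp add: \<mu>_def)
  obtain B where B: "\<And>x. x \<in> Z \<Longrightarrow> cmod x \<le> B" using finite_imp_bounded[OF finZ] by (auto simp: bounded_iff)
  have "\<forall>\<^sub>F x in at_infinity. - (\<Sum>e\<in>Z. of_nat (m e) * (x / (x - e))\<^sup>2) + (\<Sum>e\<in>Z. of_nat (m e) * (x / (x - e)))\<^sup>2 / 2
      = x\<^sup>2 * ratfun P N x"
    unfolding eventually_at_infinity
  proof (intro exI allI impI)
    fix x :: complex assume "\<bar>B\<bar> + 1 \<le> norm x"
    hence x: "x \<notin> Z" using B[of x] by auto
    have "(\<Sum>e\<in>Z. of_nat (m e) * (x / (x - e))\<^sup>2) = x\<^sup>2 * S2 x"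
      unfolding S2_def sum_distrib_left by (intro sum.cong refl) (simp add: power_divide)
    moreover have "(\<Sum>e\<in>Z. of_nat (m e) * (x / (x - e))) = x * S x"
      unfolding S_def sum_distrib_left by (intro sum.cong refl) simp
    ultimately show "- (\<Sum>e\<in>Z. of_nat (m e) * (x / (x - e))\<^sup>2) + (\<Sum>e\<in>Z. of_nat (m e) * (x / (x - e)))\<^sup>2 / 2
      = x\<^sup>2 * ratfun P N x" unfolding Q[OF x] by (simp add: power_mult_distrib algebra_simps)
  qed
  from Lim_transform_eventually[OF l1 this] have "((\<lambda>x. x\<^sup>2 * ratfun P N x) \<longlongrightarrow> - \<mu> + \<mu>\<^sup>2 / 2) at_infinity" .
  hence "- \<mu> + \<mu>\<^sup>2 / 2 = - 1/2" using parabolic_infinity tendsto_unique[OF trivial_limit_at_infinity] by blast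
  hence "(\<mu> - 1)\<^sup>2 = 0" by (simp add: power2_diff field_simps)
  hence "complex_of_nat (\<Sum>e\<in>Z. m e) = of_nat 1" by (simp add: \<mu>_def)
  hence "(\<Sum>e\<in>Z. m e) = 1" using of_nat_eq_iff by blast
  moreover have "card Z \<le> (\<Sum>e\<in>Z. m e)"
    using sum_mono[of Z "\<lambda>_. 1" m] by (simp add: m_def)
  ultimately show False using card2 by simp
qed

end

locale uniformization_connection = parabolic_uniformization P N chi G + rational_connection P N p q
  for P N chi G p q +
  assumes q_nz: "q \<noteq> 0"
begin

lemma den_nz: "den \<noteq> 0" using N_nz q_nz by (simp add: den_def)

lemma ex_generic_point:
  assumes "A \<noteq> 0"
  obtains \<tau> where "\<tau> \<in> \<H>" "poly A (chi \<tau>) \<noteq> 0" "poly den (chi \<tau>) \<noteq> 0"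
proof -
  obtain x where x: "poly (A * den) x \<noteq> 0" using ex_not_root_not_eq[of "A * den"] assms den_nz by auto
  hence "poly N x \<noteq> 0" by (auto simp: den_def)
  then obtain \<tau> where "\<tau> \<in> \<H>" "chi \<tau> = x" using surjective by blast
  thus ?thesis using that x by auto
qed

lemma poly_chi_continuous: "\<tau> \<in> \<H> \<Longrightarrow> isCont (\<lambda>t. poly A (chi t)) \<tau>"
  using holomorphic_on_imp_continuous_on[OF chi_holomorphic] open_upper_half_plane
  by (intro continuous_intros) (simp add: continuous_on_eq_continuous_at)

lemma ex_generic_ball:
  assumes "\<tau> \<in> \<H>" "poly A (chi \<tau>) \<noteq> 0"
  obtains r where "r > 0" "ball \<tau> r \<subseteq> \<H>" "\<And>t. t \<in> ball \<tau> r \<Longrightarrow> poly A (chi t) \<noteq> 0"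
proof -
  have "\<forall>\<^sub>F t in nhds \<tau>. poly A (chi t) \<noteq> 0"
    using poly_chi_continuous[OF assms(1), of A] tendsto_at_iff_tendsto_nhds[of "\<lambda>t. poly A (chi t)" \<tau>] assms(2)
    by (auto simp: isCont_def intro: tendsto_imp_eventually_ne)
  moreover have "\<forall>\<^sub>F t in nhds \<tau>. t \<in> \<H>" using open_upper_half_plane assms(1) by (rule eventually_nhds_in_open)
  ultimately have "\<forall>\<^sub>F t in nhds \<tau>. t \<in> \<H> \<and> poly A (chi t) \<noteq> 0" by eventually_elim simp
  then obtain r where "r > 0" "\<And>t. dist t \<tau> < r \<Longrightarrow> t \<in> \<H> \<and> poly A (chi t) \<noteq> 0"
    by (auto simp: eventually_nhds_metric)
  thus ?thesis by (intro that[of r]) (auto simp: dist_commute)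
qed

text \<open>In terms of \<open>R = num/den\<close> the polynomial \<open>S2\<close> is \<open>den\<^sup>2 (Q + R' - R\<^sup>2/2)\<close>.\<close>
lemma S2_nz: "S2 \<noteq> 0"
proof
  assume S2: "S2 = 0"
  define d where "d = gcd p q"
  have d0: "d \<noteq> 0" using q_nz by (simp add: d_def)
  obtain p1 q1 where pq: "p = p1 * d" "q = q1 * d" "coprime p1 q1"
    using gcd_coprime_exists[of p q] d0 unfolding d_def by blast
  have q10: "q1 \<noteq> 0" using pq(2) q_nz by auto
  have "S2 = P * N * q ^ 2 + pderiv (p * N) * (N * q) - (p * N) * pderiv (N * q) - smult (1/2) ((p * N) ^ 2)"
    by (simp add: S2_def num_def den_def)
  also have "\<dots> = (N * d ^ 2) * (N * (pderiv p1 * q1 - p1 * pderiv q1 - smult (1/2) (p1 ^ 2)) + P * q1 ^ 2)"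
    unfolding pq(1,2)
    by (simp add: pderiv_mult algebra_simps power2_eq_square smult_add_right smult_diff_right)
  finally have "N * (pderiv p1 * q1 - p1 * pderiv q1 - smult (1/2) (p1 ^ 2)) + P * q1 ^ 2 = 0"
    using S2 N_nz d0 by simp
  from riccati_no_rational_solution[OF pq(3) q10 this] show False .
qed

text \<open>If \<open>W = 0\<close>, then \<open>J = b\<^sup>2/a\<^sup>3\<close> is constant along \<open>\<tau>\<close>. With \<open>\<omega> = a'/(2a) = f + b/(2a)\<close> one finds
  \<open>\<omega>' - \<omega>\<^sup>2/2 = (1 + J/8) a\<close>, so \<open>a\<close> is the inverse square of a quadratic polynomial.\<close>
lemma W_nz: "W \<noteq> 0"
proof
  assume W: "W = 0"
  obtain z where z: "z \<in> \<H>" "poly S2 (chi z) \<noteq> 0" "poly den (chi z) \<noteq> 0" using ex_generic_point[OF S2_nz] .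
  hence "poly (S2 * den) (chi z) \<noteq> 0" by simp
  from ex_generic_ball[OF z(1) this]
  obtain r where r: "r > 0" "ball z r \<subseteq> \<H>" and nz: "\<And>t. t \<in> ball z r \<Longrightarrow> poly (S2 * den) (chi t) \<noteq> 0" by blast
  define V where "V = ball z r"
  have sol: "schwarz_solution P N V chi (deriv chi) (canonical_connection chi)"
    using schwarz r by (auto simp: schwarz_solution_def V_def)
  define f where "f = conn chi (deriv chi) (canonical_connection chi)"
  define \<rho> where "\<rho> t = deriv chi t / poly den (chi t)" for t
  have qn: "poly q (chi t) \<noteq> 0" if "t \<in> V" for t using nz that by (auto simp: V_def den_def)
  have dn: "poly den (chi t) \<noteq> 0" "poly S2 (chi t) \<noteq> 0" if "t \<in> V" for t using nz that by (auto simp: V_def)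
  define a where "a t = jet_a_at f t" for t
  define b where "b t = jet_b_at f t" for t
  define c where "c t = jet_c_at f t" for t
  note j = jets_of_conn[OF sol qn, of f]
  have fV: "f holomorphic_on V" and a: "\<And>t. t \<in> V \<Longrightarrow> a t = poly S2 (chi t) * \<rho> t ^ 2"
    and b: "\<And>t. t \<in> V \<Longrightarrow> b t = poly S3 (chi t) * \<rho> t ^ 3" and c: "\<And>t. t \<in> V \<Longrightarrow> c t = poly S4 (chi t) * \<rho> t ^ 4"
    using j(1)[of z] j(2-4) r(1) by (auto simp: f_def V_def a_def b_def c_def \<rho>_def)
  have a0: "a t \<noteq> 0" if t: "t \<in> V" for t
    using dn[OF t] deriv_chi_nz[of t] t r by (auto simp: a[OF t] \<rho>_def V_def)
  have V: "open V" by (simp add: V_def)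
  have d: "(f has_field_derivative a t + (f t)\<^sup>2 / 2) (at t)" "(a has_field_derivative b t + 2 * f t * a t) (at t)"
    "(b has_field_derivative c t + 3 * f t * b t) (at t)" if "t \<in> V" for t
    using jet_derivatives[OF V fV that] by (simp_all add: a_def[abs_def] b_def[abs_def] c_def[abs_def])
  \<comment> \<open>This is \<open>W = 0\<close> along \<open>\<tau>\<close>.\<close>
  have rel: "c t * a t = 3/2 * (b t)\<^sup>2" if t: "t \<in> V" for t
  proof -
    have "3 * (poly S3 (chi t))\<^sup>2 = 2 * (poly S2 (chi t) * poly S4 (chi t))"
      using arg_cong[OF W_den, of "\<lambda>p. poly p (chi t)"] W by (simp add: poly_power)
    hence "poly S2 (chi t) * poly S4 (chi t) = 3/2 * (poly S3 (chi t))\<^sup>2" by simp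
    hence "(poly S2 (chi t) * poly S4 (chi t)) * \<rho> t ^ 6 = 3/2 * (poly S3 (chi t))\<^sup>2 * \<rho> t ^ 6" by (simp only:)
    moreover have "c t * a t = (poly S2 (chi t) * poly S4 (chi t)) * \<rho> t ^ 6" unfolding a[OF t] c[OF t]
      by (simp add: power_add[symmetric] mult_ac)
    moreover have "(b t)\<^sup>2 = (poly S3 (chi t))\<^sup>2 * \<rho> t ^ 6" unfolding b[OF t]
      by (simp add: power_mult_distrib power_mult[symmetric])
    ultimately show ?thesis by simp
  qed
  define \<omega> where "\<omega> t = f t + b t / (2 * a t)" for t
  define K where "K t = 1 + (b t)\<^sup>2 / (8 * a t ^ 3)" for t
  have dK: "(K has_field_derivative 0) (at t)" if t: "t \<in> V" for t
  proof (rule DERIV_cong)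
    show "(K has_field_derivative 0 + ((2 * (b t) * (c t + 3 * f t * b t)) * (8 * a t ^ 3)
        - (b t)\<^sup>2 * (8 * (3 * (a t)\<^sup>2 * (b t + 2 * f t * a t)))) / ((8 * a t ^ 3) * (8 * a t ^ 3))) (at t)"
      unfolding K_def using a0[OF t]
      by (intro DERIV_add DERIV_const DERIV_divide) (auto intro!: derivative_eq_intros d[OF t])
    have "(2 * (b t) * (c t + 3 * f t * b t)) * (8 * a t ^ 3) - (b t)\<^sup>2 * (8 * (3 * (a t)\<^sup>2 * (b t + 2 * f t * a t)))
       = 16 * b t * (a t)\<^sup>2 * (c t * a t) - 24 * (b t) ^ 3 * (a t)\<^sup>2"
      by (simp add: algebra_simps power2_eq_square power3_eq_cube)
    also have "\<dots> = 0" unfolding rel[OF t] by (simp add: power2_eq_square power3_eq_cube)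
    finally show "0 + ((2 * (b t) * (c t + 3 * f t * b t)) * (8 * a t ^ 3)
        - (b t)\<^sup>2 * (8 * (3 * (a t)\<^sup>2 * (b t + 2 * f t * a t)))) / ((8 * a t ^ 3) * (8 * a t ^ 3)) = 0" by simp
  qed
  then obtain \<kappa> where \<kappa>: "\<And>t. t \<in> V \<Longrightarrow> K t = \<kappa>"
    using holomorphic_zero_derivative_const[of z r K] unfolding V_def by blast
  have "(a has_field_derivative 2 * \<omega> t * a t) (at t)" if t: "t \<in> V" for t
    by (rule DERIV_cong[OF d(2)[OF t]]) (use a0[OF t] in \<open>simp add: \<omega>_def field_simps\<close>)
  moreover have "(\<omega> has_field_derivative (\<omega> t)\<^sup>2 / 2 + \<kappa> * a t) (at t)" if t: "t \<in> V" for t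
  proof (rule DERIV_cong)
    show "(\<omega> has_field_derivative (a t + (f t)\<^sup>2 / 2) + ((c t + 3 * f t * b t) * (2 * a t)
        - b t * (2 * (b t + 2 * f t * a t))) / ((2 * a t) * (2 * a t))) (at t)"
      unfolding \<omega>_def using a0[OF t]
      by (intro DERIV_add DERIV_divide d t) (auto intro!: derivative_eq_intros d[OF t])
    have "(c t + 3 * f t * b t) * (2 * a t) - b t * (2 * (b t + 2 * f t * a t))
      = 2 * (c t * a t) + 2 * f t * b t * a t - 2 * (b t)\<^sup>2" by (simp add: algebra_simps power2_eq_square)
    also have "\<dots> = (b t)\<^sup>2 + 2 * f t * b t * a t" unfolding rel[OF t] by simp
    finally have "(a t + (f t)\<^sup>2 / 2) + ((c t + 3 * f t * b t) * (2 * a t)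
        - b t * (2 * (b t + 2 * f t * a t))) / ((2 * a t) * (2 * a t))
       = (a t + (f t)\<^sup>2 / 2) + ((b t)\<^sup>2 + 2 * f t * b t * a t) / ((2 * a t) * (2 * a t))" by simp
    also have "\<dots> = (\<omega> t)\<^sup>2 / 2 + K t * a t"
    proof -
      define B where "B = b t / (2 * a t)"
      have bB: "b t = 2 * a t * B" using a0[OF t] by (simp add: B_def)
      have "((b t)\<^sup>2 + 2 * f t * b t * a t) / ((2 * a t) * (2 * a t)) = (B\<^sup>2 + f t * B) * ((2 * a t) * (2 * a t)) / ((2 * a t) * (2 * a t))"
        unfolding bB by (simp add: algebra_simps power2_eq_square)
      also have "\<dots> = B\<^sup>2 + f t * B" using a0[OF t] by simp
      finally have 1: "((b t)\<^sup>2 + 2 * f t * b t * a t) / ((2 * a t) * (2 * a t)) = B\<^sup>2 + f t * B" .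
      have "(b t)\<^sup>2 / (8 * a t ^ 3) * a t = B\<^sup>2 / 2"
      proof -
        have "(b t)\<^sup>2 / (8 * a t ^ 3) * a t = ((b t)\<^sup>2 * a t) / (8 * a t ^ 3)" by simp
        also have "(b t)\<^sup>2 * a t = B\<^sup>2 / 2 * (8 * a t ^ 3)"
          unfolding bB by (simp add: power2_eq_square power3_eq_cube)
        also have "\<dots> / (8 * a t ^ 3) = B\<^sup>2 / 2" using a0[OF t] by simp
        finally show ?thesis .
      qed
      hence 2: "K t * a t = a t + B\<^sup>2 / 2" by (simp add: K_def distrib_right)
      have 3: "\<omega> t = f t + B" by (simp add: \<omega>_def B_def)
      show ?thesis unfolding 1 2 3 by (simp add: power2_sum add_divide_distrib)
    qed
    finally show "(a t + (f t)\<^sup>2 / 2) + ((c t + 3 * f t * b t) * (2 * a t)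
        - b t * (2 * (b t + 2 * f t * a t))) / ((2 * a t) * (2 * a t)) = (\<omega> t)\<^sup>2 / 2 + \<kappa> * a t"
      unfolding \<kappa>[OF t] .
  qed
  ultimately obtain \<alpha> \<beta> \<gamma> where h: "\<And>t. t \<in> V \<Longrightarrow> a t * (\<alpha> * t\<^sup>2 + \<beta> * t + \<gamma>)\<^sup>2 = 1"
    using inverse_square_of_quadratic[of z r a \<omega> \<kappa>] a0 unfolding V_def by blast
  show False
  proof (rule first_kind_no_invariant_quadratic[OF first_kind chi_holomorphic deriv_chi_nz invariant r(2,1) z(2,3)])
    fix t assume "t \<in> ball z r"
    hence t: "t \<in> V" by (simp add: V_def)
    show "poly S2 (chi t) * (deriv chi t)\<^sup>2 * (\<alpha> * t\<^sup>2 + \<beta> * t + \<gamma>)\<^sup>2 = (poly den (chi t))\<^sup>2"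
      using h[OF t] dn[OF t] unfolding a[OF t] \<rho>_def by (simp add: power_divide field_simps)
  qed
qed

end

section \<open>Behaviour at the cusps\<close>

lemma open_act_domain:
  assumes "open U" shows "open (act_domain M U)"
proof -
  define D where "D = {\<tau>. M$2$1 * \<tau> + M$2$2 \<noteq> 0}"
  have D: "open D" unfolding D_def by (intro open_Collect_neq continuous_intros)
  have "continuous_on D (moebius M)" unfolding moebius_def[abs_def] D_def
    by (intro continuous_intros) auto
  hence "open (D \<inter> moebius M -` U)" using continuous_open_preimage[OF _ D assms] by blast
  moreover have "act_domain M U = D \<inter> moebius M -` U" by (auto simp: act_domain_def D_def)
  ultimately show ?thesis by simp
qed

text \<open>The Schwarzian derivative is a projective invariant: replacing \<open>X\<close> by \<open>X \<circ> M\<close> transforms \<open>w = X''/X'\<close> by the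
  affine action on connections and preserves its Riccati equation.\<close>
lemma schwarz_solution_moebius:
  assumes sol: "schwarz_solution P N U X X' w" and M: "M \<in> SL2C"
  shows "schwarz_solution P N (act_domain M U) (\<lambda>\<tau>. X (moebius M \<tau>))
    (\<lambda>\<tau>. X' (moebius M \<tau>) / (M$2$1 * \<tau> + M$2$2)\<^sup>2) (connection_act M w)"
  unfolding schwarz_solution_def
proof (intro conjI ballI)
  show "open (act_domain M U)" using sol by (intro open_act_domain) (simp add: schwarz_solution_def)
  fix \<tau> assume \<tau>: "\<tau> \<in> act_domain M U"
  define c where "c = M$2$1"
  define l where "l = (\<lambda>\<tau>. c * \<tau> + M$2$2)"
  define z where "z = moebius M \<tau>"
  have l: "l \<tau> \<noteq> 0" and z: "z \<in> U" using \<tau> by (auto simp: act_domain_def l_def z_def c_def)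
  have d: "(X has_field_derivative X' z) (at z)" "(X' has_field_derivative w z * X' z) (at z)"
    "(w has_field_derivative (w z)\<^sup>2 / 2 + ratfun P N (X z) * (X' z)\<^sup>2) (at z)" "X' z \<noteq> 0" "poly N (X z) \<noteq> 0"
    using sol z by (auto simp: schwarz_solution_def)
  have m: "(moebius M has_field_derivative 1 / (l \<tau>)\<^sup>2) (at \<tau>)"
    using moebius_has_derivative[OF M] l by (simp add: l_def c_def)
  have dl: "(l has_field_derivative c) (at \<tau>)" unfolding l_def by (auto intro!: derivative_eq_intros)
  have l2: "((\<lambda>\<tau>. (l \<tau>)\<^sup>2) has_field_derivative 2 * l \<tau> * c) (at \<tau>)"
    by (rule DERIV_cong[OF DERIV_power[OF dl]]) simp
  note ch = DERIV_chain2[OF d(1)[unfolded z_def] m, folded z_def]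
    DERIV_chain2[OF d(2)[unfolded z_def] m, folded z_def]
    DERIV_chain2[OF d(3)[unfolded z_def] m, folded z_def]
  have lf: "(\<lambda>\<tau>. M$2$1 * \<tau> + M$2$2) = l" by (simp add: l_def c_def)
  have lfp: "M$2$1 * t + M$2$2 = l t" for t by (simp add: l_def c_def)
  show "((\<lambda>\<tau>. X (moebius M \<tau>)) has_field_derivative X' (moebius M \<tau>) / (M$2$1 * \<tau> + M$2$2)\<^sup>2) (at \<tau>)"
    using ch(1) unfolding lfp z_def by simp
  have "((\<lambda>\<tau>. X' (moebius M \<tau>) / (l \<tau>)\<^sup>2) has_field_derivative
      (w z * X' z * (1 / (l \<tau>)\<^sup>2) * (l \<tau>)\<^sup>2 - X' z * (2 * l \<tau> * c)) / ((l \<tau>)\<^sup>2 * (l \<tau>)\<^sup>2)) (at \<tau>)"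
    unfolding z_def by (rule DERIV_divide[OF ch(2)[unfolded z_def] l2]) (use l in simp)
  moreover have "(w z * X' z * (1 / (l \<tau>)\<^sup>2) * (l \<tau>)\<^sup>2 - X' z * (2 * l \<tau> * c)) / ((l \<tau>)\<^sup>2 * (l \<tau>)\<^sup>2)
      = (w z / (l \<tau>)\<^sup>2 - 2 * c / l \<tau>) * (X' z / (l \<tau>)\<^sup>2)"
    using l by (simp add: field_simps power2_eq_square)
  ultimately show "((\<lambda>\<tau>. X' (moebius M \<tau>) / (M$2$1 * \<tau> + M$2$2)\<^sup>2) has_field_derivative
      connection_act M w \<tau> * (X' (moebius M \<tau>) / (M$2$1 * \<tau> + M$2$2)\<^sup>2)) (at \<tau>)"
    unfolding lfp connection_act_def z_def c_def by simp
  have "((\<lambda>\<tau>. w (moebius M \<tau>) / (l \<tau>)\<^sup>2 - 2 * c / l \<tau>) has_field_derivative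
      (((w z)\<^sup>2 / 2 + ratfun P N (X z) * (X' z)\<^sup>2) * (1 / (l \<tau>)\<^sup>2) * (l \<tau>)\<^sup>2 - w z * (2 * l \<tau> * c)) / ((l \<tau>)\<^sup>2 * (l \<tau>)\<^sup>2)
      - (0 * l \<tau> - 2 * c * c) / (l \<tau> * l \<tau>)) (at \<tau>)"
    unfolding z_def by (intro DERIV_diff DERIV_divide ch(3)[unfolded z_def] l2 dl DERIV_const) (use l in auto)
  moreover have "(((w z)\<^sup>2 / 2 + Y) * (1 / (l \<tau>)\<^sup>2) * (l \<tau>)\<^sup>2 - w z * (2 * l \<tau> * c)) / ((l \<tau>)\<^sup>2 * (l \<tau>)\<^sup>2)
      - (0 * l \<tau> - 2 * c * c) / (l \<tau> * l \<tau>) = (w z / (l \<tau>)\<^sup>2 - 2 * c / l \<tau>)\<^sup>2 / 2 + Y / ((l \<tau>)\<^sup>2)\<^sup>2" for Y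
  proof -
    define u where "u = 1 / l \<tau>"
    have u: "1 / (l \<tau>)\<^sup>2 = u\<^sup>2" "x / (l \<tau>)\<^sup>2 = x * u\<^sup>2" "x / l \<tau> = x * u" "x / ((l \<tau>)\<^sup>2 * (l \<tau>)\<^sup>2) = x * u\<^sup>2 * u\<^sup>2"
      "x / (l \<tau> * l \<tau>) = x * u * u" "x / ((l \<tau>)\<^sup>2)\<^sup>2 = x * u\<^sup>2 * u\<^sup>2" "l \<tau> * u = 1" "u\<^sup>2 * (l \<tau>)\<^sup>2 = 1" for x
      using l by (simp_all add: u_def power2_eq_square)
    have "(((w z)\<^sup>2 / 2 + Y) * (1 * u\<^sup>2) * (l \<tau>)\<^sup>2 - w z * (2 * l \<tau> * c)) * u\<^sup>2 * u\<^sup>2 - (0 * l \<tau> - 2 * c * c) * u * u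
      = (((w z)\<^sup>2 / 2 + Y) * (u\<^sup>2 * (l \<tau>)\<^sup>2)) * u\<^sup>2 * u\<^sup>2 - w z * 2 * c * (l \<tau> * u) * u * u\<^sup>2 + 2 * c * c * u * u"
      by (simp add: algebra_simps power2_eq_square)
    also have "\<dots> = (w z * u\<^sup>2 - 2 * c * u)\<^sup>2 / 2 + Y * u\<^sup>2 * u\<^sup>2"
      unfolding u(7,8)
      by (simp add: power2_eq_square algebra_simps diff_divide_distrib add_divide_distrib)
    finally show ?thesis unfolding u(2-6) .
  qed
  ultimately have "((\<lambda>\<tau>. w (moebius M \<tau>) / (l \<tau>)\<^sup>2 - 2 * c / l \<tau>) has_field_derivative
     (w z / (l \<tau>)\<^sup>2 - 2 * c / l \<tau>)\<^sup>2 / 2 + ratfun P N (X z) * (X' z)\<^sup>2 / ((l \<tau>)\<^sup>2)\<^sup>2) (at \<tau>)" by simp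
  thus "(connection_act M w has_field_derivative (connection_act M w \<tau>)\<^sup>2 / 2 +
      ratfun P N (X (moebius M \<tau>)) * (X' (moebius M \<tau>) / (M$2$1 * \<tau> + M$2$2)\<^sup>2)\<^sup>2) (at \<tau>)"
    unfolding connection_act_def[abs_def] lfp z_def c_def by (simp add: power_divide)
  show "X' (moebius M \<tau>) / (M$2$1 * \<tau> + M$2$2)\<^sup>2 \<noteq> 0" using d(4) l unfolding lfp z_def by simp
  show "poly N (X (moebius M \<tau>)) \<noteq> 0" using d(5) by (simp add: z_def)
qed

lemma moebius_mult:
  assumes "B$2$1 * \<tau> + B$2$2 \<noteq> 0"
  shows "moebius (A ** B) \<tau> = moebius A (moebius B \<tau>)"
proof -
  define u where "u = B$1$1 * \<tau> + B$1$2"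
  define v where "v = B$2$1 * \<tau> + B$2$2"
  have v: "v \<noteq> 0" using assms by (simp add: v_def)
  have "moebius (A ** B) \<tau> = (A$1$1 * u + A$1$2 * v) / (A$2$1 * u + A$2$2 * v)"
    by (simp add: moebius_def matrix_matrix_mult_def sum_2 u_def v_def algebra_simps)
  also have "\<dots> = ((A$1$1 * u + A$1$2 * v) / v) / ((A$2$1 * u + A$2$2 * v) / v)"
  proof -
    have "(x / v) / (y / v) = x / y" for x y using v by simp
    thus ?thesis by (rule sym)
  qed
  also have "(A$1$1 * u + A$1$2 * v) / v = A$1$1 * (u / v) + A$1$2" using v by (simp add: add_divide_distrib)
  also have "(A$2$1 * u + A$2$2 * v) / v = A$2$1 * (u / v) + A$2$2" using v by (simp add: add_divide_distrib)
  finally show ?thesis by (simp add: moebius_def u_def v_def)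
qed

lemma moebius_uminus: "moebius (- A) \<tau> = moebius A \<tau>"
proof -
  have "moebius (- A) \<tau> = (- (A$1$1 * \<tau> + A$1$2)) / (- (A$2$1 * \<tau> + A$2$2))"
    by (simp add: moebius_def)
  thus ?thesis unfolding minus_divide_divide by (simp add: moebius_def)
qed

lemma matrix_inv_left_SL2C:
  assumes "M \<in> SL2C" shows "matrix_inv M ** M = mat 1"
proof -
  have "invertible M" using assms by (simp add: SL2C_def invertible_det_nz)
  hence "\<exists>A'. M ** A' = mat 1 \<and> A' ** M = mat 1" by (simp add: invertible_def)
  from someI_ex[OF this] show ?thesis unfolding matrix_inv_def by blast
qed

text \<open>\<open>F = f \<circ> log/(\<pi>i)\<close> is independent of the branch of the logarithm, so near each point a branch may be chosen that is
  holomorphic there.\<close>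
lemma periodic_through_exp:
  assumes f: "f holomorphic_on \<H>" and per: "\<And>\<tau>. \<tau> \<in> \<H> \<Longrightarrow> f (\<tau> + 2) = f \<tau>"
  obtains F where "F holomorphic_on ball 0 1 - {0}"
    "\<And>\<tau>. \<tau> \<in> \<H> \<Longrightarrow> F (exp (pi * \<i> * \<tau>)) = f \<tau>"
proof -
  define lf where "lf q = q / (pi * \<i>)" for q :: complex
  define F where "F q = f (lf (Ln q))" for q
  have pern: "f (\<tau> + 2 * of_nat n) = f \<tau>" if "\<tau> \<in> \<H>" for \<tau> n
  proof (induction n)
    case (Suc n)
    have "\<tau> + 2 * of_nat n \<in> \<H>" using that by (simp add: upper_half_plane_def)
    from per[OF this] Suc show ?case by (simp add: algebra_simps)
  qed simp
  have peri: "f (\<tau> + 2 * of_int k) = f \<tau>" if t: "\<tau> \<in> \<H>" for \<tau> k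
  proof (cases "k \<ge> 0")
    case True
    thus ?thesis using pern[OF t, of "nat k"] by simp
  next
    case False
    have "\<tau> + 2 * of_int k \<in> \<H>" using t by (simp add: upper_half_plane_def)
    from pern[OF this, of "nat (- k)"] False show ?thesis by (simp add: algebra_simps)
  qed
  have Fexp: "F (exp (pi * \<i> * \<tau>)) = f \<tau>" if t: "\<tau> \<in> \<H>" for \<tau>
  proof -
    have "exp (Ln (exp (pi * \<i> * \<tau>))) = exp (pi * \<i> * \<tau>)" by simp
    hence "\<exists>k::int. Ln (exp (pi * \<i> * \<tau>)) = pi * \<i> * \<tau> + (of_int (2 * k) * pi) * \<i>"
      by (rule exp_eq[THEN iffD1])
    then obtain k :: int where "Ln (exp (pi * \<i> * \<tau>)) = pi * \<i> * \<tau> + (of_int (2 * k) * pi) * \<i>" ..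
    hence "lf (Ln (exp (pi * \<i> * \<tau>))) = \<tau> + 2 * of_int k" by (simp add: lf_def field_simps)
    thus ?thesis using peri[OF t] by (simp add: F_def)
  qed
  have "F holomorphic_on ball 0 1 - {0}"
    unfolding holomorphic_on_def
  proof
    fix q0 :: complex assume q0: "q0 \<in> ball 0 1 - {0}"
    define L where "L q = Ln (q / q0) + Ln q0" for q
    define U where "U = (ball 0 1 - {0}) \<inter> {q. Re (q / q0) > 0}"
    have oU: "open U" unfolding U_def using q0 by (intro open_Int open_Collect_less continuous_intros) auto
    have q0U: "q0 \<in> U" using q0 by (simp add: U_def)
    have LH: "lf (L q) \<in> \<H>" "exp (pi * \<i> * lf (L q)) = q" if "q \<in> U" for q
    proof -
      have q: "q \<noteq> 0" "norm q < 1" "q / q0 \<noteq> 0" using that q0 by (auto simp: U_def)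
      have "exp (L q) = q" using q q0 by (simp add: L_def exp_add)
      thus 1: "exp (pi * \<i> * lf (L q)) = q" by (simp add: lf_def)
      have "exp (- pi * Im (lf (L q))) = norm q" using arg_cong[OF 1, of norm] by (simp add: norm_exp_eq_Re)
      hence "exp (- pi * Im (lf (L q))) < exp 0" using q by simp
      hence "pi * Im (lf (L q)) > 0" by (simp only: exp_less_cancel_iff)
      thus "lf (L q) \<in> \<H>" by (simp add: upper_half_plane_def zero_less_mult_iff)
    qed
    have nn: "q / q0 \<notin> \<real>\<^sub>\<le>\<^sub>0" if "q \<in> U" for q
      using that by (auto simp: U_def complex_nonpos_Reals_iff)
    have "(\<lambda>q. lf (L q)) holomorphic_on U" unfolding lf_def L_def
      using nn q0 by (intro holomorphic_intros) auto
    hence "(\<lambda>q. f (lf (L q))) holomorphic_on U"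
      using holomorphic_on_compose_gen[OF _ f, of "\<lambda>q. lf (L q)" U] LH by (auto simp: o_def)
    moreover have "f (lf (L q)) = F q" if "q \<in> U" for q using Fexp[OF LH(1)[OF that]] LH(2)[OF that] by simp
    ultimately have "F holomorphic_on U" by (rule holomorphic_transform)
    thus "F field_differentiable at q0 within ball 0 1 - {0}"
      using oU q0U holomorphic_on_imp_differentiable_at field_differentiable_at_within by blast
  qed
  thus ?thesis using Fexp that by blast
qed

text \<open>Great Picard for \<open>F - E1\<close>, which has no zeros, so that \<open>1/(F - E1) \<rightarrow> 0\<close> means a pole.\<close>
lemma not_essential_of_two_omitted_values:
  assumes F: "F holomorphic_on ball 0 1 - {0}" and E: "E1 \<noteq> E2"
    and om: "\<And>q. q \<in> ball 0 1 - {0} \<Longrightarrow> F q \<noteq> E1 \<and> F q \<noteq> E2"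
  shows "not_essential F (0::complex)"
proof -
  define f where "f q = F q - E1" for q
  have fh: "f holomorphic_on ball 0 1 - {0}" unfolding f_def by (intro holomorphic_intros F)
  have "f q \<noteq> 0 \<and> f q \<noteq> E2 - E1" if "q \<in> ball 0 1 - {0}" for q using om[OF that] by (simp add: f_def)
  from great_Picard[OF open_ball _ _ fh this]
  obtain l where l: "(f \<longlongrightarrow> l) (at 0) \<or> ((inverse \<circ> f) \<longlongrightarrow> l) (at 0)" using E by auto
  have ev: "\<forall>\<^sub>F q in at 0. f q \<noteq> 0"
  proof -
    have "\<forall>\<^sub>F q in at (0::complex). q \<in> ball 0 1 - {0}" by (rule eventually_at_in_open) auto
    thus ?thesis by eventually_elim (use om in \<open>auto simp: f_def\<close>)
  qed
  have nf: "not_essential f 0"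
  proof (cases "(f \<longlongrightarrow> l) (at 0)")
    case True thus ?thesis by (rule tendsto_imp_not_essential)
  next
    case False
    hence i: "((\<lambda>q. inverse (f q)) \<longlongrightarrow> l) (at 0)" using l by (simp add: o_def)
    show ?thesis
    proof (cases "l = 0")
      case True
      have "filterlim (\<lambda>q. inverse (f q)) (at 0) (at 0)"
        using i ev True by (auto simp: filterlim_at elim!: eventually_mono)
      from filterlim_compose[OF filterlim_inverse_at_infinity this]
      have "is_pole f 0" by (simp add: is_pole_def)
      thus ?thesis by (rule is_pole_imp_not_essential)
    next
      case False
      from tendsto_inverse[OF i False] have "(f \<longlongrightarrow> inverse l) (at 0)" by simp
      thus ?thesis by (rule tendsto_imp_not_essential)
    qed
  qed
  have "(f \<longlongrightarrow> c) (at 0) \<Longrightarrow> (F \<longlongrightarrow> c + E1) (at 0)" for c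
    using tendsto_add[of f c "at 0" "\<lambda>_. E1" E1] by (simp add: f_def)
  moreover have "is_pole f 0 \<Longrightarrow> is_pole F 0"
    using tendsto_add_filterlim_at_infinity[of "\<lambda>_. E1" E1 "at 0" f] by (simp add: f_def[abs_def] is_pole_def)
  ultimately show ?thesis using nf unfolding not_essential_def by blast
qed

context parabolic_uniformization
begin

text \<open>With the translation \<open>T\<close> by 2, the matrix \<open>M T M\<^sup>-\<^sup>1\<close>, which lies in \<open>G\<close> up to sign, moves \<open>M\<tau>\<close> to
  \<open>M(\<tau> + 2)\<close>.\<close>
lemma cusp_periodic:
  assumes M: "normalized_cusp G M" and \<tau>: "\<tau> \<in> \<H>"
  shows "chi (moebius M (\<tau> + 2)) = chi (moebius M \<tau>)"
proof -
  define T :: "complex^2^2" where "T = vector [vector [1, 2], vector [0, 1]]"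
  define A where "A = M ** T ** matrix_inv M"
  have MS: "M \<in> SL2R" and A: "A \<in> G \<or> - A \<in> G"
    using M by (auto simp: normalized_cusp_def Let_def A_def T_def)
  have MC: "M \<in> SL2C" using MS by (rule SL2R_imp_SL2C)
  have "A ** M = M ** T" unfolding A_def using matrix_inv_left_SL2C[OF MC]
    by (simp add: matrix_mul_assoc[symmetric])
  hence "moebius A (moebius M \<tau>) = moebius (M ** T) \<tau>"
    using moebius_mult[of M \<tau> A] SL2R_action(1)[OF MS \<tau>] by simp
  also have "\<dots> = moebius M (moebius T \<tau>)"
    by (rule moebius_mult) (simp add: T_def)
  also have "moebius T \<tau> = \<tau> + 2" by (simp add: moebius_def T_def)
  finally have eq: "moebius A (moebius M \<tau>) = moebius M (\<tau> + 2)" .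
  have MH: "moebius M \<tau> \<in> \<H>" by (rule SL2R_action(3)[OF MS \<tau>])
  from A show ?thesis
    using invariant[OF _ MH, of A] invariant[OF _ MH, of "- A"] eq by (auto simp: moebius_uminus)
qed

lemma connection_holomorphic_at_cusp:
  assumes cusp: "normalized_cusp G M"
  shows "holomorphic_at_i_infinity (connection_act M (canonical_connection chi))"
proof -
  have MS: "M \<in> SL2R" using cusp by (simp add: normalized_cusp_def)
  define f where "f \<tau> = chi (moebius M \<tau>)" for \<tau>
  define f1 where "f1 \<tau> = deriv chi (moebius M \<tau>) / (M$2$1 * \<tau> + M$2$2)\<^sup>2" for \<tau>
  define w where "w = connection_act M (canonical_connection chi)"
  have "\<H> \<subseteq> act_domain M \<H>" using SL2R_action[OF MS] by (auto simp: act_domain_def)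
  hence sol: "(f has_field_derivative f1 \<tau>) (at \<tau>)" "(f1 has_field_derivative w \<tau> * f1 \<tau>) (at \<tau>)"
    "f1 \<tau> \<noteq> 0" "poly N (f \<tau>) \<noteq> 0" if "\<tau> \<in> \<H>" for \<tau>
    using schwarz_solution_moebius[OF schwarz SL2R_imp_SL2C[OF MS]] that
    unfolding schwarz_solution_def f_def f1_def w_def by blast+
  have fh: "f holomorphic_on \<H>" using sol(1) open_upper_half_plane by (auto simp: holomorphic_on_open)
  have "f (\<tau> + 2) = f \<tau>" if "\<tau> \<in> \<H>" for \<tau> unfolding f_def by (rule cusp_periodic[OF cusp that])
  from periodic_through_exp[OF fh this]
  obtain F where F: "F holomorphic_on ball 0 1 - {0}" "\<And>\<tau>. \<tau> \<in> \<H> \<Longrightarrow> F (exp (pi * \<i> * \<tau>)) = f \<tau>" by blast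
  have pre: "\<exists>\<tau>\<in>\<H>. q = exp (pi * \<i> * \<tau>)" if q: "q \<in> ball 0 1 - {0}" for q
  proof -
    define \<tau> where "\<tau> = Ln q / (pi * \<i>)"
    have 1: "exp (pi * \<i> * \<tau>) = q" using q by (simp add: \<tau>_def)
    have "exp (- pi * Im \<tau>) = norm q" using arg_cong[OF 1, of norm] by (simp add: norm_exp_eq_Re)
    hence "exp (- pi * Im \<tau>) < exp 0" using q by simp
    hence "pi * Im \<tau> > 0" by (simp only: exp_less_cancel_iff)
    hence "\<tau> \<in> \<H>" by (simp add: upper_half_plane_def zero_less_mult_iff)
    thus ?thesis using 1 by blast
  qed
  have q1: "exp (pi * \<i> * \<tau>) \<in> ball 0 1 - {0}" if "\<tau> \<in> \<H>" for \<tau>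
    using that by (simp add: norm_exp_eq_Re upper_half_plane_def)
  obtain E1 E2 where E: "E1 \<noteq> E2" "poly N E1 = 0" "poly N E2 = 0" using two_cusps by blast
  have "not_essential F 0"
  proof (rule not_essential_of_two_omitted_values[OF F(1) E(1)])
    fix q :: complex assume "q \<in> ball 0 1 - {0}"
    then obtain \<tau> where "\<tau> \<in> \<H>" "q = exp (pi * \<i> * \<tau>)" using pre by blast
    thus "F q \<noteq> E1 \<and> F q \<noteq> E2" using F(2) sol(4) E by metis
  qed
  moreover have iso: "isolated_singularity_at F 0"
    by (rule isolated_singularity_at_holomorphic[OF F(1)]) auto
  ultimately have nD: "not_essential (deriv F) 0" by (rule not_essential_deriv)
  have B: "open (ball 0 1 - {0::complex})" by auto
  have Dh: "deriv F holomorphic_on ball 0 1 - {0}" by (rule holomorphic_deriv[OF F(1) B])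
  have dexp: "((\<lambda>\<tau>. exp (pi * \<i> * \<tau>)) has_field_derivative pi * \<i> * exp (pi * \<i> * \<tau>)) (at \<tau>)" for \<tau> :: complex
    by (auto intro!: derivative_eq_intros)
  \<comment> \<open>\<open>d/d\<tau> = \<pi>i q d/dq\<close>\<close>
  have f1D: "f1 \<tau> = deriv F (exp (pi * \<i> * \<tau>)) * (pi * \<i> * exp (pi * \<i> * \<tau>))" if t: "\<tau> \<in> \<H>" for \<tau>
  proof -
    have "((\<lambda>\<tau>. F (exp (pi * \<i> * \<tau>))) has_field_derivative deriv F (exp (pi * \<i> * \<tau>)) * (pi * \<i> * exp (pi * \<i> * \<tau>))) (at \<tau>)"
      by (rule DERIV_chain2[OF holomorphic_derivI[OF F(1) B q1[OF t]] dexp])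
    hence "(f has_field_derivative deriv F (exp (pi * \<i> * \<tau>)) * (pi * \<i> * exp (pi * \<i> * \<tau>))) (at \<tau>)"
      by (rule has_field_derivative_transform_within_open[OF _ open_upper_half_plane t F(2)])
    thus ?thesis using sol(1)[OF t] DERIV_unique by blast
  qed
  have D0: "deriv F q \<noteq> 0" if "q \<in> ball 0 1 - {0}" for q
    using pre[OF that] f1D sol(3) by force
  have "\<exists>\<^sub>F q in at 0. deriv F q \<noteq> 0"
    using eventually_at_in_open[of "ball 0 1" "0::complex"] D0
    by (intro eventually_frequently) (auto elim!: eventually_mono)
  from zorder_exist[OF isolated_singularity_at_deriv[OF iso] nD this]
  obtain m h r where h0: "h 0 \<noteq> 0" and r: "r > 0" and hh: "h holomorphic_on cball 0 r"
    and Dm: "\<And>q. q \<in> cball 0 r - {0} \<Longrightarrow> deriv F q = h q * (q - 0) powi m \<and> h q \<noteq> 0" by blast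
  define s where "s = min r 1"
  have s: "s > 0" "s \<le> r" "s \<le> 1" using r by (auto simp: s_def)
  have hh: "h holomorphic_on ball 0 s" using hh by (rule holomorphic_on_subset) (use s in auto)
  have hnz: "h q \<noteq> 0" if "q \<in> ball 0 s" for q using Dm[of q] h0 that s by (cases "q = 0") auto
  define g where "g q = pi * \<i> * (1 + of_int m + q * (deriv h q / h q))" for q
  have gh: "g holomorphic_on ball 0 s" unfolding g_def
    using hnz by (intro holomorphic_intros hh) auto
  have "w \<tau> = g (exp (pi * \<i> * \<tau>))" if t: "\<tau> \<in> \<H>" and qs: "exp (pi * \<i> * \<tau>) \<in> ball 0 s" for \<tau>
  proof -
    define q where "q = exp (pi * \<i> * \<tau>)"
    have qB: "q \<in> ball 0 1 - {0}" using q1[OF t] by (simp add: q_def)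
    have q0: "q \<noteq> 0" and qs: "q \<in> ball 0 s" using qs by (simp_all add: q_def)
    have dD: "(deriv F has_field_derivative deriv (deriv F) q) (at q)"
      by (rule holomorphic_derivI[OF Dh B qB])
    have ev: "\<forall>\<^sub>F s in nhds q. deriv F s = h s * (s - 0) powi m"
      by (rule eventually_mono[OF eventually_nhds_in_open[of "ball 0 s - {0}" q]]) (use Dm s q0 qs in auto)
    have ld: "deriv (deriv F) q / deriv F q = of_int m / (q - 0) + deriv h q / h q"
      by (rule log_derivative_of_mult_power_int(2)[OF holomorphic_derivI[OF hh open_ball qs] hnz[OF qs] q0 dD ev])
    have "((\<lambda>\<tau>. deriv F (exp (pi * \<i> * \<tau>)) * (pi * \<i> * exp (pi * \<i> * \<tau>))) has_field_derivative
       deriv (deriv F) q * (pi * \<i> * q) * (pi * \<i> * q) + (pi * \<i> * (pi * \<i> * q)) * deriv F q) (at \<tau>)"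
    proof -
      have "((\<lambda>\<tau>. deriv F (exp (pi * \<i> * \<tau>))) has_field_derivative deriv (deriv F) q * (pi * \<i> * q)) (at \<tau>)"
        unfolding q_def by (rule DERIV_chain2[where g = "\<lambda>\<tau>. exp (pi * \<i> * \<tau>)", OF _ dexp]) (use dD in \<open>simp add: q_def\<close>)
      from DERIV_mult[OF this DERIV_cmult[OF dexp, of "pi * \<i>"]] show ?thesis by (simp add: q_def)
    qed
    hence "(f1 has_field_derivative
       deriv (deriv F) q * (pi * \<i> * q) * (pi * \<i> * q) + (pi * \<i> * (pi * \<i> * q)) * deriv F q) (at \<tau>)"
      by (rule has_field_derivative_transform_within_open[OF _ open_upper_half_plane t]) (simp add: f1D)
    note e = DERIV_unique[OF sol(2)[OF t] this]
    define c where "c = pi * \<i>"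
    define y where "y = deriv (deriv F) q / deriv F q"
    have Dy: "deriv (deriv F) q = y * deriv F q" using D0[OF qB] by (simp add: y_def)
    have "w \<tau> * (deriv F q * (c * q)) = deriv (deriv F) q * (c * q) * (c * q) + (c * (c * q)) * deriv F q"
      using e unfolding f1D[OF t] unfolding q_def[symmetric] unfolding c_def[symmetric] .
    also have "\<dots> = (c * (1 + q * y)) * (deriv F q * (c * q))" unfolding Dy by (simp add: algebra_simps)
    finally have "w \<tau> * (deriv F q * (pi * \<i> * q)) = (pi * \<i> * (1 + q * (deriv (deriv F) q / deriv F q))) * (deriv F q * (pi * \<i> * q))"
      unfolding c_def y_def .
    hence "w \<tau> = pi * \<i> * (1 + q * (deriv (deriv F) q / deriv F q))"
      using D0[OF qB] q0 by simp
    thus ?thesis unfolding ld g_def q_def[symmetric] using q0 by (simp add: algebra_simps)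
  qed
  thus ?thesis unfolding holomorphic_at_i_infinity_def w_def[symmetric] using s(1) gh by blast
qed

end

section \<open>Solutions of the Schwarzian equation are Moebius transforms of the Hauptmodul\<close>

text \<open>A local inverse of \<open>f\<close> at \<open>z\<close>, composed with \<open>Y\<close>. The set \<open>W\<close> on which \<open>f\<close> is injective identifies the lift among the solutions of
  \<open>f x = Y t\<close>.\<close>
lemma holomorphic_lift:
  assumes f: "f holomorphic_on S" "open S" "z \<in> S" "deriv f z \<noteq> 0"
    and Y: "Y holomorphic_on V" "open V" "\<tau> \<in> V" "Y \<tau> = f z"
  obtains r v W where "r > 0" "ball \<tau> r \<subseteq> V" "v holomorphic_on ball \<tau> r" "v \<tau> = z"
    "open W" "z \<in> W" "W \<subseteq> S" "inj_on f W" "\<And>t. t \<in> ball \<tau> r \<Longrightarrow> v t \<in> W \<and> f (v t) = Y t"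
proof -
  obtain \<rho> where \<rho>: "\<rho> > 0" "ball z \<rho> \<subseteq> S" "open (f ` ball z \<rho>)" "inj_on f (ball z \<rho>)"
    using has_complex_derivative_locally_invertible[OF f(1,3,2,4)] by blast
  define W where "W = ball z \<rho>"
  have fW: "f holomorphic_on W" using f(1) \<rho>(2) unfolding W_def by (rule holomorphic_on_subset)
  have "open W" "inj_on f W" using \<rho>(4) by (simp_all add: W_def)
  from holomorphic_has_inverse[OF fW this]
  obtain g where g: "g holomorphic_on f ` W" "\<And>x. x \<in> W \<Longrightarrow> g (f x) = x" by metis
  have "open (V \<inter> Y -` (f ` W))"
    by (rule continuous_open_preimage[OF holomorphic_on_imp_continuous_on[OF Y(1)] Y(2)])
       (use \<rho>(3) in \<open>simp add: W_def\<close>)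
  moreover have "\<tau> \<in> V \<inter> Y -` (f ` W)" using Y(3,4) \<rho>(1) by (simp add: W_def)
  ultimately obtain r where r: "r > 0" "ball \<tau> r \<subseteq> V \<inter> Y -` (f ` W)" using openE by blast
  define v where "v t = g (Y t)" for t
  have "v holomorphic_on ball \<tau> r"
    using holomorphic_on_compose_gen[OF holomorphic_on_subset[OF Y(1)] g(1), of "ball \<tau> r"] r(2)
    by (auto simp: v_def[abs_def] o_def)
  moreover have "v t \<in> W \<and> f (v t) = Y t" if "t \<in> ball \<tau> r" for t
  proof -
    have "t \<in> V \<inter> Y -` (f ` W)" using r(2) that by (rule subsetD)
    then obtain x where "x \<in> W" "Y t = f x" by auto
    thus ?thesis using g(2) by (simp add: v_def)
  qed
  moreover have "v \<tau> = z" using g(2)[of z] \<rho>(1) Y(4) by (simp add: v_def W_def)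
  ultimately show ?thesis using that[of r v W] r \<rho> by (auto simp: W_def)
qed

lemma schwarz_solution_cong:
  assumes X: "schwarz_solution P N V X X' w" and Y: "schwarz_solution P N V Y Y' u"
    and eq: "\<And>t. t \<in> V \<Longrightarrow> X t = Y t" and t: "t \<in> V"
  shows "X' t = Y' t" "w t = u t"
proof -
  have V: "open V" using X by (simp add: schwarz_solution_def)
  have d: "X' s = Y' s" if s: "s \<in> V" for s
  proof -
    have "(X has_field_derivative X' s) (at s)" using X s by (simp add: schwarz_solution_def)
    hence "(Y has_field_derivative X' s) (at s)"
      by (rule has_field_derivative_transform_within_open[OF _ V s eq])
    moreover have "(Y has_field_derivative Y' s) (at s)" using Y s by (simp add: schwarz_solution_def)
    ultimately show ?thesis by (rule DERIV_unique)
  qed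
  show "X' t = Y' t" by (rule d[OF t])
  have "(X' has_field_derivative w t * X' t) (at t)" using X t by (simp add: schwarz_solution_def)
  hence "(Y' has_field_derivative w t * X' t) (at t)"
    by (rule has_field_derivative_transform_within_open[OF _ V t d])
  moreover have "(Y' has_field_derivative u t * Y' t) (at t)" using Y t by (simp add: schwarz_solution_def)
  ultimately have "w t * X' t = u t * Y' t" by (rule DERIV_unique)
  moreover have "Y' t \<noteq> 0" using Y t by (simp add: schwarz_solution_def)
  ultimately show "w t = u t" using d[OF t] by simp
qed

lemma schwarz_solution_subset:
  "schwarz_solution P N V X X' w \<Longrightarrow> open U \<Longrightarrow> U \<subseteq> V \<Longrightarrow> schwarz_solution P N U X X' w"
  by (auto simp: schwarz_solution_def)

text \<open>Let \<open>s = v'\<^sup>-\<^sup>1\<^sup>/\<^sup>2\<close>. The hypotheses say that \<open>s'' = 0\<close> and \<open>(v s)'' = 0\<close>, so \<open>s = c t + d\<close> and \<open>v s = a t + b\<close>, and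
  \<open>v' = s\<^sup>-\<^sup>2\<close> is the condition on the determinant.\<close>
lemma moebius_of_zero_schwarzian:
  assumes r: "r > 0"
    and v: "\<And>t. t \<in> ball \<tau> r \<Longrightarrow> (v has_field_derivative v1 t) (at t)"
    and v1: "\<And>t. t \<in> ball \<tau> r \<Longrightarrow> (v1 has_field_derivative \<kappa> t * v1 t) (at t)"
    and \<kappa>: "\<And>t. t \<in> ball \<tau> r \<Longrightarrow> (\<kappa> has_field_derivative (\<kappa> t)\<^sup>2 / 2) (at t)"
    and nz: "\<And>t. t \<in> ball \<tau> r \<Longrightarrow> v1 t \<noteq> 0"
  obtains M where "M \<in> SL2C" "\<And>t. t \<in> ball \<tau> r \<Longrightarrow> M$2$1 * t + M$2$2 \<noteq> 0 \<and> v t = moebius M t"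
proof -
  have "(\<lambda>t. 1 / v1 t) holomorphic_on ball \<tau> r"
    using v1 nz by (intro holomorphic_intros) (force simp: holomorphic_on_open)+
  then obtain s where s: "s holomorphic_on ball \<tau> r" "\<And>t. t \<in> ball \<tau> r \<Longrightarrow> 1 / v1 t = s t ^ 2"
    using ball_holomorphic_sqrt[of "\<lambda>t. 1 / v1 t" \<tau> r] nz by auto
  have s0: "s t \<noteq> 0" if "t \<in> ball \<tau> r" for t using s(2)[OF that] nz[OF that] by auto
  have v1s: "v1 t = 1 / s t ^ 2" if "t \<in> ball \<tau> r" for t unfolding s(2)[OF that, symmetric] by simp
  have ds: "(s has_field_derivative - (\<kappa> t * s t / 2)) (at t)" if t: "t \<in> ball \<tau> r" for t
  proof -
    have d: "(s has_field_derivative deriv s t) (at t)" by (rule holomorphic_derivI[OF s(1) open_ball t])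
    have "((\<lambda>t. s t ^ 2) has_field_derivative 2 * s t * deriv s t) (at t)"
      by (rule derivative_eq_intros d refl)+ simp
    moreover have "((\<lambda>t. 1 / v1 t) has_field_derivative - (\<kappa> t * v1 t) / (v1 t * v1 t)) (at t)"
      using nz[OF t] by (auto intro!: derivative_eq_intros v1[OF t])
    from has_field_derivative_transform_within_open[OF this open_ball t s(2)]
    have "((\<lambda>t. s t ^ 2) has_field_derivative - (\<kappa> t * v1 t) / (v1 t * v1 t)) (at t)" by simp
    ultimately have "2 * s t * deriv s t = - (\<kappa> t * v1 t) / (v1 t * v1 t)" by (rule DERIV_unique)
    also have "\<dots> = - \<kappa> t * (1 / v1 t)" using nz[OF t] by simp
    also have "\<dots> = - \<kappa> t * s t ^ 2" unfolding s(2)[OF t] ..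
    finally have "s t * (2 * deriv s t + \<kappa> t * s t) = 0" by (simp add: power2_eq_square distrib_left mult_ac)
    hence "2 * deriv s t + \<kappa> t * s t = 0" using s0[OF t] by simp
    hence "2 * deriv s t = - (\<kappa> t * s t)" by (simp add: eq_neg_iff_add_eq_0)
    from arg_cong[OF this, of "\<lambda>x. x / 2"] have "deriv s t = - (\<kappa> t * s t / 2)" by simp
    thus ?thesis using d by simp
  qed
  have ds2: "((\<lambda>t. - (\<kappa> t * s t / 2)) has_field_derivative 0) (at t)" if t: "t \<in> ball \<tau> r" for t
    by (rule DERIV_cong[OF DERIV_minus[OF DERIV_cdivide[OF DERIV_mult[OF \<kappa>[OF t] ds[OF t]]]]])
       (simp add: power2_eq_square)
  obtain c d where c: "\<And>t. t \<in> ball \<tau> r \<Longrightarrow> s t = c * t + d" "\<And>t. t \<in> ball \<tau> r \<Longrightarrow> - (\<kappa> t * s t / 2) = c"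
    using holomorphic_affine[OF ds ds2] by blast
  have sc: "(s has_field_derivative c) (at t)" if t: "t \<in> ball \<tau> r" for t
    using ds[OF t] c(2)[OF t] by simp
  have dvs: "((\<lambda>t. v t * s t) has_field_derivative 1 / s t + v t * c) (at t)" if t: "t \<in> ball \<tau> r" for t
    by (rule DERIV_cong[OF DERIV_mult[OF v[OF t] sc[OF t]]])
       (use s0[OF t] in \<open>simp add: v1s[OF t] power2_eq_square\<close>)
  have dvs2: "((\<lambda>t. 1 / s t + v t * c) has_field_derivative 0) (at t)" if t: "t \<in> ball \<tau> r" for t
  proof (rule DERIV_cong)
    show "((\<lambda>t. 1 / s t + v t * c) has_field_derivative (0 * s t - 1 * c) / (s t * s t) + v1 t * c) (at t)"
      by (intro DERIV_add DERIV_divide DERIV_const sc t s0 DERIV_cmult_right v)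
    show "(0 * s t - 1 * c) / (s t * s t) + v1 t * c = 0" by (simp add: v1s[OF t] power2_eq_square)
  qed
  obtain a b where a: "\<And>t. t \<in> ball \<tau> r \<Longrightarrow> v t * s t = a * t + b" "\<And>t. t \<in> ball \<tau> r \<Longrightarrow> 1 / s t + v t * c = a"
    using holomorphic_affine[OF dvs dvs2] by blast
  define M :: "complex^2^2" where "M = vector [vector [a, b], vector [c, d]]"
  have M: "M$1$1 = a" "M$1$2 = b" "M$2$1 = c" "M$2$2 = d" by (simp_all add: M_def)
  have \<tau>: "\<tau> \<in> ball \<tau> r" using r by simp
  have "a * d - b * c = a * (c * \<tau> + d) - c * (a * \<tau> + b)" by (simp add: algebra_simps)
  also have "\<dots> = a * s \<tau> - c * (v \<tau> * s \<tau>)" by (simp only: a(1)[OF \<tau>] c(1)[OF \<tau>, symmetric])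
  also have "\<dots> = 1" unfolding a(2)[OF \<tau>, symmetric] using s0[OF \<tau>] by (simp add: algebra_simps)
  finally have "M \<in> SL2C" by (simp add: SL2C_def det_2 M)
  moreover have "M$2$1 * t + M$2$2 \<noteq> 0 \<and> v t = moebius M t" if t: "t \<in> ball \<tau> r" for t
    using s0[OF t] a(1)[OF t] c(1)[OF t] unfolding moebius_def M by (metis nonzero_eq_divide_eq)
  ultimately show ?thesis by (rule that)
qed

context parabolic_uniformization
begin

text \<open>Locally \<open>X = chi \<circ> v\<close>. The chain rule for the Schwarzian derivative, \<open>{X,t} = {chi,v} v'\<^sup>2 + {v,t}\<close>, leaves
  \<open>{v,t} = 0\<close>.\<close>
lemma schwarz_solution_is_moebius_transform:
  assumes sol: "schwarz_solution P N V X X' w" and \<tau>: "\<tau> \<in> V"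
  obtains M r where "M \<in> SL2C" "r > 0" "ball \<tau> r \<subseteq> V" "ball \<tau> r \<subseteq> act_domain M \<H>"
    "\<And>t. t \<in> ball \<tau> r \<Longrightarrow> X t = chi (moebius M t)"
proof -
  have V: "open V" using sol by (simp add: schwarz_solution_def)
  have X: "(X has_field_derivative X' t) (at t)" "(X' has_field_derivative w t * X' t) (at t)"
    "(w has_field_derivative (w t)\<^sup>2 / 2 + ratfun P N (X t) * (X' t)\<^sup>2) (at t)"
    "X' t \<noteq> 0" "poly N (X t) \<noteq> 0" if "t \<in> V" for t
    using sol that by (auto simp: schwarz_solution_def)
  define g where "g = canonical_connection chi"
  have C: "(chi has_field_derivative deriv chi t) (at t)" "(deriv chi has_field_derivative g t * deriv chi t) (at t)"
    "(g has_field_derivative (g t)\<^sup>2 / 2 + ratfun P N (chi t) * (deriv chi t)\<^sup>2) (at t)" if "t \<in> \<H>" for t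
    using schwarz that by (auto simp: schwarz_solution_def g_def)
  have Xh: "X holomorphic_on V" using X(1) V by (auto simp: holomorphic_on_open)
  obtain z where z: "z \<in> \<H>" "X \<tau> = chi z" using surjective[OF X(5)[OF \<tau>]] by metis
  obtain r v W where r: "r > 0" "ball \<tau> r \<subseteq> V" and vh: "v holomorphic_on ball \<tau> r"
    and W: "W \<subseteq> \<H>" "\<And>t. t \<in> ball \<tau> r \<Longrightarrow> v t \<in> W \<and> chi (v t) = X t"
    using holomorphic_lift[OF chi_holomorphic open_upper_half_plane z(1) deriv_chi_nz[OF z(1)] Xh V \<tau> z(2)] by metis
  have vH: "v t \<in> \<H>" and vX: "chi (v t) = X t" if "t \<in> ball \<tau> r" for t using W that by auto
  have rV: "t \<in> V" if "t \<in> ball \<tau> r" for t using r(2) that by blast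
  define v1 where "v1 = deriv v"
  have dv: "(v has_field_derivative v1 t) (at t)" if "t \<in> ball \<tau> r" for t
    unfolding v1_def by (rule holomorphic_derivI[OF vh open_ball that])
  have ch: "((\<lambda>t. F (v t)) has_field_derivative F' * v1 t) (at t)"
    if "(F has_field_derivative F') (at (v t))" "t \<in> ball \<tau> r" for F F' t
    using DERIV_chain2[OF that(1) dv[OF that(2)]] .
  have X'v: "X' t = deriv chi (v t) * v1 t" if t: "t \<in> ball \<tau> r" for t
  proof -
    have "((\<lambda>t. chi (v t)) has_field_derivative deriv chi (v t) * v1 t) (at t)" by (rule ch[OF C(1)[OF vH[OF t]] t])
    hence "(X has_field_derivative deriv chi (v t) * v1 t) (at t)"
      by (rule has_field_derivative_transform_within_open[OF _ open_ball t vX])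
    thus ?thesis using X(1)[OF rV[OF t]] DERIV_unique by blast
  qed
  have v10: "v1 t \<noteq> 0" and c0: "deriv chi (v t) \<noteq> 0" if t: "t \<in> ball \<tau> r" for t
    using X(4)[OF rV[OF t]] X'v[OF t] by auto
  define \<kappa> where "\<kappa> t = w t - g (v t) * v1 t" for t
  have v1h: "(v1 has_field_derivative deriv v1 t) (at t)" if t: "t \<in> ball \<tau> r" for t
    unfolding v1_def by (rule holomorphic_derivI[OF holomorphic_deriv[OF vh open_ball] open_ball t])
  have dv1: "(v1 has_field_derivative \<kappa> t * v1 t) (at t)" if t: "t \<in> ball \<tau> r" for t
  proof -
    have "((\<lambda>t. deriv chi (v t) * v1 t) has_field_derivative
        (g (v t) * deriv chi (v t)) * v1 t * v1 t + deriv v1 t * deriv chi (v t)) (at t)"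
      by (rule DERIV_mult[OF ch[OF C(2)[OF vH[OF t]] t] v1h[OF t]])
    moreover have "((\<lambda>t. deriv chi (v t) * v1 t) has_field_derivative w t * X' t) (at t)"
      by (rule has_field_derivative_transform_within_open[OF X(2)[OF rV[OF t]] open_ball t X'v])
    ultimately have "(g (v t) * deriv chi (v t)) * v1 t * v1 t + deriv v1 t * deriv chi (v t) = w t * X' t"
      by (rule DERIV_unique)
    hence "deriv chi (v t) * deriv v1 t = deriv chi (v t) * (\<kappa> t * v1 t)"
      unfolding X'v[OF t] \<kappa>_def by (simp add: algebra_simps)
    hence "deriv v1 t = \<kappa> t * v1 t" using c0[OF t] by simp
    thus ?thesis using v1h[OF t] by simp
  qed
  have d\<kappa>: "(\<kappa> has_field_derivative (\<kappa> t)\<^sup>2 / 2) (at t)" if t: "t \<in> ball \<tau> r" for t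
  proof (rule DERIV_cong)
    let ?Q = "ratfun P N (X t)"
    show "(\<kappa> has_field_derivative ((w t)\<^sup>2 / 2 + ?Q * (X' t)\<^sup>2)
       - (((g (v t))\<^sup>2 / 2 + ?Q * (deriv chi (v t))\<^sup>2) * v1 t * v1 t + \<kappa> t * v1 t * g (v t))) (at t)"
      unfolding \<kappa>_def
      by (rule DERIV_diff[OF X(3)[OF rV[OF t]] DERIV_mult[OF ch[OF C(3)[OF vH[OF t], unfolded vX[OF t]] t] dv1[OF t, unfolded \<kappa>_def]]])
    have alg: "(W\<^sup>2 / 2 + Q * (D * u)\<^sup>2) - ((G\<^sup>2 / 2 + Q * D\<^sup>2) * u * u + (W - G * u) * u * G) = (W - G * u)\<^sup>2 / 2"
      for W Q D u G :: complex
      by (simp add: power2_eq_square algebra_simps add_divide_distrib diff_divide_distrib)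
    show "((w t)\<^sup>2 / 2 + ?Q * (X' t)\<^sup>2)
       - (((g (v t))\<^sup>2 / 2 + ?Q * (deriv chi (v t))\<^sup>2) * v1 t * v1 t + \<kappa> t * v1 t * g (v t)) = (\<kappa> t)\<^sup>2 / 2"
      unfolding X'v[OF t] \<kappa>_def by (rule alg)
  qed
  obtain M where M: "M \<in> SL2C" "\<And>t. t \<in> ball \<tau> r \<Longrightarrow> M$2$1 * t + M$2$2 \<noteq> 0 \<and> v t = moebius M t"
    using moebius_of_zero_schwarzian[OF r(1) dv dv1 d\<kappa> v10] by blast
  show ?thesis
  proof (rule that[OF M(1) r])
    show "ball \<tau> r \<subseteq> act_domain M \<H>" using M(2) vH by (auto simp: act_domain_def)
    show "X t = chi (moebius M t)" if "t \<in> ball \<tau> r" for t using vX[OF that] M(2)[OF that] by simp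
  qed
qed

text \<open>By invariance \<open>chi\<close> and \<open>chi \<circ> M\<close> are the same solution of the Schwarzian equation, so their logarithmic derivatives agree.\<close>
lemma canonical_connection_law:
  assumes M: "M \<in> G" and \<tau>: "\<tau> \<in> \<H>"
  shows "canonical_connection chi (moebius M \<tau>) =
    (M$2$1 * \<tau> + M$2$2)\<^sup>2 * canonical_connection chi \<tau> + 2 * M$2$1 * (M$2$1 * \<tau> + M$2$2)"
proof -
  have MS: "M \<in> SL2R" using M first_kind by (auto simp: fuchsian_group_first_kind_def fuchsian_group_def)
  have "\<H> \<subseteq> act_domain M \<H>" using SL2R_action[OF MS] by (auto simp: act_domain_def)
  from schwarz_solution_subset[OF schwarz_solution_moebius[OF schwarz SL2R_imp_SL2C[OF MS]] open_upper_half_plane this]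
  have "connection_act M (canonical_connection chi) \<tau> = canonical_connection chi \<tau>"
    by (rule schwarz_solution_cong(2)[OF _ schwarz invariant[OF M] \<tau>])
  moreover define l where "l = M$2$1 * \<tau> + M$2$2"
  moreover have "l \<noteq> 0" using SL2R_action(1)[OF MS \<tau>] by (simp add: l_def)
  ultimately have "canonical_connection chi (moebius M \<tau>) / l\<^sup>2 = canonical_connection chi \<tau> + 2 * M$2$1 / l"
    by (simp add: connection_act_def diff_eq_eq)
  hence "canonical_connection chi (moebius M \<tau>) = l\<^sup>2 * (canonical_connection chi \<tau> + 2 * M$2$1 / l)"
    using \<open>l \<noteq> 0\<close> by (simp add: divide_eq_eq mult.commute)
  also have "\<dots> = l\<^sup>2 * canonical_connection chi \<tau> + 2 * M$2$1 * l"
    using \<open>l \<noteq> 0\<close> by (simp add: distrib_left power2_eq_square)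
  finally show ?thesis unfolding l_def .
qed

end

section \<open>Recovering the Hauptmodul from a solution of the eliminated equation\<close>

lemma isCont_eval3:
  assumes "isCont g2 t" "isCont g1 t" "isCont g0 t"
  shows "isCont (\<lambda>t. eval3 D (g2 t) (g1 t) (g0 t)) t"
proof -
  have 2: "isCont (\<lambda>t. poly (poly A [:g1 t:]) (g0 t)) t" for A
  proof (induction A)
    case (pCons a A)
    have "(\<lambda>t. poly (poly (pCons a A) [:g1 t:]) (g0 t)) = (\<lambda>t. poly a (g0 t) + g1 t * poly (poly A [:g1 t:]) (g0 t))" by simp
    thus ?case using pCons assms by (simp only:) (intro continuous_intros)
  qed simp
  show ?thesis
  proof (induction D)
    case (pCons A D)
    have "(\<lambda>t. eval3 (pCons A D) (g2 t) (g1 t) (g0 t)) = (\<lambda>t. poly (poly A [:g1 t:]) (g0 t) + g2 t * eval3 D (g2 t) (g1 t) (g0 t))"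
      by (simp add: eval3_def)
    thus ?case using pCons 2 assms by (simp only:) (intro continuous_intros)
  qed simp
qed

lemma isCont_eval4:
  assumes "isCont g3 t" "isCont g2 t" "isCont g1 t" "isCont g0 t"
  shows "isCont (\<lambda>t. eval4 \<Xi> (g3 t) (g2 t) (g1 t) (g0 t)) t"
proof (induction \<Xi>)
  case (pCons D \<Xi>)
  have "(\<lambda>t. eval4 (pCons D \<Xi>) (g3 t) (g2 t) (g1 t) (g0 t))
     = (\<lambda>t. eval3 D (g2 t) (g1 t) (g0 t) + g3 t * eval4 \<Xi> (g3 t) (g2 t) (g1 t) (g0 t))"
    by (simp add: eval4_def eval3_def)
  thus ?case using pCons isCont_eval3 assms by (simp only:) (intro continuous_intros)
qed simp

lemma filterlim_at_nonzero_DERIV: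
  fixes X :: "complex \<Rightarrow> complex"
  assumes "(X has_field_derivative X') (at t)" "X' \<noteq> 0"
  shows "filterlim X (at (X t)) (at t)"
proof -
  have "((\<lambda>s. (X s - X t) / (s - t)) \<longlongrightarrow> X') (at t)"
    using assms(1) by (simp add: has_field_derivative_iff)
  hence "\<forall>\<^sub>F s in at t. (X s - X t) / (s - t) \<noteq> 0" using assms(2) by (rule tendsto_imp_eventually_ne)
  hence "\<forall>\<^sub>F s in at t. X s \<noteq> X t" by (rule eventually_mono) auto
  moreover have "(X \<longlongrightarrow> X t) (at t)" using DERIV_isCont[OF assms(1)] by (simp add: isCont_def)
  ultimately show ?thesis by (simp add: filterlim_at)
qed

text \<open>If the leading coefficient of \<open>u j2 - j1\<close> stays away from 0, no root escapes to infinity.\<close>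
lemma roots_locally_bounded:
  fixes j1 j2 :: "complex poly"
  assumes deg: "degree (smult u0 j2 - j1) = max (degree j1) (degree j2)" "smult u0 j2 - j1 \<noteq> 0"
  obtains K where "\<forall>\<^sub>F u in nhds u0. \<forall>x. u * poly j2 x = poly j1 x \<longrightarrow> cmod x \<le> K"
proof -
  define m where "m = max (degree j1) (degree j2)"
  have m: "degree j1 \<le> m" "degree j2 \<le> m" by (auto simp: m_def)
  have c: "u0 * coeff j2 m - coeff j1 m \<noteq> 0"
    using leading_coeff_neq_0[OF deg(2)] unfolding deg(1) m_def[symmetric] by simp
  have "((\<lambda>(x, u). u * (poly j2 x / x ^ m) - poly j1 x / x ^ m) \<longlongrightarrow> u0 * coeff j2 m - coeff j1 m) (at_infinity \<times>\<^sub>F nhds u0)"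
    unfolding case_prod_beta
    by (intro tendsto_diff tendsto_mult filterlim_compose[OF poly_over_power_at_infinity[OF m(1)] filterlim_fst]
        filterlim_compose[OF poly_over_power_at_infinity[OF m(2)] filterlim_fst] filterlim_snd)
  from tendsto_imp_eventually_ne[OF this c]
  have "\<forall>\<^sub>F (x, u) in at_infinity \<times>\<^sub>F nhds u0. u * (poly j2 x / x ^ m) - poly j1 x / x ^ m \<noteq> 0"
    by (simp only: case_prod_unfold)
  then obtain A B where A: "eventually A at_infinity" and B: "eventually B (nhds u0)"
    and AB: "\<And>x u. A x \<Longrightarrow> B u \<Longrightarrow> u * (poly j2 x / x ^ m) - poly j1 x / x ^ m \<noteq> 0"
    unfolding eventually_prod_filter by auto
  obtain K where K: "\<And>x. K \<le> cmod x \<Longrightarrow> A x" using A by (auto simp: eventually_at_infinity)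
  have "\<forall>\<^sub>F u in nhds u0. \<forall>x. u * poly j2 x = poly j1 x \<longrightarrow> cmod x \<le> K"
    using B
  proof eventually_elim
    case (elim u)
    show ?case
    proof (intro allI impI)
      fix x assume x: "u * poly j2 x = poly j1 x"
      show "cmod x \<le> K"
      proof (rule ccontr)
        assume "\<not> cmod x \<le> K"
        hence "A x" using K by simp
        from AB[OF this elim] show False using x by (simp add: times_divide_eq_right)
      qed
    qed
  qed
  thus ?thesis by (rule that)
qed

context rational_connection
begin

text \<open>Pointwise common roots \<open>x\<close> of the two relations are available near \<open>\<tau>\<close>, but with no regularity. Along a sequence tending to
  \<open>\<tau>\<close> they accumulate at some \<open>x\<^sub>*\<close>, because they are bounded. There \<open>J = S3\<^sup>2/S2\<^sup>3\<close> is locally invertible, since \<open>W \<noteq> 0\<close>, and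
  \<open>X = J\<^sup>-\<^sup>1 \<circ> u\<close> passes through infinitely many of the chosen roots. So the second relation holds for \<open>X\<close> on a set
  with limit point \<open>\<tau>\<close>, hence identically.\<close>
lemma holomorphic_branch:
  assumes u: "u holomorphic_on V" and v: "v holomorphic_on V" and V: "open V" "\<tau> \<in> V"
    and deg: "degree (smult (u \<tau>) j2 - j1) = max (degree j1) (degree j2)" "smult (u \<tau>) j2 - j1 \<noteq> 0"
    and j: "S3 ^ 2 = j1 * d" "S2 ^ 3 = j2 * d"
    and gen: "\<And>x. u \<tau> * poly j2 x = poly j1 x \<Longrightarrow> poly (S2 * S3 * W * den) x \<noteq> 0"
    and sol: "\<And>t. t \<in> V \<Longrightarrow> \<exists>x. u t * poly j2 x = poly j1 x \<and> v t * (poly S2 x)\<^sup>2 = poly S4 x"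
  obtains X r where "r > 0" "ball \<tau> r \<subseteq> V" "X holomorphic_on ball \<tau> r"
    "\<And>t. t \<in> ball \<tau> r \<Longrightarrow> u t * poly S2 (X t) ^ 3 = (poly S3 (X t))\<^sup>2 \<and> v t * (poly S2 (X t))\<^sup>2 = poly S4 (X t)
       \<and> poly (S2 * S3 * W * den) (X t) \<noteq> 0"
proof -
  obtain K where K: "\<forall>\<^sub>F s in nhds (u \<tau>). \<forall>x. s * poly j2 x = poly j1 x \<longrightarrow> cmod x \<le> K"
    using roots_locally_bounded[OF deg] by blast
  have uc: "isCont u \<tau>" using holomorphic_on_imp_continuous_on[OF u] V by (simp add: continuous_on_eq_continuous_at)
  have un: "(u \<longlongrightarrow> u \<tau>) (nhds \<tau>)" using uc tendsto_at_iff_tendsto_nhds[of u \<tau>] by (simp add: isCont_def)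
  have "\<forall>\<^sub>F t in nhds \<tau>. (\<forall>x. u t * poly j2 x = poly j1 x \<longrightarrow> cmod x \<le> K) \<and> t \<in> V"
    using eventually_compose_filterlim[OF K un] eventually_nhds_in_open[OF V] by eventually_elim blast
  then obtain R where R: "R > 0" "\<And>t. dist t \<tau> < R \<Longrightarrow> (\<forall>x. u t * poly j2 x = poly j1 x \<longrightarrow> cmod x \<le> K) \<and> t \<in> V"
    by (auto simp: eventually_nhds_metric)
  \<comment> \<open>The offset 2 keeps the points within distance \<open>R\<close> of \<open>\<tau>\<close>.\<close>
  define tn where "tn n = \<tau> + of_real (R / real (n + 2))" for n :: nat
  have tn: "dist (tn n) \<tau> < R" "tn n \<noteq> \<tau>" for n
  proof -
    have "R / real (n + 2) < R" using R(1) by (simp add: divide_less_eq)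
    moreover have "dist (tn n) \<tau> = \<bar>R / real (n + 2)\<bar>"
      unfolding tn_def dist_norm by (simp only: add_diff_cancel_left' norm_of_real)
    moreover have "R / real (n + 2) \<ge> 0" using R(1) by simp
    ultimately show "dist (tn n) \<tau> < R" by linarith
    have "of_real (R / real (n + 2)) \<noteq> (0::complex)" using R(1) by (simp only: of_real_eq_0_iff) simp
    thus "tn n \<noteq> \<tau>" unfolding tn_def by (simp only: add_cancel_left_right not_False_eq_True)
  qed
  have tnl: "tn \<longlonglongrightarrow> \<tau>"
  proof -
    have "(\<lambda>n. R / real (n + 2)) \<longlonglongrightarrow> 0" using LIMSEQ_ignore_initial_segment[OF lim_const_over_n[of R], of 2] by simp
    from tendsto_add[OF tendsto_const tendsto_of_real[OF this], of \<tau>] show ?thesis unfolding tn_def by simp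
  qed
  obtain x where x: "\<And>n. u (tn n) * poly j2 (x n) = poly j1 (x n)" "\<And>n. v (tn n) * (poly S2 (x n))\<^sup>2 = poly S4 (x n)"
  proof -
    have "\<forall>n. \<exists>x. u (tn n) * poly j2 x = poly j1 x \<and> v (tn n) * (poly S2 x)\<^sup>2 = poly S4 x"
      using sol R(2)[OF tn(1)] by simp
    from choice[OF this] show ?thesis using that by blast
  qed
  have "x n \<in> cball 0 K" for n using R(2)[OF tn(1)] x(1) by auto
  then obtain xs l where l: "strict_mono l" "(x \<circ> l) \<longlonglongrightarrow> xs"
    using seq_compactE[OF compact_imp_seq_compact[OF compact_cball[of "0::complex" K]], of x] by metis
  have tl: "(\<lambda>n. tn (l n)) \<longlonglongrightarrow> \<tau>" using LIMSEQ_subseq_LIMSEQ[OF tnl l(1)] by (simp add: o_def)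
  have ul: "(\<lambda>n. u (tn (l n))) \<longlonglongrightarrow> u \<tau>" using isCont_tendsto_compose[OF uc tl] .
  have xl: "(\<lambda>n. x (l n)) \<longlonglongrightarrow> xs" using l(2) by (simp add: o_def)
  have "(\<lambda>n. u (tn (l n)) * poly j2 (x (l n))) \<longlonglongrightarrow> u \<tau> * poly j2 xs" by (intro tendsto_intros ul xl)
  moreover have "(\<lambda>n. poly j1 (x (l n))) \<longlonglongrightarrow> poly j1 xs" by (intro tendsto_intros xl)
  ultimately have xs: "u \<tau> * poly j2 xs = poly j1 xs" unfolding x(1) by (rule LIMSEQ_unique)
  have gxs: "poly (S2 * S3 * W * den) xs \<noteq> 0" by (rule gen[OF xs])
  define U where "U = {z. poly (S2 * S3 * W * den) z \<noteq> 0}"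
  have "open U" unfolding U_def by (intro open_Collect_neq continuous_intros)
  moreover have "xs \<in> U" using gxs unfolding U_def by (rule CollectI)
  ultimately have U: "open U" "xs \<in> U" .
  define J where "J z = (poly S3 z)\<^sup>2 / poly S2 z ^ 3" for z
  have Uz: "poly S2 z \<noteq> 0" "poly S3 z \<noteq> 0" "poly W z \<noteq> 0" "poly den z \<noteq> 0" if "z \<in> U" for z
    using that by (auto simp: U_def)
  have jx: "(poly S3 z)\<^sup>2 = poly j1 z * poly d z" "poly S2 z ^ 3 = poly j2 z * poly d z" for z
    using arg_cong[OF j(1), of "\<lambda>p. poly p z"] arg_cong[OF j(2), of "\<lambda>p. poly p z"] by (simp_all add: poly_power)
  have Jj: "J z = s" if "z \<in> U" "s * poly j2 z = poly j1 z" for s z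
  proof -
    have "s * poly S2 z ^ 3 = (poly S3 z)\<^sup>2" unfolding jx using that(2) by (simp add: mult.assoc[symmetric])
    thus ?thesis using Uz(1)[OF that(1)] by (simp add: J_def field_simps)
  qed
  have dJ: "(J has_field_derivative - poly S3 z * poly W z / poly S2 z ^ 4) (at z)" if z: "z \<in> U" for z
  proof (rule DERIV_cong)
    show "(J has_field_derivative ((2 * (poly S3 z) * poly (pderiv S3) z) * poly S2 z ^ 3
       - (poly S3 z)\<^sup>2 * (3 * (poly S2 z)\<^sup>2 * poly (pderiv S2) z)) / (poly S2 z ^ 3 * poly S2 z ^ 3)) (at z)"
      unfolding J_def
    proof (rule DERIV_divide)
      show "((\<lambda>z. (poly S3 z)\<^sup>2) has_field_derivative 2 * poly S3 z * poly (pderiv S3) z) (at z)"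
        by (rule DERIV_cong[OF DERIV_power[OF poly_DERIV]]) simp
      show "((\<lambda>z. poly S2 z ^ 3) has_field_derivative 3 * (poly S2 z)\<^sup>2 * poly (pderiv S2) z) (at z)"
        by (rule DERIV_cong[OF DERIV_power[OF poly_DERIV]]) (simp add: numeral_2_eq_2 power2_eq_square)
    qed (use Uz[OF z] in simp)
    have W: "poly W z = 3 * (poly S3 z * poly (pderiv S2) z) - 2 * (poly S2 z * poly (pderiv S3) z)"
      by (simp add: W_def)
    have n1: "(2 * (poly S3 z) * poly (pderiv S3) z) * poly S2 z ^ 3 - (poly S3 z)\<^sup>2 * (3 * (poly S2 z)\<^sup>2 * poly (pderiv S2) z)
       = (- poly S3 z * poly W z) * (poly S2 z)\<^sup>2"
      unfolding W by (simp add: algebra_simps power2_eq_square power3_eq_cube)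
    have n2: "poly S2 z ^ 3 * poly S2 z ^ 3 = poly S2 z ^ 4 * (poly S2 z)\<^sup>2"
      by (simp add: power_add[symmetric])
    show "((2 * (poly S3 z) * poly (pderiv S3) z) * poly S2 z ^ 3
       - (poly S3 z)\<^sup>2 * (3 * (poly S2 z)\<^sup>2 * poly (pderiv S2) z)) / (poly S2 z ^ 3 * poly S2 z ^ 3)
      = - poly S3 z * poly W z / poly S2 z ^ 4" unfolding n1 n2
      by (rule nonzero_mult_divide_mult_cancel_right) (use Uz(1)[OF z] in simp)
  qed
  have Jh: "J holomorphic_on U" using dJ U(1) by (auto simp: holomorphic_on_open)
  have "deriv J xs \<noteq> 0" using DERIV_imp_deriv[OF dJ[OF U(2)]] Uz[OF U(2)] by simp
  from holomorphic_lift[OF Jh U this u V] Jj[OF U(2) xs]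
  obtain r X Z where r: "r > 0" "ball \<tau> r \<subseteq> V" and X: "X holomorphic_on ball \<tau> r" "X \<tau> = xs"
    and Z: "open Z" "xs \<in> Z" "Z \<subseteq> U" "inj_on J Z" "\<And>t. t \<in> ball \<tau> r \<Longrightarrow> X t \<in> Z \<and> J (X t) = u t" by metis
  have ev1: "\<forall>\<^sub>F n in sequentially. x (l n) \<in> Z" by (rule topological_tendstoD[OF xl Z(1,2)])
  have ev2: "\<forall>\<^sub>F n in sequentially. tn (l n) \<in> ball \<tau> r" by (rule topological_tendstoD[OF tl]) (use r in auto)
  from eventually_conj[OF ev1 ev2]
  obtain n0 where n0: "\<And>n. n \<ge> n0 \<Longrightarrow> x (l n) \<in> Z \<and> tn (l n) \<in> ball \<tau> r" by (auto simp: eventually_sequentially)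
  define T where "T = (\<lambda>n. tn (l n)) ` {n0..}"
  have Tl: "\<tau> islimpt T"
  proof (rule islimpt_sequential[THEN iffD2], intro exI conjI allI)
    show "tn (l (n + n0)) \<in> T - {\<tau>}" for n using tn(2) by (auto simp: T_def)
    show "(\<lambda>n. tn (l (n + n0))) \<longlonglongrightarrow> \<tau>" using LIMSEQ_ignore_initial_segment[OF tl] .
  qed
  have XT: "v t * (poly S2 (X t))\<^sup>2 - poly S4 (X t) = 0" if t: "t \<in> T" for t
  proof -
    obtain n where n: "n \<ge> n0" "t = tn (l n)" using t by (auto simp: T_def)
    have xn: "x (l n) \<in> Z" "t \<in> ball \<tau> r" using n0 n by auto
    have "J (x (l n)) = u t" unfolding n(2) by (rule Jj) (use xn Z(3) x(1) in auto)
    hence "J (x (l n)) = J (X t)" using Z(5)[OF xn(2)] by simp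
    hence "x (l n) = X t" by (rule inj_onD[OF Z(4) _ xn(1)]) (use Z(5)[OF xn(2)] in simp)
    thus ?thesis using x(2)[of "l n"] n(2) by simp
  qed
  have pX: "(\<lambda>t. poly p (X t)) holomorphic_on ball \<tau> r" for p
    unfolding holomorphic_on_open[OF open_ball]
    using DERIV_chain2[OF poly_DERIV holomorphic_derivI[OF X(1) open_ball]] by blast
  have hol: "(\<lambda>t. v t * (poly S2 (X t))\<^sup>2 - poly S4 (X t)) holomorphic_on ball \<tau> r"
    by (intro holomorphic_intros pX holomorphic_on_subset[OF v r(2)])
  show ?thesis
  proof (rule that[OF r X(1)], intro conjI)
    fix t assume t: "t \<in> ball \<tau> r"
    have XU: "X t \<in> U" using Z(3,5) t by blast
    show "poly (S2 * S3 * W * den) (X t) \<noteq> 0" using XU by (simp add: U_def)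
    have "u t = (poly S3 (X t))\<^sup>2 / poly S2 (X t) ^ 3" using Z(5)[OF t] by (simp add: J_def)
    thus "u t * poly S2 (X t) ^ 3 = (poly S3 (X t))\<^sup>2" using Uz(1)[OF XU] by simp
    have "v t * (poly S2 (X t))\<^sup>2 - poly S4 (X t) = 0"
      by (rule analytic_continuation[OF hol open_ball connected_ball _ _ Tl XT t]) (use r n0 in \<open>auto simp: T_def\<close>)
    thus "v t * (poly S2 (X t))\<^sup>2 = poly S4 (X t)" by simp
  qed
qed

lemma connection_act_conn:
  "connection_act M (conn X X' w) \<tau> =
    conn (\<lambda>\<tau>. X (moebius M \<tau>)) (\<lambda>\<tau>. X' (moebius M \<tau>) / (M$2$1 * \<tau> + M$2$2)\<^sup>2) (connection_act M w) \<tau>"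
  by (simp add: connection_act_def conn_def add_divide_distrib)

end

section \<open>The differential equation and its general solution\<close>

lemma connection_act_one [simp]: "connection_act (mat 1) f = f"
  by (simp add: fun_eq_iff connection_act_def moebius_def mat_def)

lemma act_domain_one [simp]: "act_domain (mat 1) U = U"
  by (auto simp: act_domain_def moebius_def mat_def)

lemma mat_one_SL2C: "mat 1 \<in> SL2C" by (simp add: SL2C_def)

lemma connection_act_holomorphic:
  assumes f: "f holomorphic_on U" and U: "open U" and M: "M \<in> SL2C"
  shows "connection_act M f holomorphic_on act_domain M U"
proof -
  have "moebius M holomorphic_on act_domain M U"
    using moebius_has_derivative[OF M] open_act_domain[OF U, of M]
    by (auto simp: holomorphic_on_open act_domain_def)
  hence "(\<lambda>\<tau>. f (moebius M \<tau>)) holomorphic_on act_domain M U"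
    using holomorphic_on_compose_gen[OF _ f, of "moebius M"] by (auto simp: o_def act_domain_def)
  thus ?thesis unfolding connection_act_def[abs_def]
    by (intro holomorphic_intros) (auto simp: act_domain_def)
qed

text \<open>The image of a point, the factor \<open>c \<tau> + d\<close> there and the entry \<open>c\<close> can be prescribed independently; they
  correspond to the value and the first two derivatives of the transformation.\<close>
lemma ex_moebius_with_jet:
  assumes "l \<noteq> 0"
  obtains M where "M \<in> SL2C" "M$2$1 = c" "M$2$1 * \<tau> + M$2$2 = l" "moebius M \<tau> = z"
proof -
  define M :: "complex^2^2" where "M = vector [vector [c * z + 1 / l, z * l - (c * z + 1 / l) * \<tau>], vector [c, l - c * \<tau>]]"
  have M: "M$1$1 = c * z + 1 / l" "M$1$2 = z * l - (c * z + 1 / l) * \<tau>" "M$2$1 = c" "M$2$2 = l - c * \<tau>"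
    by (simp_all add: M_def)
  have "det M = (c * z + 1 / l) * (l - c * \<tau>) - (z * l - (c * z + 1 / l) * \<tau>) * c" by (simp add: det_2 M)
  also have "\<dots> = (c * z + 1 / l) * l - z * l * c" by (simp add: algebra_simps)
  also have "\<dots> = 1" using assms by (simp add: algebra_simps)
  finally have "M \<in> SL2C" by (simp add: SL2C_def)
  moreover have "moebius M \<tau> = z" using assms by (simp add: moebius_def M)
  ultimately show ?thesis using that M by simp
qed

context uniformization_connection
begin

text \<open>If \<open>J = j1/j2\<close> were constant, its derivative and with it \<open>W\<close> would vanish. The fraction has to be reduced, because a common
  root of \<open>S2\<close> and \<open>S3\<close> would be a root of \<open>b\<^sup>2 S2\<^sup>3 - a\<^sup>3 S3\<^sup>2\<close> for all \<open>a\<close> and \<open>b\<close>.\<close>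
lemma invariants_nonconstant:
  obtains j1 j2 d where "S3 ^ 2 = j1 * d" "S2 ^ 3 = j2 * d" "coprime j1 j2" "max (degree j1) (degree j2) > 0"
proof -
  have g: "gcd (S3 ^ 2) (S2 ^ 3) \<noteq> 0" using S2_nz by simp
  obtain j1 j2 where j: "S3 ^ 2 = j1 * gcd (S3 ^ 2) (S2 ^ 3)" "S2 ^ 3 = j2 * gcd (S3 ^ 2) (S2 ^ 3)" "coprime j1 j2"
    using gcd_coprime_exists[OF g] by blast
  have "max (degree j1) (degree j2) > 0"
  proof (rule ccontr)
    assume "\<not> max (degree j1) (degree j2) > 0"
    then obtain c1 c2 where c: "j1 = [:c1:]" "j2 = [:c2:]" by (metis degree_eq_zeroE gr0I max_less_iff_conj max.strict_coboundedI1 max.strict_coboundedI2)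
    have c2: "c2 \<noteq> 0" using j(2) S2_nz by (auto simp: c)
    define k where "k = c1 / c2"
    have "smult k (S2 ^ 3) = smult c1 (gcd (S3 ^ 2) (S2 ^ 3))"
      by (subst j(2)) (simp add: c k_def c2)
    hence e: "S3 ^ 2 = smult k (S2 ^ 3)" using j(1) by (simp add: c)
    hence "pderiv (S3 ^ 2) = smult k (pderiv (S2 ^ 3))" by (simp add: pderiv_smult)
    hence "2 * S3 * pderiv S3 = smult k (3 * S2 ^ 2 * pderiv S2)"
      by (simp add: power2_eq_square power3_eq_cube pderiv_mult algebra_simps smult_add_right)
    hence "2 * S3 * pderiv S3 * S2 = 3 * smult k (S2 ^ 3) * pderiv S2"
      by (simp add: power2_eq_square power3_eq_cube mult_ac)
    also have "\<dots> = 3 * S3 ^ 2 * pderiv S2" using e by simp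
    finally have *: "2 * S3 * pderiv S3 * S2 = 3 * S3 ^ 2 * pderiv S2" .
    have sm: "smult (numeral n) p = numeral n * p" for n and p :: "complex poly"
      by (simp add: numeral_poly)
    have "S3 * W = 3 * S3 ^ 2 * pderiv S2 - 2 * S3 * pderiv S3 * S2"
      unfolding W_def sm by (simp add: algebra_simps power2_eq_square)
    hence "S3 * W = 0" using * by simp
    hence "S3 = 0" using W_nz by simp
    thus False using W_nz by (simp add: W_def)
  qed
  thus ?thesis using that j by blast
qed

end

text \<open>A connection \<open>\<Gamma>\<close>, the equation \<open>\<Xi>\<close> obtained by elimination, and the polynomial \<open>D\<close> whose nonvanishing makes a jet
  generic: the roots \<open>x\<close> of \<open>b\<^sup>2 j2 = a\<^sup>3 j1\<close> then avoid the zeros of \<open>S2 S3 W den\<close>. The domain \<open>U\<close> may contain points where \<open>R(chi)\<close> is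
  given by a fraction with vanishing denominator.\<close>
locale connection_ode = uniformization_connection P N chi G p q
  for P N chi G p q +
  fixes \<Gamma> :: "complex \<Rightarrow> complex" and U :: "complex set" and j1 j2 d :: "complex poly"
    and \<Xi> :: "complex poly poly poly poly" and e :: complex and D :: "complex poly poly poly"
  assumes U: "open U" "U \<subseteq> \<H>" "\<And>\<tau>. \<tau> \<in> \<H> \<Longrightarrow> poly q (chi \<tau>) \<noteq> 0 \<Longrightarrow> \<tau> \<in> U"
    and hol: "\<Gamma> holomorphic_on U"
    and \<Gamma>: "\<And>\<tau>. \<tau> \<in> \<H> \<Longrightarrow> poly q (chi \<tau>) \<noteq> 0 \<Longrightarrow> \<Gamma> \<tau> = conn chi (deriv chi) (canonical_connection chi) \<tau>"
    and j: "S3 ^ 2 = j1 * d" "S2 ^ 3 = j2 * d" "coprime j1 j2" and m: "max (degree j1) (degree j2) > 0"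
    and \<Xi>: "\<And>y3 y2 y1 y0. \<lbrakk>jet_a y1 y0 \<noteq> 0; jet_b y2 y1 y0 \<noteq> 0; (jet_b y2 y1 y0)\<^sup>2 \<noteq> e * jet_a y1 y0 ^ 3\<rbrakk> \<Longrightarrow>
       eval4 \<Xi> y3 y2 y1 y0 = 0 \<longleftrightarrow>
       (\<exists>x. (jet_b y2 y1 y0)\<^sup>2 * poly j2 x = jet_a y1 y0 ^ 3 * poly j1 x \<and>
            jet_c y3 y2 y1 y0 * poly (S2 ^ 2) x = (jet_a y1 y0)\<^sup>2 * poly S4 x)"
    and deg: "\<And>u. u \<noteq> e \<Longrightarrow> degree (smult u j2 - j1) = max (degree j1) (degree j2)"
    and D_nonzero: "D \<noteq> 0" and D_generic: "\<exists>y2 y1 y0. eval3 D y2 y1 y0 \<noteq> 0"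
    and D: "\<And>y2 y1 y0. eval3 D y2 y1 y0 \<noteq> 0 \<longleftrightarrow> jet_a y1 y0 \<noteq> 0 \<and> jet_b y2 y1 y0 \<noteq> 0 \<and>
       (\<forall>u\<in>insert e ((\<lambda>x. poly j1 x / poly j2 x) ` {x. poly (S2 * S3 * W * den) x = 0}).
          (jet_b y2 y1 y0)\<^sup>2 \<noteq> u * jet_a y1 y0 ^ 3)"
begin

lemma j_poly: "(poly S3 z)\<^sup>2 = poly j1 z * poly d z" "poly S2 z ^ 3 = poly j2 z * poly d z"
  using arg_cong[OF j(1), of "\<lambda>p. poly p z"] arg_cong[OF j(2), of "\<lambda>p. poly p z"] by (simp_all add: poly_power)

lemma generic_jet:
  assumes "eval3 D y2 y1 y0 \<noteq> 0"
  shows "jet_a y1 y0 \<noteq> 0" "jet_b y2 y1 y0 \<noteq> 0" "(jet_b y2 y1 y0)\<^sup>2 \<noteq> e * jet_a y1 y0 ^ 3"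
  using assms unfolding D by auto

lemma root_generic:
  assumes g: "eval3 D y2 y1 y0 \<noteq> 0" and x: "(jet_b y2 y1 y0)\<^sup>2 * poly j2 x = jet_a y1 y0 ^ 3 * poly j1 x"
  shows "poly (S2 * S3 * W * den) x \<noteq> 0"
proof
  assume Ax: "poly (S2 * S3 * W * den) x = 0"
  have "poly j2 x \<noteq> 0"
  proof
    assume "poly j2 x = 0"
    moreover from this x generic_jet(1)[OF g] have "poly j1 x = 0" by simp
    ultimately show False using coprime_poly_0[OF j(3), of x] by auto
  qed
  hence "(jet_b y2 y1 y0)\<^sup>2 = poly j1 x / poly j2 x * jet_a y1 y0 ^ 3" using x by (simp add: field_simps)
  thus False using g Ax unfolding D by auto
qed

lemma ex_root:
  assumes g: "eval3 D y2 y1 y0 \<noteq> 0"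
  shows "\<exists>x. (jet_b y2 y1 y0)\<^sup>2 * poly j2 x = jet_a y1 y0 ^ 3 * poly j1 x"
proof -
  define u where "u = (jet_b y2 y1 y0)\<^sup>2 / jet_a y1 y0 ^ 3"
  have "u \<noteq> e" using generic_jet[OF g] by (auto simp: u_def)
  hence "degree (smult u j2 - j1) > 0" using deg m by simp
  then obtain x where "poly (smult u j2 - j1) x = 0" using alg_closed_imp_poly_has_root by blast
  hence "u * poly j2 x = poly j1 x" by simp
  hence "jet_a y1 y0 ^ 3 * (u * poly j2 x) = jet_a y1 y0 ^ 3 * poly j1 x" by simp
  moreover have "jet_a y1 y0 ^ 3 * u = (jet_b y2 y1 y0)\<^sup>2" using generic_jet(1)[OF g] by (simp add: u_def)
  ultimately show ?thesis by (metis mult.assoc)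
qed

lemma root_relation: "b\<^sup>2 * poly S2 x ^ 3 = a ^ 3 * (poly S3 x)\<^sup>2" if "b\<^sup>2 * poly j2 x = a ^ 3 * poly j1 x" for a b
  unfolding j_poly using that by (simp add: mult.assoc[symmetric])

definition "formula_points = {\<tau>\<in>\<H>. poly q (chi \<tau>) \<noteq> 0}"

lemma formula_points: "open formula_points" "formula_points \<subseteq> U" "formula_points \<subseteq> \<H>"
proof -
  have "continuous_on \<H> (\<lambda>\<tau>. poly q (chi \<tau>))"
    using poly_chi_continuous open_upper_half_plane by (auto simp: continuous_on_eq_continuous_at)
  from continuous_open_preimage[OF this open_upper_half_plane, of "-{0}"]
  have "open (\<H> \<inter> (\<lambda>\<tau>. poly q (chi \<tau>)) -` (-{0}))" by (simp add: open_Compl)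
  moreover have "formula_points = \<H> \<inter> (\<lambda>\<tau>. poly q (chi \<tau>)) -` (-{0})" by (auto simp: formula_points_def)
  ultimately show "open formula_points" by simp
qed (use U(3) in \<open>auto simp: formula_points_def\<close>)

definition "chi_transform M \<tau> = chi (moebius M \<tau>)"
definition "deriv_chi_transform M \<tau> = deriv chi (moebius M \<tau>) / (M$2$1 * \<tau> + M$2$2)\<^sup>2"

lemma transform_schwarz_solution:
  assumes "M \<in> SL2C"
  shows "schwarz_solution P N (act_domain M \<H>) (chi_transform M) (deriv_chi_transform M) (connection_act M (canonical_connection chi))"
  using schwarz_solution_moebius[OF schwarz assms] unfolding chi_transform_def[abs_def] deriv_chi_transform_def[abs_def] .

lemma transform_conn:
  assumes t: "t \<in> act_domain M formula_points"
  shows "connection_act M \<Gamma> t = conn (chi_transform M) (deriv_chi_transform M) (connection_act M (canonical_connection chi)) t"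
proof -
  have "moebius M t \<in> formula_points" using t by (simp add: act_domain_def)
  hence "connection_act M \<Gamma> t = connection_act M (conn chi (deriv chi) (canonical_connection chi)) t"
    using \<Gamma> by (simp add: connection_act_def formula_points_def)
  thus ?thesis by (simp add: connection_act_conn chi_transform_def[abs_def] deriv_chi_transform_def[abs_def])
qed

lemma transform_jets:
  assumes M: "M \<in> SL2C" and t: "t \<in> act_domain M formula_points" and f: "f = connection_act M \<Gamma>"
  defines "\<rho> \<equiv> deriv_chi_transform M t / poly den (chi_transform M t)"
  shows "jet_a_at f t = poly S2 (chi_transform M t) * \<rho> ^ 2"
    "jet_b_at f t = poly S3 (chi_transform M t) * \<rho> ^ 3"
    "jet_c_at f t = poly S4 (chi_transform M t) * \<rho> ^ 4"
proof -
  have s: "schwarz_solution P N (act_domain M formula_points) (chi_transform M) (deriv_chi_transform M) (connection_act M (canonical_connection chi))"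
    using transform_schwarz_solution[OF M] open_act_domain[OF formula_points(1)] by (rule schwarz_solution_subset) (use formula_points(3) in \<open>auto simp: act_domain_def\<close>)
  have q: "poly q (chi_transform M t) \<noteq> 0" if "t \<in> act_domain M formula_points" for t
    using that by (simp add: act_domain_def formula_points_def chi_transform_def)
  note jj = jets_of_conn[OF s q _ t, of f, unfolded f, OF _ transform_conn]
  show "jet_a_at f t = poly S2 (chi_transform M t) * \<rho> ^ 2" "jet_b_at f t = poly S3 (chi_transform M t) * \<rho> ^ 3"
    "jet_c_at f t = poly S4 (chi_transform M t) * \<rho> ^ 4"
    unfolding f \<rho>_def using jj(2-4) by blast+
qed

text \<open>Where the jet is generic, \<open>x = chi(M\<tau>)\<close> is a common root. The remaining points are isolated, and there the relation holds by
  continuity.\<close>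
lemma transform_solves:
  assumes M: "M \<in> SL2C"
  shows "solves_ode \<Xi> (act_domain M U) (connection_act M \<Gamma>)"
  unfolding solves_ode_def
proof (intro conjI ballI)
  show oV: "open (act_domain M U)" by (rule open_act_domain[OF U(1)])
  define f where "f = connection_act M \<Gamma>"
  show fV: "connection_act M \<Gamma> holomorphic_on act_domain M U" by (rule connection_act_holomorphic[OF hol U(1) M])
  fix \<tau> assume \<tau>: "\<tau> \<in> act_domain M U"
  have \<tau>H: "\<tau> \<in> act_domain M \<H>" using \<tau> U(2) by (auto simp: act_domain_def)
  define E where "E t = eval4 \<Xi> ((deriv ^^ 3) f t) ((deriv ^^ 2) f t) (deriv f t) (f t)" for t
  have "isCont E \<tau>" unfolding E_def
  proof (rule isCont_eval4)
    note h = holomorphic_iterated_deriv[OF oV fV \<tau>, folded f_def]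
    show "isCont f \<tau>" "isCont (deriv f) \<tau>" "isCont ((deriv ^^ 2) f) \<tau>" using h by (auto intro: DERIV_isCont)
    show "isCont ((deriv ^^ 3) f) \<tau>"
      using holomorphic_derivI[OF holomorphic_higher_deriv[OF fV oV, of 3] oV \<tau>]
      unfolding f_def by (rule DERIV_isCont)
  qed
  hence l1: "E \<midarrow>\<tau>\<rightarrow> E \<tau>" by (simp add: isCont_def)
  define A' where "A' = S2 * S3 * W * den * (j1 - smult e j2)"
  have "j1 - smult e j2 \<noteq> 0"
  proof
    assume "j1 - smult e j2 = 0"
    hence je: "j1 = smult e j2" by simp
    hence "j2 dvd j1" by (simp add: dvd_smult)
    hence "is_unit j2" using j(3) by (metis coprime_common_divisor dvd_refl)
    hence "degree j2 = 0" by (auto simp: is_unit_iff_degree)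
    moreover have "degree j1 \<le> degree j2" unfolding je by (rule degree_smult_le)
    ultimately show False using m by simp
  qed
  hence A': "A' \<noteq> 0" using S2_nz W_nz den_nz by (auto simp: A'_def W_def)
  have "(chi_transform M has_field_derivative deriv_chi_transform M \<tau>) (at \<tau>)" "deriv_chi_transform M \<tau> \<noteq> 0"
    using transform_schwarz_solution[OF M] \<tau>H by (auto simp: schwarz_solution_def)
  from eventually_compose_filterlim[OF poly_eventually_nonzero_at[OF A'] filterlim_at_nonzero_DERIV[OF this]]
  have "\<forall>\<^sub>F t in at \<tau>. poly A' (chi_transform M t) \<noteq> 0" .
  moreover have "\<forall>\<^sub>F t in at \<tau>. t \<in> act_domain M \<H>"
    using eventually_at_in_open'[OF open_act_domain[OF open_upper_half_plane] \<tau>H] .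
  ultimately have "\<forall>\<^sub>F t in at \<tau>. 0 = E t"
  proof eventually_elim
    case (elim t)
    have nz: "poly S2 (chi_transform M t) \<noteq> 0" "poly S3 (chi_transform M t) \<noteq> 0" "poly den (chi_transform M t) \<noteq> 0"
      "poly j1 (chi_transform M t) \<noteq> e * poly j2 (chi_transform M t)"
      using elim(1) by (auto simp: A'_def)
    have t: "t \<in> act_domain M formula_points" using elim(2) nz(3) by (auto simp: act_domain_def formula_points_def chi_transform_def den_def)
    define \<rho> where "\<rho> = deriv_chi_transform M t / poly den (chi_transform M t)"
    have \<rho>: "\<rho> \<noteq> 0" using transform_schwarz_solution[OF M] elim(2) nz(3) by (simp add: schwarz_solution_def \<rho>_def)
    note jt = transform_jets[OF M t f_def, folded \<rho>_def]
    have b2: "(jet_b_at f t)\<^sup>2 = poly j1 (chi_transform M t) * poly d (chi_transform M t) * \<rho> ^ 6"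
      unfolding jt j_poly(1)[symmetric] by (simp add: power_mult_distrib power_mult[symmetric])
    have a3: "jet_a_at f t ^ 3 = poly j2 (chi_transform M t) * poly d (chi_transform M t) * \<rho> ^ 6"
      unfolding jt j_poly(2)[symmetric] by (simp add: power_mult_distrib power_mult[symmetric])
    have dnz: "poly d (chi_transform M t) \<noteq> 0" using j_poly(2)[of "chi_transform M t"] nz(1) by auto
    have "eval4 \<Xi> ((deriv ^^ 3) f t) ((deriv ^^ 2) f t) (deriv f t) (f t) = 0"
    proof (subst \<Xi>)
      show "jet_a_at f t \<noteq> 0" unfolding jt using nz \<rho> by simp
      show "jet_b_at f t \<noteq> 0" unfolding jt using nz \<rho> by simp
      show "(jet_b_at f t)\<^sup>2 \<noteq> e * jet_a_at f t ^ 3"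
        unfolding a3 b2 using nz(4) dnz \<rho> by simp
      show "\<exists>x. (jet_b_at f t)\<^sup>2 * poly j2 x = jet_a_at f t ^ 3 * poly j1 x \<and>
          jet_c_at f t * poly (S2 ^ 2) x = (jet_a_at f t)\<^sup>2 * poly S4 x"
      proof (intro exI conjI)
        show "(jet_b_at f t)\<^sup>2 * poly j2 (chi_transform M t) = jet_a_at f t ^ 3 * poly j1 (chi_transform M t)"
          unfolding a3 b2 by simp
        show "jet_c_at f t * poly (S2 ^ 2) (chi_transform M t)
            = (jet_a_at f t)\<^sup>2 * poly S4 (chi_transform M t)"
          unfolding jt by (simp add: poly_power power_mult_distrib power_mult[symmetric])
      qed
    qed
    thus ?case by (simp add: E_def)
  qed
  from Lim_transform_eventually[OF tendsto_const this] have "E \<midarrow>\<tau>\<rightarrow> 0" .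
  hence "E \<tau> = 0" using l1 tendsto_unique[OF trivial_limit_at] by blast
  thus "eval4 \<Xi> ((deriv ^^ 3) (connection_act M \<Gamma>) \<tau>) ((deriv ^^ 2) (connection_act M \<Gamma>) \<tau>)
         (deriv (connection_act M \<Gamma>) \<tau>) (connection_act M \<Gamma> \<tau>) = 0" by (simp add: E_def f_def)
qed

text \<open>An equation without \<open>f'''\<close> would admit, at a generic jet, every value of \<open>c\<close>; but \<open>c/a\<^sup>2\<close> can only be one of the finitely
  many values of \<open>S4/S2\<^sup>2\<close> at the roots \<open>x\<close>.\<close>
lemma degree_positive: "degree \<Xi> > 0"
proof (rule ccontr)
  assume "\<not> degree \<Xi> > 0"
  then obtain \<xi> where \<xi>: "\<Xi> = [:\<xi>:]" by (metis degree_eq_zeroE gr0I)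
  obtain y2 y1 y0 where g: "eval3 D y2 y1 y0 \<noteq> 0" using D_generic by blast
  let ?a = "jet_a y1 y0" and ?b = "jet_b y2 y1 y0"
  obtain x where x: "?b\<^sup>2 * poly j2 x = ?a ^ 3 * poly j1 x" using ex_root[OF g] by blast
  have S2x: "poly S2 y \<noteq> 0" if "?b\<^sup>2 * poly j2 y = ?a ^ 3 * poly j1 y" for y
    using root_generic[OF g that] by simp
  define y where "y c = c - jet_c 0 y2 y1 y0" for c
  have yc: "jet_c (y c) y2 y1 y0 = c" for c by (simp add: y_def jet_c_def)
  have "eval4 \<Xi> (y (?a\<^sup>2 * poly S4 x / (poly S2 x)\<^sup>2)) y2 y1 y0 = 0"
    using x S2x[OF x] by (subst \<Xi>[OF generic_jet[OF g]]) (auto simp: yc poly_power intro!: exI[of _ x])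
  hence z: "eval4 \<Xi> (y c) y2 y1 y0 = 0" for c unfolding \<xi> by simp
  define R where "R = {x. ?b\<^sup>2 * poly j2 x = ?a ^ 3 * poly j1 x}"
  define u where "u = ?b\<^sup>2 / ?a ^ 3"
  have "u \<noteq> e" using generic_jet[OF g] by (auto simp: u_def)
  hence "degree (smult u j2 - j1) > 0" using deg m by simp
  hence "smult u j2 - j1 \<noteq> 0" by auto
  from poly_roots_finite[OF this] have "finite {x. u * poly j2 x = poly j1 x}" by simp
  moreover have "R \<subseteq> {x. u * poly j2 x = poly j1 x}"
    using generic_jet(1)[OF g] by (auto simp: R_def u_def)
  ultimately have "finite R" by (rule finite_subset[rotated])
  moreover have "c \<in> (\<lambda>x. ?a\<^sup>2 * poly S4 x / (poly S2 x)\<^sup>2) ` R" for c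
  proof -
    obtain x where "?b\<^sup>2 * poly j2 x = ?a ^ 3 * poly j1 x" "c * poly (S2 ^ 2) x = ?a\<^sup>2 * poly S4 x"
      using z[of c] unfolding \<Xi>[OF generic_jet[OF g]] yc by blast
    thus ?thesis using S2x by (intro image_eqI[of _ _ x]) (auto simp: R_def poly_power field_simps)
  qed
  hence im: "(\<lambda>x. ?a\<^sup>2 * poly S4 x / (poly S2 x)\<^sup>2) ` R = UNIV" by blast
  ultimately have "finite ((\<lambda>x. ?a\<^sup>2 * poly S4 x / (poly S2 x)\<^sup>2) ` R)" by (intro finite_imageI)
  thus False unfolding im using infinite_UNIV_char_0 by blast
qed

text \<open>The jet determines \<open>x\<close>, then \<open>\<rho>\<close>, hence \<open>x'\<close>, and by the value of \<open>f\<close> also \<open>x''\<close>. A point \<open>z\<close> with \<open>chi z = x\<close> exists, and the factor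
  \<open>l = c \<tau>\<^sub>0 + d\<close> and the entry \<open>c\<close> adjust the first two derivatives of \<open>chi \<circ> M\<close>.\<close>
lemma initial_values_attained:
  assumes g: "eval3 D y2 y1 y0 \<noteq> 0"
  shows "\<exists>M\<in>SL2C. \<tau>0 \<in> act_domain M U \<and> connection_act M \<Gamma> \<tau>0 = y0 \<and>
     deriv (connection_act M \<Gamma>) \<tau>0 = y1 \<and> (deriv ^^ 2) (connection_act M \<Gamma>) \<tau>0 = y2"
proof -
  let ?a = "jet_a y1 y0" and ?b = "jet_b y2 y1 y0"
  obtain x where x: "?b\<^sup>2 * poly j2 x = ?a ^ 3 * poly j1 x" using ex_root[OF g] by blast
  have nz: "poly S2 x \<noteq> 0" "poly S3 x \<noteq> 0" "poly den x \<noteq> 0"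
    using root_generic[OF g x] by (auto)
  define \<rho> where "\<rho> = ?b * poly S2 x / (?a * poly S3 x)"
  have \<rho>0: "\<rho> \<noteq> 0" using nz generic_jet[OF g] by (simp add: \<rho>_def)
  have wt: "?a = poly S2 x * \<rho> ^ 2" "?b = poly S3 x * \<rho> ^ 3"
    unfolding \<rho>_def using normalization_by_scaling[OF nz(1,2) generic_jet(1)[OF g] root_relation[OF x]] by blast+
  have "poly N x \<noteq> 0" using nz(3) by (simp add: den_def)
  then obtain z where z: "z \<in> \<H>" "chi z = x" using surjective by blast
  \<comment> \<open>The factor by which \<open>M\<close> has to scale \<open>chi'\<close> so that \<open>(chi \<circ> M)' = den(x) \<rho>\<close> at \<open>\<tau>\<^sub>0\<close>.\<close>
  define l where "l = csqrt (deriv chi z / (poly den x * \<rho>))"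
  have l2: "l\<^sup>2 = deriv chi z / (poly den x * \<rho>)" by (simp add: l_def)
  have l0: "l \<noteq> 0"
  proof
    assume "l = 0"
    thus False using l2 deriv_chi_nz[OF z(1)] nz(3) \<rho>0 by simp
  qed
  obtain M where M: "M \<in> SL2C" "M$2$1 = (\<Gamma> z / l\<^sup>2 - y0) * l / 2" "M$2$1 * \<tau>0 + M$2$2 = l" "moebius M \<tau>0 = z"
    using ex_moebius_with_jet[OF l0] by metis
  have \<tau>: "\<tau>0 \<in> act_domain M formula_points" using M l0 z nz(3) by (auto simp: act_domain_def formula_points_def den_def)
  have f0: "connection_act M \<Gamma> \<tau>0 = y0"
    unfolding connection_act_def M(3,4) unfolding M(2) using l0 by simp
  have "deriv_chi_transform M \<tau>0 = deriv chi z / l\<^sup>2" by (simp add: deriv_chi_transform_def M(3,4))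
  also have "\<dots> = poly den x * \<rho>" unfolding l2 using deriv_chi_nz[OF z(1)] by simp
  finally have Y: "deriv_chi_transform M \<tau>0 / poly den x = \<rho>" using nz(3) by simp
  have Xx: "chi_transform M \<tau>0 = x" by (simp add: chi_transform_def M(4) z(2))
  note jt = transform_jets[OF M(1) \<tau> refl, unfolded Xx, unfolded Y f0, folded wt]
  have 1: "deriv (connection_act M \<Gamma>) \<tau>0 = y1" using jt(1) by (simp add: jet_a_def)
  have "(deriv ^^ 2) (connection_act M \<Gamma>) \<tau>0 = y2" using jt(2) unfolding 1 by (simp add: jet_b_def)
  moreover have "\<tau>0 \<in> act_domain M U" using \<tau> formula_points(2) by (auto simp: act_domain_def)
  ultimately show ?thesis using M(1) f0 1 by blast
qed

text \<open>The jet of \<open>f\<close> stays generic near \<open>\<tau>\<^sub>0\<close>, so it yields a holomorphic \<open>X\<close> with \<open>J(X) = b\<^sup>2/a\<^sup>3\<close> and \<open>L(X) = c/a\<^sup>2\<close>. This \<open>X\<close>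
  solves the Schwarzian equation and equals \<open>chi \<circ> M\<close>; then \<open>f\<close> is the connection belonging to \<open>chi \<circ> M\<close>.\<close>
lemma solution_is_transform:
  assumes f: "solves_ode \<Xi> V f" and \<tau>0: "\<tau>0 \<in> V"
    and g0: "eval3 D ((deriv ^^ 2) f \<tau>0) (deriv f \<tau>0) (f \<tau>0) \<noteq> 0"
  shows "\<exists>M\<in>SL2C. \<tau>0 \<in> act_domain M U \<and> (\<forall>\<^sub>F \<tau> in nhds \<tau>0. f \<tau> = connection_act M \<Gamma> \<tau>)"
proof -
  have V: "open V" and fh: "f holomorphic_on V" using f by (auto simp: solves_ode_def)
  define a where "a t = jet_a_at f t" for t
  define b where "b t = jet_b_at f t" for t
  define c where "c t = jet_c_at f t" for t
  have "isCont (\<lambda>t. eval3 D ((deriv ^^ 2) f t) (deriv f t) (f t)) \<tau>0"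
    using holomorphic_iterated_deriv[OF V fh \<tau>0] by (intro isCont_eval3) (auto intro: DERIV_isCont)
  hence "((\<lambda>t. eval3 D ((deriv ^^ 2) f t) (deriv f t) (f t)) \<longlongrightarrow> eval3 D ((deriv ^^ 2) f \<tau>0) (deriv f \<tau>0) (f \<tau>0)) (nhds \<tau>0)"
    using tendsto_at_iff_tendsto_nhds[of "\<lambda>t. eval3 D ((deriv ^^ 2) f t) (deriv f t) (f t)" \<tau>0] by (simp add: isCont_def)
  hence "\<forall>\<^sub>F t in nhds \<tau>0. eval3 D ((deriv ^^ 2) f t) (deriv f t) (f t) \<noteq> 0" using g0 by (rule tendsto_imp_eventually_ne)
  hence "\<forall>\<^sub>F t in nhds \<tau>0. t \<in> V \<and> eval3 D ((deriv ^^ 2) f t) (deriv f t) (f t) \<noteq> 0"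
    using eventually_nhds_in_open[OF V \<tau>0] by eventually_elim blast
  then obtain V' where V': "open V'" "\<tau>0 \<in> V'" "\<And>t. t \<in> V' \<Longrightarrow> t \<in> V \<and> eval3 D ((deriv ^^ 2) f t) (deriv f t) (f t) \<noteq> 0"
    by (auto simp: eventually_nhds)
  have V'V: "V' \<subseteq> V" using V'(3) by blast
  have gen: "a t \<noteq> 0" "b t \<noteq> 0" "(b t)\<^sup>2 \<noteq> e * a t ^ 3" if "t \<in> V'" for t
    using generic_jet[of "(deriv ^^ 2) f t" "deriv f t" "f t"] V'(3)[OF that] by (auto simp: a_def b_def)
  have ah: "a holomorphic_on V'" "b holomorphic_on V'" "c holomorphic_on V'"
  proof -
    have "deriv f holomorphic_on V'" "(deriv ^^ 2) f holomorphic_on V'" "(deriv ^^ 3) f holomorphic_on V'" "f holomorphic_on V'"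
      using holomorphic_on_subset[OF _ V'V] holomorphic_deriv[OF fh V] holomorphic_higher_deriv[OF fh V] fh by blast+
    note h = this
    show "a holomorphic_on V'" "b holomorphic_on V'" "c holomorphic_on V'"
      unfolding a_def[abs_def] b_def[abs_def] c_def[abs_def] jet_a_def jet_b_def jet_c_def
      by (intro holomorphic_intros h; simp)+
  qed
  define u where "u t = (b t)\<^sup>2 / a t ^ 3" for t
  define v where "v t = c t / (a t)\<^sup>2" for t
  have uh: "u holomorphic_on V'" "v holomorphic_on V'" unfolding u_def[abs_def] v_def[abs_def]
    using gen by (auto intro!: holomorphic_intros ah)
  have ue: "u \<tau>0 \<noteq> e" using gen[OF V'(2)] by (auto simp: u_def)
  have cl: "(b t)\<^sup>2 * poly j2 x = a t ^ 3 * poly j1 x" if "u t * poly j2 x = poly j1 x" "t \<in> V'" for t x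
  proof -
    have "a t ^ 3 * (u t * poly j2 x) = (b t)\<^sup>2 * poly j2 x" using gen(1)[OF that(2)] by (simp add: u_def)
    thus ?thesis using that(1) by simp
  qed
  obtain X r where r: "r > 0" "ball \<tau>0 r \<subseteq> V'" and X: "X holomorphic_on ball \<tau>0 r"
    "\<And>t. t \<in> ball \<tau>0 r \<Longrightarrow> u t * poly S2 (X t) ^ 3 = (poly S3 (X t))\<^sup>2 \<and> v t * (poly S2 (X t))\<^sup>2 = poly S4 (X t)
     \<and> poly (S2 * S3 * W * den) (X t) \<noteq> 0"
  proof (rule holomorphic_branch[OF uh V'(1,2) deg[OF ue] _ j(1,2)])
    have "degree (smult (u \<tau>0) j2 - j1) > 0" using deg[OF ue] m by simp
    thus "smult (u \<tau>0) j2 - j1 \<noteq> 0" by auto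
    fix x assume "u \<tau>0 * poly j2 x = poly j1 x"
    from root_generic[OF g0 cl[OF this V'(2), unfolded a_def b_def]]
    show "poly (S2 * S3 * W * den) x \<noteq> 0" by simp
  next
    fix t assume t: "t \<in> V'"
    have "eval4 \<Xi> ((deriv ^^ 3) f t) ((deriv ^^ 2) f t) (deriv f t) (f t) = 0"
      using f V'(3)[OF t] by (auto simp: solves_ode_def)
    then obtain x where x: "(b t)\<^sup>2 * poly j2 x = a t ^ 3 * poly j1 x" "c t * (poly S2 x)\<^sup>2 = (a t)\<^sup>2 * poly S4 x"
      using \<Xi>[of "deriv f t" "f t" "(deriv ^^ 2) f t" "(deriv ^^ 3) f t"] gen[OF t]
      unfolding a_def b_def c_def poly_power by blast
    have "u t * poly j2 x = (b t)\<^sup>2 * poly j2 x / a t ^ 3" by (simp add: u_def)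
    also have "\<dots> = poly j1 x" unfolding x(1) using gen(1)[OF t] by simp
    finally have 1: "u t * poly j2 x = poly j1 x" .
    have "v t * (poly S2 x)\<^sup>2 = c t * (poly S2 x)\<^sup>2 / (a t)\<^sup>2" by (simp add: v_def)
    also have "\<dots> = poly S4 x" unfolding x(2) using gen(1)[OF t] by simp
    finally show "\<exists>x. u t * poly j2 x = poly j1 x \<and> v t * (poly S2 x)\<^sup>2 = poly S4 x" using 1 by blast
  qed blast
  define B0 where "B0 = ball \<tau>0 r"
  have BV: "B0 \<subseteq> V'" "B0 \<subseteq> V" using r(2) V'V by (auto simp: B0_def)
  obtain w' where sol: "schwarz_solution P N B0 X (deriv X) w'" and fc: "\<And>t. t \<in> B0 \<Longrightarrow> f t = conn X (deriv X) w' t"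
  proof (rule conn_of_jets[of B0 f X])
    show "open B0" by (simp add: B0_def)
    show "f holomorphic_on B0" using fh BV(2) by (rule holomorphic_on_subset)
    show "X holomorphic_on B0" using X(1) by (simp add: B0_def)
    fix t assume t: "t \<in> B0"
    have at: "a t \<noteq> 0" "b t \<noteq> 0" using gen BV(1) t by blast+
    note Xt = X(2)[OF t[unfolded B0_def]]
    have "(b t)\<^sup>2 * poly S2 (X t) ^ 3 = a t ^ 3 * (u t * poly S2 (X t) ^ 3)" using at(1) by (simp add: u_def)
    thus "(jet_b_at f t)\<^sup>2 * poly S2 (X t) ^ 3 = jet_a_at f t ^ 3 * (poly S3 (X t))\<^sup>2"
      using Xt unfolding a_def b_def by simp
    have "c t * (poly S2 (X t))\<^sup>2 = (a t)\<^sup>2 * (v t * (poly S2 (X t))\<^sup>2)" using at(1) by (simp add: v_def)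
    thus "jet_c_at f t * (poly S2 (X t))\<^sup>2 = (jet_a_at f t)\<^sup>2 * poly S4 (X t)"
      using Xt unfolding a_def c_def by simp
    show "jet_a_at f t \<noteq> 0 \<and> jet_b_at f t \<noteq> 0 \<and> poly (S2 * S3 * W * den) (X t) \<noteq> 0"
      using Xt at unfolding a_def b_def by blast
  qed blast
  have \<tau>B: "\<tau>0 \<in> B0" using r(1) by (simp add: B0_def)
  obtain M s where M: "M \<in> SL2C" "s > 0" "ball \<tau>0 s \<subseteq> B0" "ball \<tau>0 s \<subseteq> act_domain M \<H>"
    and chi_transform: "\<And>t. t \<in> ball \<tau>0 s \<Longrightarrow> X t = chi (moebius M t)"
    using schwarz_solution_is_moebius_transform[OF sol \<tau>B] by metis
  have ball_U': "t \<in> act_domain M formula_points" if t: "t \<in> ball \<tau>0 s" for t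
  proof -
    have "poly den (X t) \<noteq> 0" using X(2)[of t] M(3) t by (auto simp: B0_def)
    hence "poly q (chi (moebius M t)) \<noteq> 0" using chi_transform[OF t] by (simp add: den_def)
    thus ?thesis using M(4) t by (auto simp: act_domain_def formula_points_def)
  qed
  have "f t = connection_act M \<Gamma> t" if t: "t \<in> ball \<tau>0 s" for t
  proof -
    note s1 = schwarz_solution_subset[OF sol open_ball M(3)]
    note s2 = schwarz_solution_subset[OF transform_schwarz_solution[OF M(1)] open_ball M(4)]
    have XX: "X t = chi_transform M t" if "t \<in> ball \<tau>0 s" for t using chi_transform[OF that] by (simp add: chi_transform_def)
    have "f t = conn X (deriv X) w' t" using fc M(3) t by blast
    also have "\<dots> = conn (chi_transform M) (deriv_chi_transform M) (connection_act M (canonical_connection chi)) t"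
      using schwarz_solution_cong[OF s1 s2 XX t] XX[OF t] by (simp add: conn_def)
    also have "\<dots> = connection_act M \<Gamma> t" using transform_conn[OF ball_U'[OF t]] by simp
    finally show ?thesis .
  qed
  hence "\<forall>\<^sub>F t in nhds \<tau>0. f t = connection_act M \<Gamma> t"
    using eventually_nhds_in_open[of "ball \<tau>0 s" \<tau>0] M(2) by (auto elim: eventually_mono)
  moreover have "\<tau>0 \<in> act_domain M U" using ball_U'[of \<tau>0] M(2) formula_points(2) by (auto simp: act_domain_def)
  ultimately show ?thesis using M(1) by blast
qed

end

lemma (in uniformization_connection) general_solution:
  assumes U: "open U" "U \<subseteq> \<H>" "\<And>\<tau>. \<tau> \<in> \<H> \<Longrightarrow> poly q (chi \<tau>) \<noteq> 0 \<Longrightarrow> \<tau> \<in> U"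
    and hol: "\<Gamma> holomorphic_on U"
    and \<Gamma>: "\<And>\<tau>. \<tau> \<in> \<H> \<Longrightarrow> poly q (chi \<tau>) \<noteq> 0 \<Longrightarrow> \<Gamma> \<tau> = conn chi (deriv chi) (canonical_connection chi) \<tau>"
  shows "\<exists>\<Xi>. degree \<Xi> > 0 \<and> solves_ode \<Xi> U \<Gamma> \<and> general_solution_by_transforms \<Xi> U \<Gamma>"
proof -
  obtain j1 j2 d where j: "S3 ^ 2 = j1 * d" "S2 ^ 3 = j2 * d" "coprime j1 j2" and m: "max (degree j1) (degree j2) > 0"
    by (rule invariants_nonconstant)
  have jnz: "j1 \<noteq> 0 \<or> j2 \<noteq> 0" using m by auto
  obtain \<Xi> e where
    \<Xi>: "\<And>y3 y2 y1 y0. \<lbrakk>jet_a y1 y0 \<noteq> 0; jet_b y2 y1 y0 \<noteq> 0; (jet_b y2 y1 y0)\<^sup>2 \<noteq> e * jet_a y1 y0 ^ 3\<rbrakk> \<Longrightarrow>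
       eval4 \<Xi> y3 y2 y1 y0 = 0 \<longleftrightarrow>
       (\<exists>x. (jet_b y2 y1 y0)\<^sup>2 * poly j2 x = jet_a y1 y0 ^ 3 * poly j1 x \<and>
            jet_c y3 y2 y1 y0 * poly (S2 ^ 2) x = (jet_a y1 y0)\<^sup>2 * poly S4 x)"
    and deg: "\<And>u. u \<noteq> e \<Longrightarrow> degree (smult u j2 - j1) = max (degree j1) (degree j2)"
    using elimination[OF jnz, of "S2 ^ 2" S4] by metis
  define B where "B = insert e ((\<lambda>x. poly j1 x / poly j2 x) ` {x. poly (S2 * S3 * W * den) x = 0})"
  have "S2 * S3 * W * den \<noteq> 0" using S2_nz W_nz den_nz by (auto simp: W_def)
  hence "finite B" unfolding B_def by (intro finite.insertI finite_imageI poly_roots_finite)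
  then obtain D where D: "D \<noteq> 0" "\<exists>y2 y1 y0. eval3 D y2 y1 y0 \<noteq> 0"
    and DB: "\<And>y2 y1 y0. eval3 D y2 y1 y0 \<noteq> 0 \<longleftrightarrow> jet_a y1 y0 \<noteq> 0 \<and> jet_b y2 y1 y0 \<noteq> 0 \<and>
       (\<forall>u\<in>B. (jet_b y2 y1 y0)\<^sup>2 \<noteq> u * jet_a y1 y0 ^ 3)"
    using generic_locus by metis
  interpret connection_ode P N chi G p q \<Gamma> U j1 j2 d \<Xi> e D
    by (rule connection_ode.intro[OF uniformization_connection_axioms],
        rule connection_ode_axioms.intro[OF U hol \<Gamma> j m \<Xi> deg D DB[unfolded B_def]])
  have "solves_ode \<Xi> U \<Gamma>" using transform_solves[OF mat_one_SL2C] by simp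
  moreover have "general_solution_by_transforms \<Xi> U \<Gamma>"
    unfolding general_solution_by_transforms_def
  proof (intro conjI ballI exI[of _ D] allI impI)
    show "D \<noteq> 0" by (rule D_nonzero)
  qed (use transform_solves initial_values_attained solution_is_transform in \<open>blast+\<close>)
  ultimately show ?thesis using degree_positive by blast
qed

section \<open>The theorem\<close>

lemma open_regular_points:
  assumes "\<Gamma> nicely_meromorphic_on \<H>"
  shows "open (regular_points \<Gamma>)" "\<Gamma> holomorphic_on regular_points \<Gamma>"
proof -
  have an: "\<Gamma> analytic_on {\<tau>}" if "\<tau> \<in> regular_points \<Gamma>" for \<tau>
    using nicely_meromorphic_on_imp_analytic_at[OF assms] that by (simp add: regular_points_def)
  thus "\<Gamma> holomorphic_on regular_points \<Gamma>"
    using analytic_imp_holomorphic analytic_on_analytic_at by blast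
  show "open (regular_points \<Gamma>)"
  proof (subst open_subopen, intro ballI)
    fix \<tau> assume \<tau>: "\<tau> \<in> regular_points \<Gamma>"
    then obtain V where V: "open V" "\<tau> \<in> V" "\<Gamma> holomorphic_on V" using an by (auto simp: analytic_at)
    have "V \<inter> \<H> \<subseteq> regular_points \<Gamma>"
      using V analytic_at_imp_no_pole by (auto simp: regular_points_def analytic_at)
    moreover have "open (V \<inter> \<H>)" "\<tau> \<in> V \<inter> \<H>"
      using V open_upper_half_plane \<tau> by (auto simp: regular_points_def)
    ultimately show "\<exists>T. open T \<and> \<tau> \<in> T \<and> T \<subseteq> regular_points \<Gamma>" by blast
  qed
qed

text \<open>The formula for \<open>\<Gamma>\<close> holds off a sparse set and its right-hand side is continuous at \<open>\<tau>\<close>, which excludes a pole and extends the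
  formula to \<open>\<tau>\<close>.\<close>
lemma (in uniformization_connection) regular_where_q_nonzero:
  assumes mero: "\<Gamma> nicely_meromorphic_on \<H>"
    and eq: "\<forall>\<^sub>\<approx>\<tau>\<in>\<H>. \<Gamma> \<tau> = canonical_connection chi \<tau> + ratfun p q (chi \<tau>) * deriv chi \<tau>"
    and \<tau>: "\<tau> \<in> \<H>" and q: "poly q (chi \<tau>) \<noteq> 0"
  shows "\<tau> \<in> regular_points \<Gamma>" "\<Gamma> \<tau> = conn chi (deriv chi) (canonical_connection chi) \<tau>"
proof -
  have s: "(deriv chi has_field_derivative canonical_connection chi \<tau> * deriv chi \<tau>) (at \<tau>)"
    "(canonical_connection chi has_field_derivative (canonical_connection chi \<tau>)\<^sup>2 / 2 + ratfun P N (chi \<tau>) * (deriv chi \<tau>)\<^sup>2) (at \<tau>)"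
    using schwarz \<tau> by (auto simp: schwarz_solution_def)
  have "isCont (\<lambda>t. conn chi (deriv chi) (canonical_connection chi) t) \<tau>"
    unfolding conn_def ratfun_def
    by (intro continuous_intros poly_chi_continuous \<tau> DERIV_isCont[OF s(1)] DERIV_isCont[OF s(2)] q)
  hence "conn chi (deriv chi) (canonical_connection chi) \<midarrow>\<tau>\<rightarrow> conn chi (deriv chi) (canonical_connection chi) \<tau>"
    by (simp add: isCont_def)
  moreover have "\<forall>\<^sub>F t in at \<tau>. conn chi (deriv chi) (canonical_connection chi) t = \<Gamma> t"
    using eventually_cosparse_imp_eventually_at[OF eq \<tau>, of UNIV]
    by eventually_elim (simp add: conn_def)
  ultimately have l: "\<Gamma> \<midarrow>\<tau>\<rightarrow> conn chi (deriv chi) (canonical_connection chi) \<tau>"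
    by (rule Lim_transform_eventually)
  hence np: "\<not> is_pole \<Gamma> \<tau>"
    unfolding is_pole_def by (auto dest: not_tendsto_and_filterlim_at_infinity[OF trivial_limit_at])
  thus "\<tau> \<in> regular_points \<Gamma>" using \<tau> by (simp add: regular_points_def)
  have "\<Gamma> \<midarrow>\<tau>\<rightarrow> \<Gamma> \<tau>" using mero \<tau> np by (auto simp: nicely_meromorphic_on_def)
  thus "\<Gamma> \<tau> = conn chi (deriv chi) (canonical_connection chi) \<tau>"
    using l tendsto_unique[OF trivial_limit_at] by blast
qed

lemma uniformizing_orbifold_imp_parabolic_uniformization:
  assumes N: "N \<noteq> 0" "coprime P N" and par: "only_parabolic_singularities P N"
    and unif: "uniformizing_orbifold P N G chi"
  shows "parabolic_uniformization P N chi G"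
proof -
  have G: "fuchsian_group_first_kind G" and h: "hauptmodul (ratfun P N) G chi"
    and eq: "\<forall>\<^sub>\<approx>\<tau>\<in>\<H>. schwarz_bracket chi \<tau> = ratfun P N (chi \<tau>)"
    using unif by (auto simp: uniformizing_orbifold_def)
  have mero: "chi nicely_meromorphic_on \<H>" and inv: "\<And>M \<tau>. M \<in> G \<Longrightarrow> \<tau> \<in> \<H> \<Longrightarrow> chi (moebius M \<tau>) = chi \<tau>"
    using h by (auto simp: hauptmodul_def)
  have surj: "\<exists>\<tau>\<in>\<H>. chi \<tau> = x" if "poly N x \<noteq> 0" for x
    using h parabolic_at_imp_pole[of P N x] that unfolding hauptmodul_def by blast
  show ?thesis
    using N par G inv surj hauptmodul_regular[OF N(1) par mero surj eq] by unfold_locales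
qed

theorem theorem19:
  fixes P N :: "complex poly" and G :: "(complex^2^2) set" and chi \<Gamma> :: "complex \<Rightarrow> complex"
  assumes "N \<noteq> 0" and "coprime P N"
    and "only_parabolic_singularities P N"
    and "uniformizing_orbifold P N G chi"
  defines "\<Gamma> \<equiv> canonical_connection chi"
  shows "analytic_connection G chi \<Gamma> \<and>
     \<Gamma> holomorphic_on \<H> \<and>
     (normalized_cusp G (mat 1) \<longrightarrow> holomorphic_at_i_infinity \<Gamma>) \<and>
     (\<forall>M. normalized_cusp G M \<longrightarrow> holomorphic_at_i_infinity (connection_act M \<Gamma>)) \<and>
     (\<exists>\<Xi>. degree \<Xi> > 0 \<and> solves_ode \<Xi> \<H> \<Gamma> \<and> general_solution_by_transforms \<Xi> \<H> \<Gamma>) \<and>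
     (\<forall>\<Gamma>'. analytic_connection G chi \<Gamma>' \<longrightarrow>
        (\<exists>\<Xi>. degree \<Xi> > 0 \<and> solves_ode \<Xi> (regular_points \<Gamma>') \<Gamma>' \<and>
              general_solution_by_transforms \<Xi> (regular_points \<Gamma>') \<Gamma>'))"
proof -
  interpret parabolic_uniformization P N chi G
    using uniformizing_orbifold_imp_parabolic_uniformization[OF assms(1-4)] .
  have hol: "\<Gamma> holomorphic_on \<H>"
    using schwarz open_upper_half_plane by (auto simp: schwarz_solution_def \<Gamma>_def holomorphic_on_open)
  have nice: "\<Gamma> nicely_meromorphic_on \<H>"
    using hol open_upper_half_plane by (intro analytic_on_imp_nicely_meromorphic_on) (simp add: analytic_on_open)
  have "\<exists>p q. q \<noteq> 0 \<and> (\<forall>\<^sub>\<approx>\<tau>\<in>\<H>. \<Gamma> \<tau> = canonical_connection chi \<tau> + ratfun p q (chi \<tau>) * deriv chi \<tau>)"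
    by (rule exI[of _ 0], rule exI[of _ 1]) (simp add: \<Gamma>_def ratfun_def)
  moreover have "\<Gamma> (moebius M \<tau>) = (M$2$1 * \<tau> + M$2$2)\<^sup>2 * \<Gamma> \<tau> + 2 * M$2$1 * (M$2$1 * \<tau> + M$2$2)"
    if "M \<in> G" "\<tau> \<in> regular_points \<Gamma>" for M \<tau>
    using canonical_connection_law[OF that(1)] that(2) by (simp add: \<Gamma>_def regular_points_def)
  ultimately have conn: "analytic_connection G chi \<Gamma>"
    using nice unfolding analytic_connection_def by blast
  have cusp: "holomorphic_at_i_infinity (connection_act M \<Gamma>)" if "normalized_cusp G M" for M
    using connection_holomorphic_at_cusp[OF that] by (simp add: \<Gamma>_def)
  have cusp1: "holomorphic_at_i_infinity \<Gamma>" if "normalized_cusp G (mat 1)"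
    using cusp[OF that] by simp
  have ode: "\<exists>\<Xi>. degree \<Xi> > 0 \<and> solves_ode \<Xi> \<H> \<Gamma> \<and> general_solution_by_transforms \<Xi> \<H> \<Gamma>"
  proof -
    interpret uniformization_connection P N chi G 0 1 by unfold_locales simp
    show ?thesis
      by (rule general_solution[OF open_upper_half_plane _ _ hol]) (auto simp: conn_def ratfun_def \<Gamma>_def)
  qed
  have "\<exists>\<Xi>. degree \<Xi> > 0 \<and> solves_ode \<Xi> (regular_points \<Gamma>') \<Gamma>' \<and> general_solution_by_transforms \<Xi> (regular_points \<Gamma>') \<Gamma>'"
    if \<Gamma>': "analytic_connection G chi \<Gamma>'" for \<Gamma>'
  proof -
    obtain p q where pq: "q \<noteq> 0" "\<forall>\<^sub>\<approx>\<tau>\<in>\<H>. \<Gamma>' \<tau> = canonical_connection chi \<tau> + ratfun p q (chi \<tau>) * deriv chi \<tau>"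
      and mero: "\<Gamma>' nicely_meromorphic_on \<H>"
      using \<Gamma>' unfolding analytic_connection_def by blast
    interpret uniformization_connection P N chi G p q by unfold_locales (rule pq)
    show ?thesis
      by (rule general_solution[OF open_regular_points(1)[OF mero] _ _ open_regular_points(2)[OF mero]])
         (use regular_where_q_nonzero[OF mero pq(2)] in \<open>auto simp: regular_points_def\<close>)
  qed
  thus ?thesis using conn hol cusp cusp1 ode by blast
qed

end
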